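(* Let $K=K(n)$ be positive integers with $K\to\infty$ and $n/K\to 0$ as $n\to\infty$. Let the initial laws $\mu_K$ of the walks $Y_K$ be such that \[\frac{\sqrt{n}}{K}\,X_{n,K}(0)\overset{\mathbb{P}}{\underset{n\to\infty}{\longrightarrow}}0 .\] Then the processes \[\Delta Z_{n,K}(t)=\frac{1}{\sqrt{n}}\left(X_{n,K}(t)-X_{n,K}(0)\right),\qquad t\ge 0,\] converge in distribution, as $n\to\infty$, in the space of càdlàg functions $D(\mathbb{R}_+,\mathbb{R})$ endowed with the Skorokhod topology, to $(2W_t)_{t\geq 0}$, where $(W_t)_{t\geq 0}$ is a standard Brownian motion starting from $0$.
   Context: For $K\ge 1$, $V_K=\{-1,+1\}^K$ is the vertex set of the $K$-dimensional hypercube, in which two vertices are adjacent iff they differ in exactly one coordinate. $(Y_K(i))_{i\ge 0}$ is the simple random walk on this graph (at each step a uniformly chosen coordinate, independent of the past, changes sign), started from a probability law $\mu_K$ on $V_K$. $f_K(v)=\sum_{i=1}^K v^{(i)}$ for $v\in V_K$, and $X_{n,K}(t)=f_K(Y_K(\lfloor nt\rfloor))$ for $t\ge 0$. *)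

theory Defs
  imports "HOL-Probability.Probability"
begin

subsection \<open>The simple random walk on the hypercube\<close>

definition hypercube :: "nat \<Rightarrow> (nat \<Rightarrow> int) set" where
  "hypercube K = {1..K} \<rightarrow>\<^sub>E {-1, 1}"

definition flip :: "nat \<Rightarrow> (nat \<Rightarrow> int) \<Rightarrow> (nat \<Rightarrow> int)" where
  "flip j v = v(j := - v j)"

text \<open>
  \<open>\<xi> i\<close> is the coordinate that changes sign in the step from time \<open>i\<close> to time \<open>i + 1\<close>;
  the past at time \<open>i\<close> is the random vector \<open>(Y 0, \<dots>, Y i)\<close>.  Independence is stated for
  the generated \<open>\<sigma>\<close>-algebras because the two random variables have different types.
  The equation for the initial law forces \<open>\<mu>\<close> to be a probability measure on all subsets
  of the hypercube.
\<close>

definition hypercube_walk ::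
  "'a measure \<Rightarrow> nat \<Rightarrow> (nat \<Rightarrow> int) measure \<Rightarrow> (nat \<Rightarrow> 'a \<Rightarrow> nat \<Rightarrow> int) \<Rightarrow> bool" where
  "hypercube_walk M K \<mu> Y \<longleftrightarrow>
     prob_space M \<and>
     (\<forall>i. Y i \<in> measurable M (count_space (hypercube K))) \<and>
     distr M (count_space (hypercube K)) (Y 0) = \<mu> \<and>
     (\<exists>\<xi> :: nat \<Rightarrow> 'a \<Rightarrow> nat. \<forall>i.
        \<xi> i \<in> measurable M (count_space {1..K}) \<and>
        distr M (count_space {1..K}) (\<xi> i) = uniform_count_measure {1..K} \<and>
        prob_space.indep_set M
          (sets (vimage_algebra (space M) (\<xi> i) (count_space {1..K})))
          (sets (vimage_algebra (space M) (\<lambda>\<omega>. \<lambda>j\<in>{..i}. Y j \<omega>)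
             (Pi\<^sub>M {..i} (\<lambda>_. count_space (hypercube K))))) \<and>
        (AE \<omega> in M. Y (Suc i) \<omega> = flip (\<xi> i \<omega>) (Y i \<omega>)))"

definition coord_sum :: "nat \<Rightarrow> (nat \<Rightarrow> int) \<Rightarrow> real" where
  "coord_sum K v = (\<Sum>i = 1..K. real_of_int (v i))"

definition X_proc ::
  "(nat \<Rightarrow> 'a \<Rightarrow> nat \<Rightarrow> int) \<Rightarrow> nat \<Rightarrow> nat \<Rightarrow> real \<Rightarrow> 'a \<Rightarrow> real" where
  "X_proc Y n K t \<omega> = coord_sum K (Y (nat \<lfloor>real n * t\<rfloor>) \<omega>)"

subsection \<open>The Skorokhod space\<close>

definition cadlag_space :: "(real \<Rightarrow> real) set" where
  "cadlag_space = {x \<in> extensional {0..}.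
     (\<forall>t\<ge>0. (x \<longlongrightarrow> x t) (at_right t)) \<and>
     (\<forall>t>0. \<exists>l. (x \<longlongrightarrow> l) (at_left t))}"

definition time_changes :: "(real \<Rightarrow> real) set" where
  "time_changes = {\<theta>. continuous_on {0..} \<theta> \<and> strict_mono_on {0..} \<theta> \<and> \<theta> 0 = 0 \<and>
     filterlim \<theta> at_top at_top}"

definition skorokhod_converges :: "(nat \<Rightarrow> real \<Rightarrow> real) \<Rightarrow> (real \<Rightarrow> real) \<Rightarrow> bool" where
  "skorokhod_converges x a \<longleftrightarrow>
     (\<exists>\<theta>. (\<forall>n. \<theta> n \<in> time_changes) \<and>
        uniform_limit {0..} \<theta> (\<lambda>s. s) sequentially \<and>
        (\<forall>N. uniform_limit {0..N} (\<lambda>n s. x n (\<theta> n s)) a sequentially))"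

text \<open>
  The Skorokhod (\<open>J\<^sub>1\<close>) topology on \<open>D(\<real>\<^sub>+, \<real>)\<close> is the metrizable topology whose convergent
  sequences are those of \<^const>\<open>skorokhod_converges\<close> (Jacod and Shiryaev, Limit Theorems for
  Stochastic Processes, VI.1.14).  As in every metrizable space, its open sets are the
  sequentially open ones; this determines it.
\<close>

definition skorokhod_open :: "(real \<Rightarrow> real) set \<Rightarrow> bool" where
  "skorokhod_open U \<longleftrightarrow> U \<subseteq> cadlag_space \<and>
     (\<forall>a\<in>U. \<forall>x. (\<forall>n. x n \<in> cadlag_space) \<longrightarrow> skorokhod_converges x a \<longrightarrow>
        (\<forall>\<^sub>F n in sequentially. x n \<in> U))"

definition skorokhod_topology :: "(real \<Rightarrow> real) topology" where
  "skorokhod_topology = topology skorokhod_open"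

lemma istopology_skorokhod_open: "istopology skorokhod_open"
  unfolding istopology_def
proof (intro conjI allI impI)
  fix S T assume "skorokhod_open S" "skorokhod_open T"
  then show "skorokhod_open (S \<inter> T)"
    unfolding skorokhod_open_def by (auto simp: eventually_conj_iff)
next
  fix \<K> assume K: "\<forall>U\<in>\<K>. skorokhod_open U"
  show "skorokhod_open (\<Union>\<K>)"
    unfolding skorokhod_open_def
  proof (intro conjI ballI allI impI)
    show "\<Union>\<K> \<subseteq> cadlag_space"
      using K by (auto simp: skorokhod_open_def)
  next
    fix a x assume "a \<in> \<Union>\<K>" and x: "\<forall>n. x n \<in> cadlag_space" "skorokhod_converges x a"
    then obtain U where U: "U \<in> \<K>" "a \<in> U" by blast
    then have "\<forall>\<^sub>F n in sequentially. x n \<in> U"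
      using K x by (auto simp: skorokhod_open_def)
    then show "\<forall>\<^sub>F n in sequentially. x n \<in> \<Union>\<K>"
      by (rule eventually_mono) (use U in blast)
  qed
qed

lemma openin_skorokhod_topology: "openin skorokhod_topology U \<longleftrightarrow> skorokhod_open U"
  by (simp add: skorokhod_topology_def topology_inverse' istopology_skorokhod_open)

lemma topspace_skorokhod_topology: "topspace skorokhod_topology = cadlag_space"
proof -
  have "skorokhod_open cadlag_space"
    by (simp add: skorokhod_open_def)
  then show ?thesis
    unfolding topspace_def openin_skorokhod_topology by (auto simp: skorokhod_open_def)
qed

subsection \<open>Convergence in distribution and in probability\<close>

definition borel_of :: "'a topology \<Rightarrow> 'a measure" where
  "borel_of T = sigma (topspace T) {U. openin T U}"

text \<open>The random elements may live on different probability spaces.\<close>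

definition converges_in_distribution ::
  "'s topology \<Rightarrow> (nat \<Rightarrow> 'a measure) \<Rightarrow> (nat \<Rightarrow> 'a \<Rightarrow> 's) \<Rightarrow> 'b measure \<Rightarrow> ('b \<Rightarrow> 's) \<Rightarrow> bool"
where
  "converges_in_distribution T M Z N Z' \<longleftrightarrow>
     (\<forall>n. Z n \<in> measurable (M n) (borel_of T)) \<and>
     Z' \<in> measurable N (borel_of T) \<and>
     (\<forall>F :: 's \<Rightarrow> real. continuous_map T euclideanreal F \<longrightarrow> bounded (F ` topspace T) \<longrightarrow>
        (\<lambda>n. \<integral>\<omega>. F (Z n \<omega>) \<partial>M n) \<longlonglongrightarrow> (\<integral>\<omega>. F (Z' \<omega>) \<partial>N))"

definition converges_in_prob_zero :: "(nat \<Rightarrow> 'a measure) \<Rightarrow> (nat \<Rightarrow> 'a \<Rightarrow> real) \<Rightarrow> bool" where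
  "converges_in_prob_zero M Z \<longleftrightarrow>
     (\<forall>\<epsilon>>0. (\<lambda>n. measure (M n) {\<omega> \<in> space (M n). \<bar>Z n \<omega>\<bar> > \<epsilon>}) \<longlonglongrightarrow> 0)"

subsection \<open>Brownian motion\<close>

definition standard_brownian_motion :: "'b measure \<Rightarrow> (real \<Rightarrow> 'b \<Rightarrow> real) \<Rightarrow> bool" where
  "standard_brownian_motion N W \<longleftrightarrow>
     prob_space N \<and>
     (\<forall>t\<ge>0. W t \<in> borel_measurable N) \<and>
     (AE \<omega> in N. W 0 \<omega> = 0) \<and>
     (\<forall>\<omega>\<in>space N. continuous_on {0..} (\<lambda>t. W t \<omega>)) \<and>
     (\<forall>s t. 0 \<le> s \<longrightarrow> s < t \<longrightarrow>
        distributed N lborel (\<lambda>\<omega>. W t \<omega> - W s \<omega>) (\<lambda>x. ennreal (normal_density 0 (sqrt (t - s)) x))) \<and>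
     (\<forall>(\<tau> :: nat \<Rightarrow> real) m. 0 \<le> \<tau> 0 \<longrightarrow> strict_mono_on {..m} \<tau> \<longrightarrow>
        prob_space.indep_vars N (\<lambda>_. borel) (\<lambda>i \<omega>. W (\<tau> (Suc i)) \<omega> - W (\<tau> i) \<omega>) {..<m})"

end

theory Submission
  imports Defs "HOL-Real_Asymp.Real_Asymp"
begin

text \<open>
  Let \<open>\<sigma>\<^sub>i = (X\<^sub>i\<^sub>+\<^sub>1 - X\<^sub>i) / 2\<close> be the signs of the increments of the coordinate sum \<open>X\<close>. Given the past,
  \<open>\<sigma>\<^sub>i = \<plusminus>1\<close> has probability \<open>(1 \<mp> X\<^sub>i / K) / 2\<close>, so the law of \<open>(\<sigma>\<^sub>i)\<close> over \<open>L = n m\<close> steps has an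
  explicit density with respect to fair coin flips, whose logarithm is governed by
  \<open>\<Sum>\<^sub>i X\<^sub>i\<^sup>2 / K\<^sup>2\<close>. Under the fair law this has mean of order \<open>n X\<^sub>0\<^sup>2 / K\<^sup>2 + (n / K)\<^sup>2\<close>, which is exactly what
  the hypotheses make vanish. Hence the total variation distance to fair coin flips tends to 0, and
  the claim reduces to Donsker's theorem for the simple random walk.

  Donsker's theorem needs no tightness argument here: since the limit is continuous, it suffices to
  test with functionals that are Lipschitz for a metric of locally uniform convergence, bounded
  continuous functionals being monotone limits of their Lipschitz inf-convolutions. A Lipschitz
  functional changes little when the path is discretised (Doob's inequality with fourth moments), and the
  finitely many block increments that remain converge jointly by the central limit theorem, applied
  through Skorokhod's representation on a product space.
\<close>

section \<open>The locally uniform distance\<close>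

text \<open>Why a second distance: the Skorokhod topology is given only through its convergent
  sequences, and identity time changes make every \<open>lu_dist\<close>-convergent sequence one of
  them. Hence Skorokhod-open sets are \<open>lu_dist\<close>-open, and Skorokhod-continuous
  functionals are sequentially continuous for \<open>lu_dist\<close>.

  The obstacle is measurability. Under \<open>lu_dist\<close> the cadlag space is not separable, and
  a Lipschitz functional need not be measurable for the \<sigma>-algebra of the coordinates. Every
  random path is therefore reached through step paths, which depend continuously on a sequence of
  real random variables.

  Why fourth moments: a horizon m with mesh m^-2 has m^3 blocks of about n / m^2 steps. A
  second-moment bound makes a large oscillation in one block of probability of order m^-2, which
  sums to order m; the fourth moment gives m^-4, which sums to order 1 / m.

  Order of the choices: the allowed oscillation is fixed first, then m, then n. With m fixed the
  number of steps is L = n m, so the limits of n / K and of the scaled initial value are not spoiled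
  by the horizon.\<close>

definition lu_dist :: "(real \<Rightarrow> real) \<Rightarrow> (real \<Rightarrow> real) \<Rightarrow> real" where
  "lu_dist x y = (SUP t\<in>{0..}. min \<bar>x t - y t\<bar> (1 / (1 + t)))"

lemma lu_dist_upper:
  assumes "t \<ge> 0"
  shows "min \<bar>x t - y t\<bar> (1 / (1 + t)) \<le> lu_dist x y"
  unfolding lu_dist_def
proof (rule cSUP_upper)
  show "bdd_above ((\<lambda>t. min \<bar>x t - y t\<bar> (1 / (1 + t))) ` {0..})"
    by (intro bdd_aboveI[of _ 1]) (auto simp: min_le_iff_disj)
qed (use assms in simp)

lemma lu_dist_least:
  assumes "\<And>t. t \<ge> 0 \<Longrightarrow> min \<bar>x t - y t\<bar> (1 / (1 + t)) \<le> c"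
  shows "lu_dist x y \<le> c"
  unfolding lu_dist_def by (rule cSUP_least) (use assms in auto)

lemma lu_dist_nonneg: "0 \<le> lu_dist x y"
  using lu_dist_upper[of 0 x y] by (auto intro: order_trans[rotated])

lemma lu_dist_refl [simp]: "lu_dist x x = 0"
  by (intro antisym lu_dist_nonneg lu_dist_least) auto

lemma lu_dist_commute: "lu_dist x y = lu_dist y x"
  by (simp add: lu_dist_def abs_minus_commute)

lemma lu_dist_triangle: "lu_dist x z \<le> lu_dist x y + lu_dist y z"
proof (rule lu_dist_least)
  fix t :: real assume "t \<ge> 0"
  have "min \<bar>x t - z t\<bar> (1 / (1 + t)) \<le> min \<bar>x t - y t\<bar> (1 / (1 + t)) + min \<bar>y t - z t\<bar> (1 / (1 + t))"
    using \<open>t \<ge> 0\<close> zero_le_divide_1_iff[of "1 + t"] by (auto simp: min_def)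
  also have "\<dots> \<le> lu_dist x y + lu_dist y z"
    by (intro add_mono lu_dist_upper \<open>t \<ge> 0\<close>)
  finally show "min \<bar>x t - z t\<bar> (1 / (1 + t)) \<le> lu_dist x y + lu_dist y z" .
qed

text \<open>From \<open>T\<close> on, the cap 1 / (1 + t) is at most 1 / (1 + T) whatever the paths
  do. The strict bound t < T lets later arguments use that the grid cell of t has index below
  m^3.\<close>

lemma lu_dist_le_horizon:
  assumes "T \<ge> 0" "c \<ge> 0" "\<And>t. 0 \<le> t \<Longrightarrow> t < T \<Longrightarrow> \<bar>x t - y t\<bar> \<le> c"
  shows "lu_dist x y \<le> c + 1 / (1 + T)"
proof (rule lu_dist_least)
  fix t :: real assume t: "t \<ge> 0"
  show "min \<bar>x t - y t\<bar> (1 / (1 + t)) \<le> c + 1 / (1 + T)"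
  proof (cases "t < T")
    case True
    then have "\<bar>x t - y t\<bar> \<le> c" using assms t by simp
    moreover have "0 \<le> 1 / (1 + T)" using assms by simp
    ultimately show ?thesis by linarith
  next
    case False
    then have "1 / (1 + t) \<le> 1 / (1 + T)" using assms by (intro divide_left_mono) auto
    then show ?thesis using assms by linarith
  qed
qed

lemma lu_dist_tendsto_zeroI:
  assumes "\<And>(T::nat) e. e > 0 \<Longrightarrow> \<forall>\<^sub>F n in F. \<forall>t\<in>{0..<real T}. \<bar>x n t - y n t\<bar> \<le> e"
  shows "((\<lambda>n. lu_dist (x n) (y n)) \<longlongrightarrow> 0) F"
proof (rule tendstoI)
  fix e :: real assume e: "e > 0"
  obtain T :: nat where T: "inverse (real (Suc T)) < e / 2"
    using reals_Archimedean[of "e/2"] e by auto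
  have "\<forall>\<^sub>F n in F. \<forall>t\<in>{0..<real T}. \<bar>x n t - y n t\<bar> \<le> e / 2"
    by (rule assms) (use e in simp)
  then show "\<forall>\<^sub>F n in F. dist (lu_dist (x n) (y n)) 0 < e"
  proof (rule eventually_mono)
    fix n assume "\<forall>t\<in>{0..<real T}. \<bar>x n t - y n t\<bar> \<le> e / 2"
    then have "lu_dist (x n) (y n) \<le> e / 2 + 1 / (1 + real T)"
      by (intro lu_dist_le_horizon) (use e in auto)
    then show "dist (lu_dist (x n) (y n)) 0 < e"
      using T lu_dist_nonneg[of "x n" "y n"] by (simp add: inverse_eq_divide)
  qed
qed

lemma lu_dist_imp_skorokhod_converges:
  assumes "(\<lambda>n. lu_dist (x n) a) \<longlonglongrightarrow> 0"
  shows "skorokhod_converges x a"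
  unfolding skorokhod_converges_def
proof (intro exI[of _ "\<lambda>_ s. s"] conjI allI)
  show "(\<lambda>s. s) \<in> time_changes"
    by (auto simp: time_changes_def strict_mono_on_def filterlim_ident)
  show "uniform_limit {0..} (\<lambda>_ s. s) (\<lambda>s. s) sequentially"
    by (auto simp: uniform_limit_iff)
  fix T :: real
  show "uniform_limit {0..T} (\<lambda>n s. x n s) a sequentially"
    unfolding uniform_limit_iff
  proof (intro allI impI)
    fix e :: real assume e: "e > 0"
    \<comment> \<open>Below the cap on all of [0, T], so the minimum in \<open>lu_dist\<close> must
      be attained by the distance of the values. \<open>max T 0\<close> is there because the horizon
      may be negative.\<close>
    define d where "d = min e (1 / (1 + max T 0))"
    have "d > 0" using e by (simp add: d_def)
    then have "\<forall>\<^sub>F n in sequentially. lu_dist (x n) a < d"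
      using assms by (rule order_tendstoD(2)[rotated])
    then show "\<forall>\<^sub>F n in sequentially. \<forall>s\<in>{0..T}. dist (x n s) (a s) < e"
    proof (rule eventually_mono, intro ballI)
      fix n s assume n: "lu_dist (x n) a < d" and s: "s \<in> {0..T}"
      have "min \<bar>x n s - a s\<bar> (1 / (1 + s)) < d"
        using lu_dist_upper[of s "x n" a] n s by auto
      moreover have "d \<le> 1 / (1 + s)"
        using s unfolding d_def by (intro min.coboundedI2 divide_left_mono) auto
      ultimately show "dist (x n s) (a s) < e"
        by (auto simp: dist_real_def d_def min_def split: if_splits)
    qed
  qed
qed

section \<open>Lipschitz functionals and inf-convolutions\<close>

definition lu_lipschitz :: "real \<Rightarrow> ((real \<Rightarrow> real) \<Rightarrow> real) \<Rightarrow> bool" where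
  "lu_lipschitz k G \<longleftrightarrow>
     (\<forall>x\<in>cadlag_space. \<forall>y\<in>cadlag_space. \<bar>G x - G y\<bar> \<le> k * lu_dist x y)"

lemma lu_lipschitzD:
  "lu_lipschitz k G \<Longrightarrow> x \<in> cadlag_space \<Longrightarrow> y \<in> cadlag_space \<Longrightarrow> \<bar>G x - G y\<bar> \<le> k * lu_dist x y"
  by (auto simp: lu_lipschitz_def)

lemma lu_lipschitz_tendsto:
  assumes "lu_lipschitz k G" "((\<lambda>n. lu_dist (x n) a) \<longlongrightarrow> 0) F"
    and "\<And>n. x n \<in> cadlag_space" "a \<in> cadlag_space"
  shows "((\<lambda>n. G (x n)) \<longlongrightarrow> G a) F"
proof (rule LIM_zero_cancel, rule tendsto_rabs_zero_cancel, rule tendsto_sandwich)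
  show "\<forall>\<^sub>F n in F. 0 \<le> \<bar>G (x n) - G a\<bar>" by simp
  show "\<forall>\<^sub>F n in F. \<bar>G (x n) - G a\<bar> \<le> k * lu_dist (x n) a"
    using assms by (intro always_eventually allI lu_lipschitzD) auto
  show "((\<lambda>n. k * lu_dist (x n) a) \<longlongrightarrow> 0) F"
    using tendsto_mult_right_zero[OF assms(2)] by simp
qed simp

text \<open>The Pasch-Hausdorff envelope: the largest \<open>k\<close>-Lipschitz function below
  \<open>F\<close> on \<open>S\<close>, for bounded \<open>F\<close> and nonnegative
  \<open>k\<close>. Two choices of \<open>S\<close> occur: the whole cadlag space, to approximate a
  functional, and the complement of an open set with F = 0, where it is the distance to that
  complement.\<close>

definition inf_conv :: "(real \<Rightarrow> real) set \<Rightarrow> ((real \<Rightarrow> real) \<Rightarrow> real) \<Rightarrow> real \<Rightarrow> (real \<Rightarrow> real) \<Rightarrow> real" where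
  "inf_conv S F k x = (INF y\<in>S. F y + k * lu_dist x y)"

context
  fixes S :: "(real \<Rightarrow> real) set" and F :: "(real \<Rightarrow> real) \<Rightarrow> real" and k B :: real
  assumes S: "S \<noteq> {}" and k: "k \<ge> 0" and B: "\<And>y. y \<in> S \<Longrightarrow> \<bar>F y\<bar> \<le> B"
begin

lemma inf_conv_lower_aux: "y \<in> S \<Longrightarrow> - B \<le> F y + k * lu_dist x y"
  using B[of y] k lu_dist_nonneg[of x y] by (smt (verit) mult_nonneg_nonneg)

lemma inf_conv_le: "y \<in> S \<Longrightarrow> inf_conv S F k x \<le> F y + k * lu_dist x y"
  unfolding inf_conv_def
  by (rule cINF_lower) (auto intro!: bdd_belowI[of _ "-B"] inf_conv_lower_aux)

lemma le_inf_conv: "(\<And>y. y \<in> S \<Longrightarrow> c \<le> F y + k * lu_dist x y) \<Longrightarrow> c \<le> inf_conv S F k x"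
  unfolding inf_conv_def by (rule cINF_greatest) (use S in auto)

lemma inf_conv_ge: "- B \<le> inf_conv S F k x"
  by (rule le_inf_conv) (rule inf_conv_lower_aux)

lemma inf_conv_lipschitz_aux: "inf_conv S F k x \<le> inf_conv S F k x' + k * lu_dist x x'"
proof -
  have "inf_conv S F k x - k * lu_dist x x' \<le> inf_conv S F k x'"
  proof (rule le_inf_conv)
    fix y assume "y \<in> S"
    then have "inf_conv S F k x \<le> F y + k * lu_dist x y" by (rule inf_conv_le)
    moreover have "k * lu_dist x y \<le> k * lu_dist x x' + k * lu_dist x' y"
      using mult_left_mono[OF lu_dist_triangle[of x y x'] k] by (simp add: algebra_simps)
    ultimately show "inf_conv S F k x - k * lu_dist x x' \<le> F y + k * lu_dist x' y" by simp
  qed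
  then show ?thesis by simp
qed

lemma lu_lipschitz_inf_conv: "lu_lipschitz k (inf_conv S F k)"
  unfolding lu_lipschitz_def
proof (intro ballI)
  fix x y
  show "\<bar>inf_conv S F k x - inf_conv S F k y\<bar> \<le> k * lu_dist x y"
    using inf_conv_lipschitz_aux[of x y] inf_conv_lipschitz_aux[of y x]
    by (simp add: lu_dist_commute abs_le_iff)
qed

end

text \<open>The choice y = a gives the upper bound. For the lower bound, points near
  \<open>a\<close> have almost the value F a by sequential continuity, and distant points pay a
  penalty that outgrows the oscillation of \<open>F\<close>.\<close>

lemma inf_conv_tendsto:
  assumes a: "a \<in> cadlag_space" and B: "\<And>y. y \<in> cadlag_space \<Longrightarrow> \<bar>F y\<bar> \<le> B"
    and cont: "\<And>x. (\<And>n. x n \<in> cadlag_space) \<Longrightarrow> (\<lambda>n. lu_dist (x n) a) \<longlonglongrightarrow> 0 \<Longrightarrow> (\<lambda>n. F (x n)) \<longlonglongrightarrow> F a"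
  shows "(\<lambda>k. inf_conv cadlag_space F (real k) a) \<longlonglongrightarrow> F a"
proof (rule tendstoI)
  fix e :: real assume e: "e > 0"
  have "\<exists>d>0. \<forall>y\<in>cadlag_space. lu_dist y a < d \<longrightarrow> F y > F a - e / 2"
  proof (rule ccontr)
    assume "\<not> ?thesis"
    then have "\<forall>n. \<exists>y\<in>cadlag_space. lu_dist y a < inverse (real (Suc n)) \<and> F y \<le> F a - e / 2"
      by (metis inverse_positive_iff_positive not_less of_nat_0_less_iff zero_less_Suc)
    then obtain x where x: "\<And>n. x n \<in> cadlag_space" "\<And>n. lu_dist (x n) a < inverse (real (Suc n))"
      "\<And>n. F (x n) \<le> F a - e / 2" by metis
    have "(\<lambda>n. lu_dist (x n) a) \<longlonglongrightarrow> 0"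
      by (rule tendsto_sandwich[OF _ _ tendsto_const LIMSEQ_inverse_real_of_nat])
         (intro always_eventually allI less_imp_le[OF x(2)] lu_dist_nonneg)+
    from cont[OF x(1) this] have "F a \<le> F a - e / 2"
      by (rule LIMSEQ_le_const2) (use x in auto)
    then show False using e by simp
  qed
  then obtain d where d: "d > 0" "\<And>y. y \<in> cadlag_space \<Longrightarrow> lu_dist y a < d \<Longrightarrow> F y > F a - e / 2"
    by auto
  \<comment> \<open>F varies by at most 2 B, so a penalty k d above 2 B rules out every point at
    distance at least \<open>d\<close>.\<close>
  obtain k0 :: nat where k0: "2 * B / d < real k0" using reals_Archimedean2 by blast
  show "\<forall>\<^sub>F k in sequentially. dist (inf_conv cadlag_space F (real k) a) (F a) < e"
  proof (rule eventually_sequentiallyI[of k0])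
    fix k assume k: "k0 \<le> k"
    have ne: "cadlag_space \<noteq> {}" using a by auto
    have "inf_conv cadlag_space F (real k) a \<le> F a + real k * lu_dist a a"
      by (rule inf_conv_le[where B=B]) (use ne a B in auto)
    moreover have "F a - e / 2 \<le> inf_conv cadlag_space F (real k) a"
    proof (rule le_inf_conv[where B=B])
      fix y assume y: "y \<in> cadlag_space"
      show "F a - e / 2 \<le> F y + real k * lu_dist a y"
      proof (cases "lu_dist a y < d")
        case True
        then have "F a - e / 2 < F y" using d y by (simp add: lu_dist_commute)
        then show ?thesis using lu_dist_nonneg[of a y] by (smt (verit) mult_nonneg_nonneg of_nat_0_le_iff)
      next
        case False
        then have "real k0 * d \<le> real k * lu_dist a y"
          using k d by (intro mult_mono) auto
        moreover have "2 * B \<le> real k0 * d" using k0 d by (simp add: field_simps)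
        ultimately show ?thesis using B[OF a] B[OF y] e by linarith
      qed
    qed (use ne B in auto)
    ultimately show "dist (inf_conv cadlag_space F (real k) a) (F a) < e"
      using e by (simp add: dist_real_def)
  qed
qed

text \<open>\<open>G\<close> is the distance to the complement of \<open>U\<close>. Were it 0 at a
  point of \<open>U\<close>, points outside \<open>U\<close> would converge to that point for
  \<open>lu_dist\<close>, hence in the Skorokhod sense, against sequential openness. An empty
  complement has no such infimum, so there a constant serves.\<close>

lemma skorokhod_open_lipschitz_test:
  assumes U: "skorokhod_open U"
  obtains k G where "lu_lipschitz k G" "\<And>x. x \<in> cadlag_space \<Longrightarrow> x \<in> U \<longleftrightarrow> G x > 0"
proof (cases "cadlag_space - U = {}")
  case True
  show ?thesis by (rule that[of 0 "\<lambda>_. 1"]) (use True in \<open>auto simp: lu_lipschitz_def\<close>)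
next
  case False
  define G where "G = inf_conv (cadlag_space - U) (\<lambda>_. 0) 1"
  have "x \<in> U \<longleftrightarrow> G x > 0" if x: "x \<in> cadlag_space" for x
  proof
    assume "G x > 0"
    show "x \<in> U"
    proof (rule ccontr)
      assume "x \<notin> U"
      then have "G x \<le> 0 + 1 * lu_dist x x"
        unfolding G_def by (intro inf_conv_le[where B=0]) (use x in auto)
      then show False using \<open>G x > 0\<close> by simp
    qed
  next
    assume xU: "x \<in> U"
    show "G x > 0"
    proof (rule ccontr)
      assume "\<not> G x > 0"
      have "\<exists>y\<in>cadlag_space - U. lu_dist y x < inverse (real (Suc n))" for n
      proof (rule ccontr)
        assume "\<not> ?thesis"
        then have "inverse (real (Suc n)) \<le> G x"
          unfolding G_def by (intro le_inf_conv[where B=0]) (use False in \<open>auto simp: lu_dist_commute not_less\<close>)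
        with \<open>\<not> G x > 0\<close> show False by (smt (verit) inverse_positive_iff_positive of_nat_0_less_iff zero_less_Suc)
      qed
      then obtain y where y: "\<And>n. y n \<in> cadlag_space - U" "\<And>n. lu_dist (y n) x < inverse (real (Suc n))"
        by metis
      have "(\<lambda>n. lu_dist (y n) x) \<longlonglongrightarrow> 0"
        by (rule tendsto_sandwich[OF _ _ tendsto_const LIMSEQ_inverse_real_of_nat])
           (intro always_eventually allI less_imp_le[OF y(2)] lu_dist_nonneg)+
      then have "\<forall>\<^sub>F n in sequentially. y n \<in> U"
        using U xU y(1) lu_dist_imp_skorokhod_converges[of y x] unfolding skorokhod_open_def by blast
      then show False using y(1) by (auto simp: eventually_sequentially)
    qed
  qed
  moreover have "lu_lipschitz 1 G"
    unfolding G_def by (rule lu_lipschitz_inf_conv[where B=0]) (use False in auto)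
  ultimately show ?thesis using that by blast
qed

lemma continuous_map_skorokhod_lu:
  assumes F: "continuous_map skorokhod_topology euclideanreal F"
    and x: "\<And>n. x n \<in> cadlag_space" and a: "a \<in> cadlag_space"
    and lim: "(\<lambda>n. lu_dist (x n) a) \<longlonglongrightarrow> 0"
  shows "(\<lambda>n. F (x n)) \<longlonglongrightarrow> F a"
proof (rule topological_tendstoI)
  fix V :: "real set" assume V: "open V" "F a \<in> V"
  have "openin skorokhod_topology {z \<in> topspace skorokhod_topology. F z \<in> V}"
    using F V by (intro openin_continuous_map_preimage[OF F]) auto
  then have "skorokhod_open {z \<in> cadlag_space. F z \<in> V}"
    by (simp add: openin_skorokhod_topology topspace_skorokhod_topology)
  then have "\<forall>\<^sub>F n in sequentially. x n \<in> {z \<in> cadlag_space. F z \<in> V}"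
    using lu_dist_imp_skorokhod_converges[OF lim] x a V unfolding skorokhod_open_def by blast
  then show "\<forall>\<^sub>F n in sequentially. F (x n) \<in> V" by (rule eventually_mono) auto
qed

text \<open>
  Skorokhod-open sets are open for the locally uniform distance, hence of the form \<open>{G > 0}\<close> for a
  Lipschitz \<open>G\<close>; so measurability only has to be tested on Lipschitz functionals.
\<close>

lemma measurable_borel_of_skorokhodI:
  assumes Z: "\<And>\<omega>. \<omega> \<in> space M \<Longrightarrow> Z \<omega> \<in> cadlag_space"
    and G: "\<And>k G. lu_lipschitz k G \<Longrightarrow> (\<lambda>\<omega>. G (Z \<omega>)) \<in> borel_measurable M"
  shows "Z \<in> measurable M (borel_of skorokhod_topology)"
  unfolding borel_of_def
proof (rule measurable_sigma_sets)
  show "sets (sigma (topspace skorokhod_topology) {U. openin skorokhod_topology U}) =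
    sigma_sets cadlag_space {U. skorokhod_open U}"
    unfolding openin_skorokhod_topology topspace_skorokhod_topology
    by (rule sets_measure_of) (auto simp: skorokhod_open_def)
  show "{U. skorokhod_open U} \<subseteq> Pow cadlag_space" by (auto simp: skorokhod_open_def)
  show "Z \<in> space M \<rightarrow> cadlag_space" using Z by auto
  fix U assume "U \<in> {U. skorokhod_open U}"
  then obtain k G' where G': "lu_lipschitz k G'" "\<And>x. x \<in> cadlag_space \<Longrightarrow> x \<in> U \<longleftrightarrow> G' x > 0"
    using skorokhod_open_lipschitz_test[of U] by blast
  have "Z -` U \<inter> space M = {\<omega>\<in>space M. G' (Z \<omega>) > 0}"
    using G'(2) Z by auto
  also have "\<dots> \<in> sets M" using G[OF G'(1)] by measurable
  finally show "Z -` U \<inter> space M \<in> sets M" .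
qed

section \<open>Step paths as continuous functions of their values\<close>

definition step_path :: "real \<Rightarrow> (nat \<Rightarrow> real) \<Rightarrow> real \<Rightarrow> real" where
  "step_path r p = (\<lambda>t\<in>{0..}. p (nat \<lfloor>r * t\<rfloor>))"

lemma step_path_cadlag:
  assumes r: "r \<ge> 0"
  shows "step_path r p \<in> cadlag_space"
proof (cases "r = 0")
  case True
  have "(step_path r p \<longlongrightarrow> p 0) (at_right t)" if "t \<ge> 0" for t
    by (rule tendsto_eventually) (use that True in \<open>auto simp: step_path_def eventually_at_right_field intro!: exI[of _ "t+1"]\<close>)
  moreover have "(step_path r p \<longlongrightarrow> p 0) (at_left t)" if "t > 0" for t
    by (rule tendsto_eventually) (use that True in \<open>auto simp: step_path_def eventually_at_left_field intro!: exI[of _ 0]\<close>)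
  moreover have "step_path r p t = p 0" if "t \<ge> 0" for t
    using that True by (simp add: step_path_def)
  moreover have "step_path r p \<in> extensional {0..}" by (simp add: step_path_def)
  ultimately show ?thesis
    unfolding cadlag_space_def by auto
next
  case False
  then have r: "r > 0" using r by simp
  have 1: "(step_path r p \<longlongrightarrow> step_path r p t) (at_right t)" if t: "t \<ge> 0" for t
  proof (rule tendsto_eventually)
    have *: "t < (of_int \<lfloor>r * t\<rfloor> + 1) / r" using r by (simp add: field_simps) linarith
    show "\<forall>\<^sub>F u in at_right t. step_path r p u = step_path r p t"
      unfolding eventually_at_right_field
    proof (intro exI conjI allI impI)
      fix u assume u: "t < u" "u < (of_int \<lfloor>r * t\<rfloor> + 1) / r"
      have "\<lfloor>r * u\<rfloor> = \<lfloor>r * t\<rfloor>"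
      proof (rule floor_unique)
        have "r * t \<le> r * u" using u r by simp
        then show "of_int \<lfloor>r * t\<rfloor> \<le> r * u" by linarith
        show "r * u < of_int \<lfloor>r * t\<rfloor> + 1" using u r by (simp add: field_simps)
      qed
      then show "step_path r p u = step_path r p t" using u t by (simp add: step_path_def)
    qed (rule *)
  qed
  have 2: "\<exists>l. (step_path r p \<longlongrightarrow> l) (at_left t)" if t: "t > 0" for t
  proof
    \<comment> \<open>The ceiling, not the floor: if r t is an integer, then t is a jump time and
      the value just before it has index r t - 1.\<close>
    define c where "c = \<lceil>r * t\<rceil> - 1"
    have c: "of_int c < r * t" "r * t \<le> of_int c + 1" "0 \<le> c"
      using r t ceiling_correct[of "r * t"] by (auto simp: c_def)
    show "(step_path r p \<longlongrightarrow> p (nat c)) (at_left t)"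
    proof (rule tendsto_eventually)
      show "\<forall>\<^sub>F u in at_left t. step_path r p u = p (nat c)"
        unfolding eventually_at_left_field
      proof (intro exI conjI allI impI)
        show "of_int c / r < t" using r c by (simp add: field_simps)
        fix u assume u: "of_int c / r < u" "u < t"
        have "0 \<le> of_int c / r" using c r by simp
        then have u0: "0 \<le> u" using u by linarith
        have "\<lfloor>r * u\<rfloor> = c"
        proof (rule floor_unique)
          show "of_int c \<le> r * u" using u r by (simp add: field_simps)
          have "r * u < r * t" using u r by simp
          then show "r * u < of_int c + 1" using c by linarith
        qed
        then show "step_path r p u = p (nat c)" using u0 by (simp add: step_path_def)
      qed
    qed
  qed
  show ?thesis unfolding cadlag_space_def using 1 2 by (auto simp: step_path_def)
qed

text \<open>Before time T a step path reads only finitely many of its values, so coordinatewise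
  convergence is already uniform there.\<close>

lemma step_path_tendsto:
  assumes r: "r \<ge> 0" and lim: "\<And>k. ((\<lambda>n. p n k) \<longlongrightarrow> q k) F"
  shows "((\<lambda>n. lu_dist (step_path r (p n)) (step_path r q)) \<longlongrightarrow> 0) F"
proof (rule lu_dist_tendsto_zeroI)
  fix T :: nat and e :: real assume e: "e > 0"
  have "\<forall>\<^sub>F n in F. \<forall>k\<in>{..nat \<lfloor>r * T\<rfloor>}. dist (p n k) (q k) < e"
    by (rule eventually_ball_finite) (auto intro!: tendstoD[OF lim] e)
  then show "\<forall>\<^sub>F n in F. \<forall>t\<in>{0..<real T}. \<bar>step_path r (p n) t - step_path r q t\<bar> \<le> e"
  proof (rule eventually_mono, intro ballI)
    fix n t assume n: "\<forall>k\<in>{..nat \<lfloor>r * T\<rfloor>}. dist (p n k) (q k) < e" and t: "t \<in> {0..<real T}"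
    have "nat \<lfloor>r * t\<rfloor> \<le> nat \<lfloor>r * T\<rfloor>"
      using t r by (intro nat_mono floor_mono mult_left_mono) auto
    then show "\<bar>step_path r (p n) t - step_path r q t\<bar> \<le> e"
      using n t by (auto simp: step_path_def dist_real_def intro: less_imp_le)
  qed
qed

text \<open>The source of all measurability: although \<open>G\<close> alone may fail to be
  measurable, its composition with a step path is continuous in the product topology on sequences,
  hence Borel.\<close>

lemma lu_lipschitz_step_path_continuous:
  fixes p :: "(nat \<Rightarrow> real) \<Rightarrow> nat \<Rightarrow> real"
  assumes G: "lu_lipschitz k G" and r: "r \<ge> 0" and p: "\<And>j. continuous_on UNIV (\<lambda>s. p s j)"
  shows "continuous_on UNIV (\<lambda>s. G (step_path r (p s)))"
  unfolding continuous_on_sequentially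
proof (intro allI ballI impI)
  fix x :: "nat \<Rightarrow> nat \<Rightarrow> real" and a assume *: "a \<in> UNIV" "(\<forall>n. x n \<in> UNIV) \<and> x \<longlonglongrightarrow> a"
  have "(\<lambda>n. p (x n) j) \<longlonglongrightarrow> p a j" for j
    using p[of j] * unfolding continuous_on_sequentially by (auto simp: o_def)
  then show "((\<lambda>s. G (step_path r (p s))) \<circ> x) \<longlonglongrightarrow> G (step_path r (p a))"
    unfolding o_def by (intro lu_lipschitz_tendsto[OF G] step_path_tendsto step_path_cadlag r) auto
qed

section \<open>Averages over signs\<close>

definition signs :: "nat \<Rightarrow> (nat \<Rightarrow> real) set" where
  "signs L = {..<L} \<rightarrow>\<^sub>E {-1, 1}"

definition sign_avg :: "nat \<Rightarrow> ((nat \<Rightarrow> real) \<Rightarrow> real) \<Rightarrow> real" where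
  "sign_avg L h = (\<Sum>s\<in>signs L. h s) / 2 ^ L"

lemma finite_signs [simp]: "finite (signs L)"
  by (auto simp: signs_def intro!: finite_PiE)

lemma sum_signs_Suc:
  "(\<Sum>s\<in>signs (Suc L). h s) = (\<Sum>s\<in>signs L. h (s(L := 1)) + h (s(L := -1)))"
proof -
  have inj: "inj_on (\<lambda>(y, g). g(L := y)) ({-1, 1 :: real} \<times> signs L)"
    unfolding signs_def by (rule inj_combinator) simp
  have "signs (Suc L) = (\<lambda>(y, g). g(L := y)) ` ({-1, 1} \<times> signs L)"
    unfolding signs_def lessThan_Suc by (rule PiE_insert_eq)
  then have "(\<Sum>s\<in>signs (Suc L). h s) = (\<Sum>(y, s)\<in>{-1, 1} \<times> signs L. h (s(L := y)))"
    using sum.reindex[OF inj, of h] by (simp add: case_prod_unfold o_def)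
  also have "\<dots> = (\<Sum>y\<in>{-1, 1}. \<Sum>s\<in>signs L. h (s(L := y)))"
    by (rule sum.cartesian_product[symmetric])
  finally show ?thesis by (simp add: sum.distrib add.commute)
qed

text \<open>Conditioning on the first \<open>L\<close> flips. This turns each martingale computation
  below into an induction on the number of flips.\<close>

lemma sign_avg_Suc:
  "sign_avg (Suc L) h = sign_avg L (\<lambda>s. (h (s(L := 1)) + h (s(L := -1))) / 2)"
  by (simp add: sign_avg_def sum_signs_Suc field_simps flip: sum_divide_distrib)

lemma card_signs: "card (signs L) = 2 ^ L"
  by (simp add: signs_def card_PiE numeral_2_eq_2)

lemma sign_avg_const [simp]: "sign_avg L (\<lambda>_. c) = c"
  by (simp add: sign_avg_def card_signs)

lemma sign_avg_add: "sign_avg L (\<lambda>s. f s + g s) = sign_avg L f + sign_avg L g"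
  by (simp add: sign_avg_def sum.distrib add_divide_distrib)

lemma sign_avg_diff: "sign_avg L (\<lambda>s. f s - g s) = sign_avg L f - sign_avg L g"
  by (simp add: sign_avg_def sum_subtractf diff_divide_distrib)

lemma sign_avg_cmult: "sign_avg L (\<lambda>s. c * f s) = c * sign_avg L f"
  by (simp add: sign_avg_def sum_distrib_left)

lemma sign_avg_divide: "sign_avg L (\<lambda>s. f s / c) = sign_avg L f / c"
  by (simp add: sign_avg_def sum_divide_distrib mult.commute)

lemma sign_avg_mono: "(\<And>s. s \<in> signs L \<Longrightarrow> f s \<le> g s) \<Longrightarrow> sign_avg L f \<le> sign_avg L g"
  by (simp add: sign_avg_def divide_right_mono sum_mono)

lemma sign_avg_cong: "(\<And>s. s \<in> signs L \<Longrightarrow> f s = g s) \<Longrightarrow> sign_avg L f = sign_avg L g"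
  by (simp add: sign_avg_def)

section \<open>Moments and Doob's inequality for fair signs\<close>

lemma sum_fun_upd_lessThan [simp]: "sum (s(L := c)) {..<L} = sum s {..<L}"
  for s :: "nat \<Rightarrow> real"
  by (rule sum.cong) auto

lemma sum_fun_upd_lessThan_le: "k \<le> L \<Longrightarrow> sum (s(L := c)) {..<k} = sum s {..<k}"
  for s :: "nat \<Rightarrow> real"
  by (rule sum.cong) auto

text \<open>x + 2 S is the position of the coordinate sum after \<open>L\<close> steps from
  \<open>x\<close> if its steps were fair; averaging over the last sign cancels the cross term and
  adds 4.\<close>

lemma sign_avg_square: "sign_avg L (\<lambda>s. (x + 2 * sum s {..<L})\<^sup>2) = x\<^sup>2 + 4 * real L"
proof (induction L)
  case (Suc L)
  have "((x + 2 * (S + 1))\<^sup>2 + (x + 2 * (S + - 1))\<^sup>2) / 2 = (x + 2 * S)\<^sup>2 + 4" for S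
    by (simp add: power2_eq_square field_simps)
  then have "sign_avg (Suc L) (\<lambda>s. (x + 2 * sum s {..<Suc L})\<^sup>2) =
    sign_avg L (\<lambda>s. (x + 2 * sum s {..<L})\<^sup>2 + 4)"
    by (simp only: sign_avg_Suc lessThan_Suc sum.insert finite_lessThan lessThan_iff less_irrefl not_False_eq_True
      sum_fun_upd_lessThan fun_upd_same add.commute[of _ "sum _ _"])
  then show ?case
    by (simp add: sign_avg_add Suc.IH)
qed simp

text \<open>The mean of (S + 1)^4 and (S - 1)^4 is S^4 + 6 S^2 + 1, and S^2 has mean
  \<open>L\<close>; the recursion is solved exactly.\<close>

lemma sign_avg_power4: "sign_avg L (\<lambda>s. (sum s {..<L}) ^ 4) = 3 * (real L)\<^sup>2 - 2 * real L"
proof (induction L)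
  case (Suc L)
  have sq: "sign_avg L (\<lambda>s. (sum s {..<L})\<^sup>2) = real L"
    using sign_avg_square[of L 0] by (simp add: power_mult_distrib sign_avg_cmult)
  have "((S + 1) ^ 4 + (S + - 1) ^ 4) / 2 = S ^ 4 + 6 * S\<^sup>2 + 1" for S :: real
    by (simp add: power2_eq_square power4_eq_xxxx field_simps)
  then have "sign_avg (Suc L) (\<lambda>s. (sum s {..<Suc L}) ^ 4) =
    sign_avg L (\<lambda>s. (sum s {..<L}) ^ 4 + 6 * (sum s {..<L})\<^sup>2 + 1)"
    by (simp only: sign_avg_Suc lessThan_Suc sum.insert finite_lessThan lessThan_iff less_irrefl not_False_eq_True
      sum_fun_upd_lessThan fun_upd_same add.commute[of _ "sum _ _"])
  then have "sign_avg (Suc L) (\<lambda>s. (sum s {..<Suc L}) ^ 4) = 3 * (real L)\<^sup>2 - 2 * real L + 6 * real L + 1"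
    by (simp only: sign_avg_add sign_avg_cmult sq Suc.IH sign_avg_const)
  then show ?case
    by (simp add: power2_eq_square algebra_simps)
qed simp

lemma power4_midpoint: "(S::real) ^ 4 \<le> ((S + 1) ^ 4 + (S + - 1) ^ 4) / 2"
proof -
  have "((S + 1) ^ 4 + (S + - 1) ^ 4) / 2 = S ^ 4 + (6 * S\<^sup>2 + 1)"
    by (simp add: power2_eq_square power4_eq_xxxx field_simps)
  then show ?thesis by simp
qed

text \<open>Doob's inequality as the invariant that S^4 - a^4 has nonnegative mean on the event of
  having reached level \<open>a\<close>. One more flip preserves it: on paths already in the event
  S^4 is a submartingale (\<open>power4_midpoint\<close>), and a path entering now has a partial sum
  of modulus at least \<open>a\<close>, so it contributes a nonnegative term.\<close>

lemma sign_avg_maximal_aux: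
  assumes a: "a \<ge> 0"
  shows "a ^ 4 * sign_avg l (\<lambda>s. of_bool (\<exists>k\<le>l. a \<le> \<bar>sum s {..<k}\<bar>)) \<le>
    sign_avg l (\<lambda>s. of_bool (\<exists>k\<le>l. a \<le> \<bar>sum s {..<k}\<bar>) * (sum s {..<l}) ^ 4)"
proof (induction l)
  case 0
  show ?case using a by (auto simp: of_bool_def)
next
  case (Suc l)
  define E where "E s \<longleftrightarrow> (\<exists>k\<le>l. a \<le> \<bar>sum s {..<k}\<bar>)" for s :: "nat \<Rightarrow> real"
  define h where "h s = of_bool (\<exists>k\<le>Suc l. a \<le> \<bar>sum s {..<k}\<bar>) * ((sum s {..<Suc l}) ^ 4 - a ^ 4)"
    for s :: "nat \<Rightarrow> real"
  have upd: "(\<exists>k\<le>Suc l. a \<le> \<bar>sum (s(l := c)) {..<k}\<bar>) \<longleftrightarrow> E s \<or> a \<le> \<bar>sum s {..<l} + c\<bar>" for s c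
    by (auto simp: E_def le_Suc_eq sum_fun_upd_lessThan_le)
  have pw: "a \<le> \<bar>y\<bar> \<Longrightarrow> a ^ 4 \<le> y ^ 4" for y :: real
    using power_mono[of a "\<bar>y\<bar>" 4] a by simp
  have "of_bool (E s) * ((sum s {..<l}) ^ 4 - a ^ 4) \<le> (h (s(l := 1)) + h (s(l := -1))) / 2" for s
  proof -
    define S where "S = sum s {..<l}"
    have h: "h (s(l := c)) = of_bool (E s \<or> a \<le> \<bar>S + c\<bar>) * ((S + c) ^ 4 - a ^ 4)" for c
      unfolding h_def upd S_def by simp
    show ?thesis
      unfolding h S_def[symmetric]
      using power4_midpoint[of S] pw[of "S + 1"] pw[of "S + - 1"]
      by (cases "E s") (auto simp: of_bool_def)
  qed
  then have "sign_avg l (\<lambda>s. of_bool (E s) * ((sum s {..<l}) ^ 4 - a ^ 4)) \<le> sign_avg (Suc l) h"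
    unfolding sign_avg_Suc by (rule sign_avg_mono)
  moreover have "sign_avg l (\<lambda>s. of_bool (E s) * ((sum s {..<l}) ^ 4 - a ^ 4)) \<ge> 0"
    using Suc.IH unfolding E_def[symmetric]
    by (simp add: right_diff_distrib sign_avg_diff mult.commute[of _ "a ^ 4"] sign_avg_cmult)
  moreover have "sign_avg (Suc l) h = sign_avg (Suc l) (\<lambda>s. of_bool (\<exists>k\<le>Suc l. a \<le> \<bar>sum s {..<k}\<bar>) * (sum s {..<Suc l}) ^ 4)
     - a ^ 4 * sign_avg (Suc l) (\<lambda>s. of_bool (\<exists>k\<le>Suc l. a \<le> \<bar>sum s {..<k}\<bar>))"
    unfolding h_def by (simp only: right_diff_distrib sign_avg_diff mult.commute[of _ "a ^ 4"] sign_avg_cmult)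
  ultimately show ?case by linarith
qed

lemma sign_avg_maximal:
  assumes a: "a > 0"
  shows "sign_avg l (\<lambda>s. of_bool (\<exists>k\<le>l. a \<le> \<bar>sum s {..<k}\<bar>)) \<le> 3 * (real l)\<^sup>2 / a ^ 4"
proof -
  have "a ^ 4 * sign_avg l (\<lambda>s. of_bool (\<exists>k\<le>l. a \<le> \<bar>sum s {..<k}\<bar>)) \<le>
    sign_avg l (\<lambda>s. of_bool (\<exists>k\<le>l. a \<le> \<bar>sum s {..<k}\<bar>) * (sum s {..<l}) ^ 4)"
    using a by (intro sign_avg_maximal_aux) simp
  also have "\<dots> \<le> sign_avg l (\<lambda>s. (sum s {..<l}) ^ 4)"
    by (intro sign_avg_mono) (auto simp: of_bool_def)
  also have "\<dots> \<le> 3 * (real l)\<^sup>2" by (simp add: sign_avg_power4)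
  finally show ?thesis using a by (simp add: field_simps)
qed

section \<open>The likelihood ratio of the walk against fair flips\<close>

text \<open>
  The density, with respect to fair coin flips, of the first \<open>L\<close> halved increments of the coordinate
  sum \<open>X\<close> of the walk started with \<open>X 0 = x\<close>: an increment \<open>2 \<sigma>\<close> from \<open>X\<close> has probability
  \<open>(1 - \<sigma> X / K) / 2\<close>.
\<close>

definition walk_density :: "real \<Rightarrow> real \<Rightarrow> nat \<Rightarrow> (nat \<Rightarrow> real) \<Rightarrow> real" where
  "walk_density K x L s = (\<Prod>i<L. 1 - s i * (x + 2 * sum s {..<i}) / K)"

lemma walk_density_Suc:
  "walk_density K x (Suc L) s = walk_density K x L s * (1 - s L * (x + 2 * sum s {..<L}) / K)"
  by (simp add: walk_density_def)

lemma walk_density_fun_upd [simp]: "walk_density K x L (s(L := c)) = walk_density K x L s"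
  unfolding walk_density_def by (rule prod.cong) (auto simp: sum_fun_upd_lessThan_le)

text \<open>The factors for the two values of the last sign average to 1, so the density is a
  martingale under fair flips. This holds even where it takes negative values.\<close>

lemma sign_avg_walk_density: "sign_avg L (walk_density K x L) = 1"
proof (induction L)
  case 0
  then show ?case by (simp add: walk_density_def)
next
  case (Suc L)
  have "(d * (1 - 1 * y / K) + d * (1 - (-1) * y / K)) / 2 = d" for d y :: real
    by (simp add: algebra_simps)
  then show ?case
    by (simp only: sign_avg_Suc walk_density_Suc walk_density_fun_upd sum_fun_upd_lessThan fun_upd_same Suc.IH)
qed

lemma signs_values: "s \<in> signs L \<Longrightarrow> i < L \<Longrightarrow> s i = 1 \<or> s i = -1"
  using PiE_mem[of s "{..<L}" "\<lambda>_. {-1, 1}" i] by (auto simp: signs_def)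

lemma abs_sum_signs_le:
  assumes "s \<in> signs L" "i \<le> L"
  shows "\<bar>sum s {..<i}\<bar> \<le> real i"
proof -
  have "\<bar>s j\<bar> = 1" if "j < i" for j
    using signs_values[OF assms(1), of j] assms(2) that by auto
  then have "(\<Sum>j<i. \<bar>s j\<bar>) = real i" by simp
  then show ?thesis using sum_abs[of s "{..<i}"] by simp
qed

text \<open>A density of mean 1 has L1 distance to 1 equal to twice the mean of the positive part of
  1 - \<Lambda>, so a lower bound on \<Lambda> is enough. It comes from 1 - \<Lambda> <= - ln
  \<Lambda> <= |U| + 2 Q, where U is a martingale whose second moment is the mean of Q. The level
  \<open>d\<close> is free and is tuned by the caller.\<close>

lemma sign_avg_walk_density_L1:
  assumes K: "K > 0" and small: "\<bar>x\<bar> + 2 * real L \<le> K / 2" and d: "d > 0"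
    and e: "real L * (x\<^sup>2 + 4 * real L) / K\<^sup>2 \<le> e"
  shows "sign_avg L (\<lambda>s. \<bar>walk_density K x L s - 1\<bar>) \<le> 2 * (d + e / d + 2 * e)"
proof -
  \<comment> \<open>\<open>u\<close> is the relative bias of one step; \<open>U\<close> sums the
    biases with their signs, \<open>Q\<close> their squares with the signs removed.\<close>
  define u where "u i s = s i * (x + 2 * sum s {..<i}) / K" for i and s :: "nat \<Rightarrow> real"
  define U where "U l s = (\<Sum>i<l. u i s)" for l s
  define Q where "Q l s = (\<Sum>i<l. ((x + 2 * sum s {..<i}) / K)\<^sup>2)" for l and s :: "nat \<Rightarrow> real"
  have upd: "U l (s(l := c)) = U l s" "Q l (s(l := c)) = Q l s" for l s c
    unfolding U_def Q_def u_def by (auto intro!: sum.cong simp: sum_fun_upd_lessThan_le)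
  have Q_avg: "sign_avg l (Q l) = (\<Sum>i<l. (x\<^sup>2 + 4 * real i) / K\<^sup>2)" for l
  proof (induction l)
    case 0 show ?case by (simp add: Q_def)
  next
    case (Suc l)
    have Q: "Q (Suc l) (s(l := c)) = Q l s + ((x + 2 * sum s {..<l}) / K)\<^sup>2" for s c
      using upd(2)[of l s c] by (simp add: Q_def)
    have "sign_avg (Suc l) (Q (Suc l)) = sign_avg l (\<lambda>s. Q l s + (x + 2 * sum s {..<l})\<^sup>2 / K\<^sup>2)"
      unfolding sign_avg_Suc by (intro sign_avg_cong) (simp add: Q power_divide)
    then show ?case by (simp add: sign_avg_add Suc.IH sign_avg_divide sign_avg_square)
  qed
  \<comment> \<open>Orthogonality of martingale increments: averaging over the last sign cancels the
    cross term and leaves the new square of \<open>Q\<close>.\<close>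
  have U_avg: "sign_avg l (\<lambda>s. (U l s)\<^sup>2) = sign_avg l (Q l)" for l
  proof (induction l)
    case 0 show ?case by (simp add: Q_def U_def)
  next
    case (Suc l)
    have sq: "((v + 1 * y / K)\<^sup>2 + (v + (- 1) * y / K)\<^sup>2) / 2 = v\<^sup>2 + (y / K)\<^sup>2" for v y
      by (simp add: power2_eq_square algebra_simps)
    have U: "U (Suc l) (s(l := c)) = U l s + c * (x + 2 * sum s {..<l}) / K" for s c
      using upd(1)[of l s c] by (simp add: U_def u_def)
    have Q: "Q (Suc l) (s(l := c)) = Q l s + ((x + 2 * sum s {..<l}) / K)\<^sup>2" for s c
      using upd(2)[of l s c] by (simp add: Q_def)
    show ?case
      unfolding sign_avg_Suc U Q sq by (simp add: sign_avg_add sign_avg_divide sign_avg_cmult Suc.IH)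
  qed
  have "(\<Sum>i<L. (x\<^sup>2 + 4 * real i) / K\<^sup>2) \<le> (\<Sum>i<L. (x\<^sup>2 + 4 * real L) / K\<^sup>2)"
    by (intro sum_mono divide_right_mono) auto
  then have e': "sign_avg L (Q L) \<le> e" "sign_avg L (\<lambda>s. (U L s)\<^sup>2) \<le> e" "0 \<le> e"
    using e by (auto simp: U_avg Q_avg intro: order_trans[rotated])
  \<comment> \<open>The summand \<Lambda> - 1 is kept because its average is exactly 0; only the
    rest costs anything.\<close>
  have "\<bar>walk_density K x L s - 1\<bar> \<le> (walk_density K x L s - 1) + 2 * (d + (U L s)\<^sup>2 / d + 2 * Q L s)"
    if s: "s \<in> signs L" for s
  proof -
    have u2: "(u i s)\<^sup>2 = ((x + 2 * sum s {..<i}) / K)\<^sup>2" if "i < L" for i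
    proof -
      have "s i = 1 \<or> s i = -1" using signs_values[OF s that] .
      then show ?thesis by (auto simp: u_def power2_eq_square)
    qed
    \<comment> \<open>The bound 1/2 keeps all factors positive and is the range in which ln (1 + y)
      differs from y by at most 2 y^2.\<close>
    have u_le: "\<bar>u i s\<bar> \<le> 1 / 2" if i: "i < L" for i
    proof -
      have "\<bar>u i s\<bar> = \<bar>(x + 2 * sum s {..<i}) / K\<bar>" using u2[OF i] by (auto simp only: power2_eq_iff abs_minus_cancel)
      also have "\<dots> \<le> (K / 2) / K"
      proof -
        have "real i \<le> real L" using i by simp
        then have "\<bar>x + 2 * sum s {..<i}\<bar> \<le> K / 2"
          using abs_sum_signs_le[OF s, of i] i small by linarith
        then show ?thesis using K by (simp add: abs_divide divide_right_mono)
      qed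
      finally show ?thesis using K by simp
    qed
    define \<Lambda> where "\<Lambda> = walk_density K x L s"
    have \<Lambda>_eq: "\<Lambda> = (\<Prod>i<L. 1 - u i s)" by (simp add: \<Lambda>_def walk_density_def u_def)
    have pos: "0 < 1 - u i s" if "i < L" for i using u_le[OF that] by linarith
    have "\<Lambda> > 0" unfolding \<Lambda>_eq by (rule prod_pos) (use pos in auto)
    have "ln \<Lambda> = (\<Sum>i<L. ln (1 - u i s))"
      unfolding \<Lambda>_eq by (rule ln_prod) (use pos in force)+
    also have "\<dots> \<ge> (\<Sum>i<L. - u i s - 2 * (u i s)\<^sup>2)"
    proof (rule sum_mono)
      fix i assume "i \<in> {..<L}"
      then show "- u i s - 2 * (u i s)\<^sup>2 \<le> ln (1 - u i s)"
        using abs_ln_one_plus_x_minus_x_bound[of "- u i s"] u_le[of i] by (simp add: abs_le_iff)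
    qed
    finally have "- U L s - 2 * Q L s \<le> ln \<Lambda>"
      by (simp add: U_def Q_def u2 sum_subtractf sum_negf sum_distrib_left)
    then have "1 - \<Lambda> \<le> \<bar>U L s\<bar> + 2 * Q L s"
      using ln_le_minus_one[OF \<open>\<Lambda> > 0\<close>] by linarith
    \<comment> \<open>Splitting at the level \<open>d\<close> trades |U| for U^2, whose average is
      known.\<close>
    moreover have "\<bar>U L s\<bar> \<le> d + (U L s)\<^sup>2 / d"
    proof (cases "\<bar>U L s\<bar> \<le> d")
      case False
      then have "\<bar>U L s\<bar> * d \<le> \<bar>U L s\<bar> * \<bar>U L s\<bar>" by (intro mult_left_mono) auto
      then have "\<bar>U L s\<bar> \<le> (U L s)\<^sup>2 / d" using d by (simp add: field_simps power2_eq_square)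
      then show ?thesis using d by simp
    qed (use d in \<open>auto intro: add_increasing2\<close>)
    moreover have "0 \<le> Q L s" by (auto simp: Q_def intro: sum_nonneg)
    moreover have "0 \<le> (U L s)\<^sup>2 / d" using d by simp
    ultimately show ?thesis using d unfolding \<Lambda>_def[symmetric] by (auto simp: abs_if)
  qed
  then have "sign_avg L (\<lambda>s. \<bar>walk_density K x L s - 1\<bar>) \<le>
    sign_avg L (\<lambda>s. (walk_density K x L s - 1) + 2 * (d + (U L s)\<^sup>2 / d + 2 * Q L s))"
    by (rule sign_avg_mono)
  also have "\<dots> = 2 * (d + sign_avg L (\<lambda>s. (U L s)\<^sup>2) / d + 2 * sign_avg L (Q L))"
    by (simp add: sign_avg_add sign_avg_diff sign_avg_cmult sign_avg_divide sign_avg_walk_density)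
  also have "\<dots> \<le> 2 * (d + e / d + 2 * e)"
    using e' d by (intro mult_left_mono add_mono divide_right_mono) auto
  finally show ?thesis .
qed

section \<open>The increments of the walk\<close>

text \<open>Expansion over the finitely many sign patterns, which exhaust the space almost surely.
  The event \<open>A\<close> allows the same formula under a restriction on the initial
  position.\<close>

lemma (in prob_space) expectation_signs:
  fixes \<sigma> :: "nat \<Rightarrow> 'a \<Rightarrow> real"
  assumes \<sigma> [measurable]: "\<And>i. \<sigma> i \<in> borel_measurable M"
    and vals: "\<And>i. AE \<omega> in M. \<sigma> i \<omega> = 1 \<or> \<sigma> i \<omega> = -1"
    and A [measurable]: "A \<in> sets M"
    and h [measurable]: "(\<lambda>\<omega>. h (\<lambda>i\<in>{..<L}. \<sigma> i \<omega>)) \<in> borel_measurable M"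
  shows "(\<integral>\<omega>. indicator A \<omega> * h (\<lambda>i\<in>{..<L}. \<sigma> i \<omega>) \<partial>M) =
    (\<Sum>s\<in>signs L. h s * prob {\<omega>\<in>space M. \<omega> \<in> A \<and> (\<forall>i<L. \<sigma> i \<omega> = s i)})"
proof -
  have ev [measurable]: "{\<omega>\<in>space M. \<omega> \<in> A \<and> (\<forall>i<L. \<sigma> i \<omega> = s i)} \<in> sets M" for s
    by measurable
  have "AE \<omega> in M. \<forall>i. \<sigma> i \<omega> = 1 \<or> \<sigma> i \<omega> = -1"
    using vals by (subst AE_all_countable) auto
  then have "AE \<omega> in M. indicator A \<omega> * h (\<lambda>i\<in>{..<L}. \<sigma> i \<omega>) =
    (\<Sum>s\<in>signs L. h s * indicator {\<omega>\<in>space M. \<omega> \<in> A \<and> (\<forall>i<L. \<sigma> i \<omega> = s i)} \<omega>)"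
  proof eventually_elim
    case (elim \<omega>)
    have r: "(\<lambda>i\<in>{..<L}. \<sigma> i \<omega>) \<in> signs L" using elim by (auto simp: signs_def)
    have *: "(\<forall>i<L. \<sigma> i \<omega> = s i) \<longleftrightarrow> s = (\<lambda>i\<in>{..<L}. \<sigma> i \<omega>)" if "s \<in> signs L" for s
      using that by (auto simp: signs_def PiE_def extensional_def fun_eq_iff)
    have "(\<Sum>s\<in>signs L. h s * indicator {\<omega>\<in>space M. \<omega> \<in> A \<and> (\<forall>i<L. \<sigma> i \<omega> = s i)} \<omega>) =
      (\<Sum>s\<in>signs L. if s = (\<lambda>i\<in>{..<L}. \<sigma> i \<omega>) then indicator A \<omega> * h s else 0)"
      using sets.sets_into_space[OF A] by (intro sum.cong) (auto simp: * indicator_def)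
    also have "\<dots> = indicator A \<omega> * h (\<lambda>i\<in>{..<L}. \<sigma> i \<omega>)"
      using r by (subst sum.delta) auto
    finally show ?case by simp
  qed
  then have "(\<integral>\<omega>. indicator A \<omega> * h (\<lambda>i\<in>{..<L}. \<sigma> i \<omega>) \<partial>M) =
    (\<integral>\<omega>. (\<Sum>s\<in>signs L. h s * indicator {\<omega>\<in>space M. \<omega> \<in> A \<and> (\<forall>i<L. \<sigma> i \<omega> = s i)} \<omega>) \<partial>M)"
    by (intro integral_cong_AE) measurable
  also have "\<dots> = (\<Sum>s\<in>signs L. h s * prob {\<omega>\<in>space M. \<omega> \<in> A \<and> (\<forall>i<L. \<sigma> i \<omega> = s i)})"
    by (subst Bochner_Integration.integral_sum) (auto intro!: integrable_mult_right sum.cong simp: emeasure_eq_measure)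
  finally show ?thesis .
qed

section \<open>One step of the walk given its past\<close>

lemma coord_sum_flip:
  assumes "j \<in> {1..K}"
  shows "coord_sum K (flip j v) = coord_sum K v - 2 * real_of_int (v j)"
proof -
  have "coord_sum K (flip j v) = (\<Sum>i\<in>{1..K} - {j}. real_of_int (v i)) - real_of_int (v j)"
    unfolding coord_sum_def flip_def using assms by (subst sum.remove[of _ j]) auto
  moreover have "coord_sum K v = (\<Sum>i\<in>{1..K} - {j}. real_of_int (v i)) + real_of_int (v j)"
    unfolding coord_sum_def using assms by (subst sum.remove[of _ j]) auto
  ultimately show ?thesis by simp
qed

lemma hypercube_values: "v \<in> hypercube K \<Longrightarrow> j \<in> {1..K} \<Longrightarrow> v j = 1 \<or> v j = -1"
  using PiE_mem[of v "{1..K}" "\<lambda>_. {-1, 1}" j] by (auto simp: hypercube_def)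

lemma finite_hypercube [simp]: "finite (hypercube K)"
  by (auto simp: hypercube_def intro!: finite_PiE)

text \<open>Flipping coordinate j changes half the coordinate sum by - v j. For values in {-1, 1}
  the indicator of - v j = s equals (1 - s v j) / 2, which is affine in v j, so only the coordinate
  sum survives the count.\<close>

lemma card_coordinates_eq:
  assumes v: "v \<in> hypercube K" and s: "s = 1 \<or> s = -1"
  shows "real (card {j\<in>{1..K}. real_of_int (- v j) = s}) = (real K - s * coord_sum K v) / 2"
proof -
  have "real (card {j\<in>{1..K}. real_of_int (- v j) = s}) = (\<Sum>j\<in>{1..K}. of_bool (real_of_int (- v j) = s))"
    by (simp add: of_bool_def sum.If_cases Int_def)
  also have "\<dots> = (\<Sum>j\<in>{1..K}. (1 - s * real_of_int (v j)) / 2)"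
    by (intro sum.cong refl) (use hypercube_values[OF v] s in fastforce)
  also have "\<dots> = (real K - s * coord_sum K v) / 2"
    by (simp add: coord_sum_def sum_subtractf sum_distrib_left flip: sum_divide_distrib)
  finally show ?thesis .
qed

definition walk_sum :: "nat \<Rightarrow> (nat \<Rightarrow> 'a \<Rightarrow> nat \<Rightarrow> int) \<Rightarrow> nat \<Rightarrow> 'a \<Rightarrow> real" where
  "walk_sum K Y i \<omega> = coord_sum K (Y i \<omega>)"

definition half_step :: "nat \<Rightarrow> (nat \<Rightarrow> 'a \<Rightarrow> nat \<Rightarrow> int) \<Rightarrow> nat \<Rightarrow> 'a \<Rightarrow> real" where
  "half_step K Y i \<omega> = (walk_sum K Y (Suc i) \<omega> - walk_sum K Y i \<omega>) / 2"

lemma sum_half_step: "(\<Sum>i<k. half_step K Y i \<omega>) = (walk_sum K Y k \<omega> - walk_sum K Y 0 \<omega>) / 2"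
  by (induction k) (auto simp: half_step_def field_simps)

locale cube_walk = prob_space M for M :: "'a measure" +
  fixes K :: nat and Y :: "nat \<Rightarrow> 'a \<Rightarrow> nat \<Rightarrow> int" and \<xi> :: "nat \<Rightarrow> 'a \<Rightarrow> nat"
  assumes K_pos: "K \<ge> 1"
    and Y_meas [measurable]: "\<And>i. Y i \<in> measurable M (count_space (hypercube K))"
    and \<xi>_meas [measurable]: "\<And>i. \<xi> i \<in> measurable M (count_space {1..K})"
    and \<xi>_unif: "\<And>i. distr M (count_space {1..K}) (\<xi> i) = uniform_count_measure {1..K}"
    and \<xi>_indep: "\<And>i. indep_set
          (sets (vimage_algebra (space M) (\<xi> i) (count_space {1..K})))
          (sets (vimage_algebra (space M) (\<lambda>\<omega>. \<lambda>j\<in>{..i}. Y j \<omega>)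
             (Pi\<^sub>M {..i} (\<lambda>_. count_space (hypercube K)))))"
    and Y_Suc: "\<And>i. AE \<omega> in M. Y (Suc i) \<omega> = flip (\<xi> i \<omega>) (Y i \<omega>)"
begin

abbreviation X :: "nat \<Rightarrow> 'a \<Rightarrow> real" where
  "X \<equiv> walk_sum K Y"

abbreviation \<sigma> :: "nat \<Rightarrow> 'a \<Rightarrow> real" where
  "\<sigma> \<equiv> half_step K Y"

lemma X_measurable [measurable]: "X i \<in> borel_measurable M"
  unfolding walk_sum_def by (rule measurable_compose[OF Y_meas]) simp

lemma \<sigma>_measurable [measurable]: "\<sigma> i \<in> borel_measurable M"
  unfolding half_step_def by measurable

lemma Y_in: "\<omega> \<in> space M \<Longrightarrow> Y i \<omega> \<in> hypercube K"
  using measurable_space[OF Y_meas] by simp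

lemma \<xi>_in: "\<omega> \<in> space M \<Longrightarrow> \<xi> i \<omega> \<in> {1..K}"
  using measurable_space[OF \<xi>_meas] by simp

lemma \<sigma>_AE: "AE \<omega> in M. \<sigma> i \<omega> = real_of_int (- Y i \<omega> (\<xi> i \<omega>))"
  using Y_Suc[of i] AE_space
  by eventually_elim (use \<xi>_in in \<open>auto simp: half_step_def walk_sum_def coord_sum_flip\<close>)

lemma \<sigma>_values: "AE \<omega> in M. \<sigma> i \<omega> = 1 \<or> \<sigma> i \<omega> = -1"
  using \<sigma>_AE[of i] AE_space
proof eventually_elim
  case (elim \<omega>)
  then show ?case using hypercube_values[OF Y_in[of \<omega> i] \<xi>_in[of \<omega> i]] by auto
qed

text \<open>The hypercube is finite and so is the time set, hence the product \<sigma>-algebra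
  contains all subsets: any predicate of the past, with no measurability condition on it, defines a
  past event.\<close>

lemma past_event:
  "{\<omega>\<in>space M. Q (\<lambda>j\<in>{..i}. Y j \<omega>)} \<in> sets (vimage_algebra (space M) (\<lambda>\<omega>. \<lambda>j\<in>{..i}. Y j \<omega>)
             (Pi\<^sub>M {..i} (\<lambda>_. count_space (hypercube K))))"
proof -
  let ?P = "{..i} \<rightarrow>\<^sub>E hypercube K"
  have "{\<omega>\<in>space M. Q (\<lambda>j\<in>{..i}. Y j \<omega>)} = (\<lambda>\<omega>. \<lambda>j\<in>{..i}. Y j \<omega>) -` {p\<in>?P. Q p} \<inter> space M"
    using Y_in by auto
  moreover have "{p\<in>?P. Q p} \<in> sets (Pi\<^sub>M {..i} (\<lambda>_. count_space (hypercube K)))"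
    by (subst count_space_PiM_finite) (auto simp: countable_finite)
  ultimately show ?thesis by (simp only: in_vimage_algebra)
qed

text \<open>The sign of the next increment depends on the whole position, not just on its sum.
  Fixing the position v turns the event into a condition on \<xi> alone, independent of the past;
  its probability depends on v only through the coordinate sum, so summing over v gives a law
  governed by \<open>c\<close>.\<close>

lemma prob_\<sigma>_past:
  assumes c: "\<And>\<omega>. \<omega> \<in> space M \<Longrightarrow> Q (\<lambda>j\<in>{..i}. Y j \<omega>) \<Longrightarrow> X i \<omega> = c" and s: "s = 1 \<or> s = -1"
  shows "prob {\<omega>\<in>space M. Q (\<lambda>j\<in>{..i}. Y j \<omega>) \<and> \<sigma> i \<omega> = s} =
    prob {\<omega>\<in>space M. Q (\<lambda>j\<in>{..i}. Y j \<omega>)} * (1 - s * c / real K) / 2"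
proof -
  let ?p = "\<lambda>\<omega>. \<lambda>j\<in>{..i}. Y j \<omega>"
  have meas: "{\<omega>\<in>space M. R (?p \<omega>)} \<in> sets M" for R
    using past_event[of R i] indep_setD_ev2[OF \<xi>_indep[of i]] by auto
  define J where "J v = {j\<in>{1..K}. real_of_int (- v j) = s}" for v :: "nat \<Rightarrow> int"
  have *: "prob {\<omega>\<in>space M. (Q (?p \<omega>) \<and> Y i \<omega> = v) \<and> \<sigma> i \<omega> = s} =
      prob {\<omega>\<in>space M. Q (?p \<omega>) \<and> Y i \<omega> = v} * ((1 - s * c / real K) / 2)"
    if v: "v \<in> hypercube K" for v
  proof -
    define R where "R q \<longleftrightarrow> Q q \<and> q i = v" for q
    have R: "R (?p \<omega>) \<longleftrightarrow> Q (?p \<omega>) \<and> Y i \<omega> = v" for \<omega> by (simp add: R_def)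
    have m1: "{\<omega>\<in>space M. Q (?p \<omega>) \<and> Y i \<omega> = v} \<in> sets M"
      using meas[of R] by (simp add: R)
    have m2: "\<xi> i -` J v \<inter> space M \<in> sets (vimage_algebra (space M) (\<xi> i) (count_space {1..K}))"
      by (rule in_vimage_algebra) (auto simp: J_def)
    have m2': "\<xi> i -` J v \<inter> space M \<in> sets M" by (rule measurable_sets[OF \<xi>_meas]) (auto simp: J_def)
    have m3: "{\<omega>\<in>space M. (Q (?p \<omega>) \<and> Y i \<omega> = v) \<and> \<sigma> i \<omega> = s} \<in> sets M"
    proof -
      have "{\<omega>\<in>space M. (Q (?p \<omega>) \<and> Y i \<omega> = v) \<and> \<sigma> i \<omega> = s} =
        {\<omega>\<in>space M. Q (?p \<omega>) \<and> Y i \<omega> = v} \<inter> {\<omega>\<in>space M. \<sigma> i \<omega> = s}" by auto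
      also have "\<dots> \<in> sets M" by (intro sets.Int m1) measurable
      finally show ?thesis .
    qed
    \<comment> \<open>With the position fixed, \<open>J v\<close> is a deterministic set of
      coordinates, so the sign condition can be replaced almost surely by \<xi> lying in it.\<close>
    have "prob {\<omega>\<in>space M. (Q (?p \<omega>) \<and> Y i \<omega> = v) \<and> \<sigma> i \<omega> = s} =
      prob ((\<xi> i -` J v \<inter> space M) \<inter> {\<omega>\<in>space M. Q (?p \<omega>) \<and> Y i \<omega> = v})"
    proof (rule finite_measure_eq_AE)
      show "AE \<omega> in M. (\<omega> \<in> {\<omega>\<in>space M. (Q (?p \<omega>) \<and> Y i \<omega> = v) \<and> \<sigma> i \<omega> = s}) =
        (\<omega> \<in> (\<xi> i -` J v \<inter> space M) \<inter> {\<omega>\<in>space M. Q (?p \<omega>) \<and> Y i \<omega> = v})"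
        using \<sigma>_AE[of i] AE_space
        by eventually_elim (use \<xi>_in in \<open>auto simp: J_def\<close>)
    qed (use m1 m2' m3 in auto)
    also have "\<dots> = prob (\<xi> i -` J v \<inter> space M) * prob {\<omega>\<in>space M. Q (?p \<omega>) \<and> Y i \<omega> = v}"
      using indep_setD[OF \<xi>_indep m2 past_event[of R i]] by (simp add: R)
    also have "prob (\<xi> i -` J v \<inter> space M) = measure (distr M (count_space {1..K}) (\<xi> i)) (J v)"
      by (subst measure_distr[OF \<xi>_meas]) (auto simp: J_def)
    also have "\<dots> = real (card (J v)) / real K"
      unfolding \<xi>_unif by (subst measure_uniform_count_measure) (auto simp: J_def)
    also have "real (card (J v)) = (real K - s * coord_sum K v) / 2"
      unfolding J_def by (rule card_coordinates_eq[OF v s])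
    also have "(real K - s * coord_sum K v) / 2 / real K * prob {\<omega>\<in>space M. Q (?p \<omega>) \<and> Y i \<omega> = v} =
      (real K - s * c) / 2 / real K * prob {\<omega>\<in>space M. Q (?p \<omega>) \<and> Y i \<omega> = v}"
    \<comment> \<open>If no outcome satisfies the condition, nothing ties the coordinate sum of v to
      \<open>c\<close>, but both sides are then 0.\<close>
    proof (cases "{\<omega>\<in>space M. Q (?p \<omega>) \<and> Y i \<omega> = v} = {}")
      case True
      show ?thesis unfolding True by simp
    next
      case False
      then have "coord_sum K v = c" using c by (auto simp: walk_sum_def)
      then show ?thesis by simp
    qed
    also have "(real K - s * c) / 2 / real K * p = p * ((1 - s * c / real K) / 2)" for p
      using K_pos by (simp add: field_simps)
    finally show ?thesis .
  qed
  have mY: "{\<omega>\<in>space M. Q (?p \<omega>) \<and> Y i \<omega> = v} \<in> sets M" for v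
    using meas[of "\<lambda>q. Q q \<and> q i = v"] by simp
  have mYs: "{\<omega>\<in>space M. Q (?p \<omega>) \<and> Y i \<omega> = v \<and> \<sigma> i \<omega> = s} \<in> sets M" for v
  proof -
    have "{\<omega>\<in>space M. Q (?p \<omega>) \<and> Y i \<omega> = v \<and> \<sigma> i \<omega> = s} =
      {\<omega>\<in>space M. Q (?p \<omega>) \<and> Y i \<omega> = v} \<inter> {\<omega>\<in>space M. \<sigma> i \<omega> = s}" by auto
    also have "\<dots> \<in> sets M" by (intro sets.Int mY) measurable
    finally show ?thesis .
  qed
  have ms: "{\<omega>\<in>space M. Q (?p \<omega>) \<and> \<sigma> i \<omega> = s} \<in> sets M"
  proof -
    have "{\<omega>\<in>space M. Q (?p \<omega>) \<and> \<sigma> i \<omega> = s} =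
      {\<omega>\<in>space M. Q (?p \<omega>)} \<inter> {\<omega>\<in>space M. \<sigma> i \<omega> = s}" by auto
    also have "\<dots> \<in> sets M" by (intro sets.Int meas) measurable
    finally show ?thesis .
  qed
  have "prob {\<omega>\<in>space M. Q (?p \<omega>) \<and> \<sigma> i \<omega> = s} =
    (\<Sum>v\<in>hypercube K. prob {\<omega>\<in>space M. (Q (?p \<omega>) \<and> Y i \<omega> = v) \<and> \<sigma> i \<omega> = s})"
    by (rule prob_sum) (use mYs ms Y_in in \<open>auto simp: conj_ac intro!: AE_I2\<close>)
  also have "\<dots> = (\<Sum>v\<in>hypercube K. prob {\<omega>\<in>space M. Q (?p \<omega>) \<and> Y i \<omega> = v}) * ((1 - s * c / real K) / 2)"
    unfolding sum_distrib_right by (rule sum.cong[OF refl *])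
  also have "(\<Sum>v\<in>hypercube K. prob {\<omega>\<in>space M. Q (?p \<omega>) \<and> Y i \<omega> = v}) = prob {\<omega>\<in>space M. Q (?p \<omega>)}"
    by (rule prob_sum[symmetric]) (use mY meas Y_in in \<open>auto intro!: AE_I2\<close>)
  finally show ?thesis by (simp only: times_divide_eq_right)
qed

text \<open>The chain rule: the initial value and the first signs determine the current coordinate
  sum, which is all that \<open>prob_\<sigma>_past\<close> asks for. The product form, instead of
  conditional probabilities, also covers initial values of probability 0.\<close>

lemma prob_cylinder:
  assumes "s \<in> signs L"
  shows "prob {\<omega>\<in>space M. X 0 \<omega> = x \<and> (\<forall>i<L. \<sigma> i \<omega> = s i)} =
    prob {\<omega>\<in>space M. X 0 \<omega> = x} * (walk_density (real K) x L s / 2 ^ L)"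
proof -
  have "l \<le> L \<Longrightarrow> prob {\<omega>\<in>space M. X 0 \<omega> = x \<and> (\<forall>i<l. \<sigma> i \<omega> = s i)} =
    prob {\<omega>\<in>space M. X 0 \<omega> = x} * (walk_density (real K) x l s / 2 ^ l)" for l
  proof (induction l)
    case 0
    then show ?case by (simp add: walk_density_def)
  next
    case (Suc l)
    \<comment> \<open>The cylinder rewritten as a predicate of the past positions, the form in which
      independence from \<xi> is available.\<close>
    define Q where "Q q \<longleftrightarrow> coord_sum K (q 0) = x \<and>
      (\<forall>i<l. (coord_sum K (q (Suc i)) - coord_sum K (q i)) / 2 = s i)" for q
    have Q: "Q (\<lambda>j\<in>{..l}. Y j \<omega>) \<longleftrightarrow> X 0 \<omega> = x \<and> (\<forall>i<l. \<sigma> i \<omega> = s i)" for \<omega>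
      by (auto simp: Q_def walk_sum_def half_step_def)
    have "prob {\<omega>\<in>space M. X 0 \<omega> = x \<and> (\<forall>i<Suc l. \<sigma> i \<omega> = s i)} =
      prob {\<omega>\<in>space M. Q (\<lambda>j\<in>{..l}. Y j \<omega>) \<and> \<sigma> l \<omega> = s l}"
      by (intro arg_cong[where f=prob] Collect_cong) (auto simp: Q less_Suc_eq)
    also have "\<dots> = prob {\<omega>\<in>space M. Q (\<lambda>j\<in>{..l}. Y j \<omega>)} * (1 - s l * (x + 2 * sum s {..<l}) / real K) / 2"
    proof (rule prob_\<sigma>_past)
      fix \<omega> assume "Q (\<lambda>j\<in>{..l}. Y j \<omega>)"
      then show "X l \<omega> = x + 2 * sum s {..<l}"
        using sum_half_step[of K Y \<omega> l] by (simp add: Q)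
    qed (use signs_values[OF assms] Suc.prems in auto)
    also have "prob {\<omega>\<in>space M. Q (\<lambda>j\<in>{..l}. Y j \<omega>)} = prob {\<omega>\<in>space M. X 0 \<omega> = x} * (walk_density (real K) x l s / 2 ^ l)"
      using Suc by (simp add: Q)
    finally show ?case by (simp add: walk_density_Suc mult_ac)
  qed
  then show ?thesis by simp
qed

text \<open>A total variation estimate. While the initial value stays below \<open>r\<close>, the
  law of the signs is a mixture over the starting values of laws with L1 distance at most \<eta>
  from fair flips. The remaining event is paid for twice, once in each expectation.\<close>

lemma expectation_compare_signs:
  assumes h: "\<And>s. \<bar>h s\<bar> \<le> B"
    and hm: "(\<lambda>\<omega>. h (\<lambda>i\<in>{..<L}. \<sigma> i \<omega>)) \<in> borel_measurable M"
    and \<eta>: "\<And>x. \<bar>x\<bar> \<le> r \<Longrightarrow> sign_avg L (\<lambda>s. \<bar>walk_density (real K) x L s - 1\<bar>) \<le> \<eta>" and "\<eta> \<ge> 0"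
  shows "\<bar>(\<integral>\<omega>. h (\<lambda>i\<in>{..<L}. \<sigma> i \<omega>) \<partial>M) - sign_avg L h\<bar> \<le>
    B * (\<eta> + 2 * prob {\<omega>\<in>space M. \<bar>X 0 \<omega>\<bar> > r})"
proof -
  have B0: "B \<ge> 0" using h[of undefined] by linarith
  define A where "A = {\<omega>\<in>space M. \<bar>X 0 \<omega>\<bar> \<le> r}"
  define V where "V = {x\<in>coord_sum K ` hypercube K. \<bar>x\<bar> \<le> r}"
  define P where "P x = prob {\<omega>\<in>space M. X 0 \<omega> = x}" for x
  have [measurable]: "A \<in> sets M" unfolding A_def by measurable
  have Ac: "prob (space M - A) = prob {\<omega>\<in>space M. \<bar>X 0 \<omega>\<bar> > r}"
    by (rule arg_cong[where f=prob]) (auto simp: A_def)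
  have X0V: "X 0 \<omega> \<in> V \<longleftrightarrow> \<omega> \<in> A" if "\<omega> \<in> space M" for \<omega>
    using Y_in[OF that] that by (auto simp: walk_sum_def V_def A_def)
  have finV: "finite V" by (auto simp: V_def)
  have PA: "prob {\<omega>\<in>space M. \<omega> \<in> A \<and> (\<forall>i<L. \<sigma> i \<omega> = s i)} =
      (\<Sum>x\<in>V. P x * (walk_density (real K) x L s / 2 ^ L))" if "s \<in> signs L" for s
  proof -
    have "prob {\<omega>\<in>space M. \<omega> \<in> A \<and> (\<forall>i<L. \<sigma> i \<omega> = s i)} =
      (\<Sum>x\<in>V. prob {\<omega>\<in>space M. X 0 \<omega> = x \<and> (\<forall>i<L. \<sigma> i \<omega> = s i)})"
      by (rule prob_sum[OF finV]) (use X0V in \<open>auto intro!: AE_I2\<close>)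
    then show ?thesis using prob_cylinder[OF that] by (simp add: P_def)
  qed
  have PA1: "prob A = (\<Sum>x\<in>V. P x)"
  proof -
    have "prob {\<omega>\<in>space M. \<omega> \<in> A} = (\<Sum>x\<in>V. P x)"
      unfolding P_def by (rule prob_sum[OF finV]) (use X0V in \<open>auto intro!: AE_I2\<close>)
    then show ?thesis by (simp add: A_def)
  qed
  have int: "integrable M (\<lambda>\<omega>. h (\<lambda>i\<in>{..<L}. \<sigma> i \<omega>))"
    by (rule integrable_const_bound[where B=B]) (use h hm in auto)
  have intA: "integrable M (\<lambda>\<omega>. indicator D \<omega> * h (\<lambda>i\<in>{..<L}. \<sigma> i \<omega>))" if "D \<in> sets M" for D
    using integrable_mult_indicator[OF that int] by simp
  have "(\<integral>\<omega>. indicator A \<omega> * h (\<lambda>i\<in>{..<L}. \<sigma> i \<omega>) \<partial>M) =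
    (\<Sum>s\<in>signs L. h s * (\<Sum>x\<in>V. P x * (walk_density (real K) x L s / 2 ^ L)))"
    by (subst expectation_signs) (use hm PA \<sigma>_values in auto)
  also have "\<dots> = (\<Sum>x\<in>V. P x * sign_avg L (\<lambda>s. h s * walk_density (real K) x L s))"
    unfolding sum_distrib_left sign_avg_def
    by (subst sum.swap) (simp add: sum_distrib_left sum_divide_distrib mult_ac)
  \<comment> \<open>The mixture has mass \<open>prob A\<close>, not 1, so the fair average is
    weighted accordingly; the missing mass joins the error of the complement.\<close>
  finally have 1: "(\<integral>\<omega>. indicator A \<omega> * h (\<lambda>i\<in>{..<L}. \<sigma> i \<omega>) \<partial>M) - prob A * sign_avg L h =
    (\<Sum>x\<in>V. P x * sign_avg L (\<lambda>s. h s * (walk_density (real K) x L s - 1)))"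
    by (simp add: PA1 sum_distrib_right sum_subtractf right_diff_distrib sign_avg_diff)
  have "\<bar>\<Sum>x\<in>V. P x * sign_avg L (\<lambda>s. h s * (walk_density (real K) x L s - 1))\<bar> \<le> (\<Sum>x\<in>V. P x * (B * \<eta>))"
  proof (rule order_trans[OF sum_abs sum_mono])
    fix x assume x: "x \<in> V"
    have "\<bar>sign_avg L (\<lambda>s. h s * (walk_density (real K) x L s - 1))\<bar> \<le>
      sign_avg L (\<lambda>s. \<bar>h s * (walk_density (real K) x L s - 1)\<bar>)"
      unfolding sign_avg_def by (simp add: divide_right_mono)
    also have "\<dots> \<le> sign_avg L (\<lambda>s. B * \<bar>walk_density (real K) x L s - 1\<bar>)"
      by (intro sign_avg_mono) (auto simp: abs_mult intro!: mult_right_mono h)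
    also have "\<dots> \<le> B * \<eta>"
      unfolding sign_avg_cmult by (intro mult_left_mono \<eta> B0) (use x in \<open>auto simp: V_def\<close>)
    finally show "\<bar>P x * sign_avg L (\<lambda>s. h s * (walk_density (real K) x L s - 1))\<bar> \<le> P x * (B * \<eta>)"
      unfolding abs_mult by (intro mult_mono) (auto simp: P_def)
  qed
  also have "\<dots> = prob A * (B * \<eta>)" by (simp add: PA1 sum_distrib_right)
  also have "\<dots> \<le> 1 * (B * \<eta>)" using B0 \<open>\<eta> \<ge> 0\<close> by (intro mult_right_mono) auto
  finally have 2: "\<bar>(\<integral>\<omega>. indicator A \<omega> * h (\<lambda>i\<in>{..<L}. \<sigma> i \<omega>) \<partial>M) - prob A * sign_avg L h\<bar> \<le> B * \<eta>"
    unfolding 1 by simp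
  have "(\<integral>\<omega>. h (\<lambda>i\<in>{..<L}. \<sigma> i \<omega>) \<partial>M) =
    (\<integral>\<omega>. indicator A \<omega> * h (\<lambda>i\<in>{..<L}. \<sigma> i \<omega>) + indicator (space M - A) \<omega> * h (\<lambda>i\<in>{..<L}. \<sigma> i \<omega>) \<partial>M)"
    by (intro Bochner_Integration.integral_cong) (auto simp: indicator_def)
  also have "\<dots> = (\<integral>\<omega>. indicator A \<omega> * h (\<lambda>i\<in>{..<L}. \<sigma> i \<omega>) \<partial>M) +
    (\<integral>\<omega>. indicator (space M - A) \<omega> * h (\<lambda>i\<in>{..<L}. \<sigma> i \<omega>) \<partial>M)"
    by (intro Bochner_Integration.integral_add intA) auto
  finally have 3: "(\<integral>\<omega>. h (\<lambda>i\<in>{..<L}. \<sigma> i \<omega>) \<partial>M) = \<dots>" .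
  have "\<bar>\<integral>\<omega>. indicator (space M - A) \<omega> * h (\<lambda>i\<in>{..<L}. \<sigma> i \<omega>) \<partial>M\<bar> \<le>
    (\<integral>\<omega>. \<bar>indicator (space M - A) \<omega> * h (\<lambda>i\<in>{..<L}. \<sigma> i \<omega>)\<bar> \<partial>M)"
    by (rule integral_abs_bound)
  also have "\<dots> \<le> (\<integral>\<omega>. indicator (space M - A) \<omega> * B \<partial>M)"
  proof (rule integral_mono)
    show "integrable M (\<lambda>\<omega>. \<bar>indicator (space M - A) \<omega> * h (\<lambda>i\<in>{..<L}. \<sigma> i \<omega>)\<bar>)"
      by (intro integrable_abs intA) auto
    show "integrable M (\<lambda>\<omega>. indicator (space M - A) \<omega> * B)"
      by (intro integrable_mult_left) (auto simp: emeasure_eq_measure)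
    show "\<bar>indicator (space M - A) \<omega> * h (\<lambda>i\<in>{..<L}. \<sigma> i \<omega>)\<bar> \<le> indicator (space M - A) \<omega> * B"
      if "\<omega> \<in> space M" for \<omega>
      using h by (auto simp: abs_mult indicator_def)
  qed
  also have "\<dots> = B * prob (space M - A)" by (simp add: mult.commute)
  finally have 4: "\<bar>\<integral>\<omega>. indicator (space M - A) \<omega> * h (\<lambda>i\<in>{..<L}. \<sigma> i \<omega>) \<partial>M\<bar> \<le> B * prob (space M - A)" .
  have "\<bar>sign_avg L h\<bar> \<le> B"
    using sign_avg_mono[of L h "\<lambda>_. B"] sign_avg_mono[of L "\<lambda>_. -B" h] h by (auto simp: abs_le_iff minus_le_iff)
  then have "\<bar>prob (space M - A) * sign_avg L h\<bar> \<le> prob (space M - A) * B"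
    unfolding abs_mult by (intro mult_mono) auto
  moreover have "sign_avg L h = prob A * sign_avg L h + prob (space M - A) * sign_avg L h"
    using prob_compl[of A] by (simp add: left_diff_distrib)
  ultimately show ?thesis
    using 2 3 4 unfolding Ac[symmetric] by (simp add: algebra_simps)
qed

end

lemma hypercube_walk_imp_cube_walk:
  assumes "hypercube_walk M K \<mu> Y" "K \<ge> 1"
  obtains \<xi> where "cube_walk M K Y \<xi>"
  using assms unfolding hypercube_walk_def cube_walk_def cube_walk_axioms_def by blast

section \<open>Fair coin flips\<close>

text \<open>Independence makes the joint law the product of the marginals, so equal marginals give
  equal expectations across different spaces. \<open>h\<close> lives on infinite sequences but reads
  only \<open>J\<close> entries.\<close>

lemma expectation_indep_vars_eq:
  fixes X :: "nat \<Rightarrow> 'a \<Rightarrow> real" and X' :: "nat \<Rightarrow> 'b \<Rightarrow> real" and h :: "(nat \<Rightarrow> real) \<Rightarrow> real"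
  assumes "prob_space M" "prob_space M'"
    and X: "prob_space.indep_vars M (\<lambda>_. borel) X {..<J}"
    and X': "prob_space.indep_vars M' (\<lambda>_. borel) X' {..<J}"
    and eq: "\<And>j. j < J \<Longrightarrow> distr M borel (X j) = distr M' borel (X' j)"
    and h: "continuous_on UNIV h"
    and dep: "\<And>y y'. (\<And>j. j < J \<Longrightarrow> y j = y' j) \<Longrightarrow> h y = h y'"
  shows "(\<integral>\<omega>. h (\<lambda>j. X j \<omega>) \<partial>M) = (\<integral>\<omega>. h (\<lambda>j. X' j \<omega>) \<partial>M')"
proof (cases "J = 0")
  case True
  interpret M: prob_space M by fact
  interpret M': prob_space M' by fact
  have "h y = h (\<lambda>_. 0)" for y by (rule dep) (use True in auto)
  then obtain a where "\<And>y. h y = a" by blast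
  then show ?thesis by (simp add: M.prob_space M'.prob_space)
next
  case False
  let ?P = "Pi\<^sub>M {..<J} (\<lambda>_. borel :: real measure)"
  \<comment> \<open>Padding with zeros maps the finite product measurably into the sequence space on
    which \<open>h\<close> is continuous; \<open>dep\<close> makes the padding invisible.\<close>
  have "(\<lambda>y j. if j < J then y j else 0) \<in> measurable ?P borel"
  proof (rule measurable_coordinatewise_then_product)
    show "(\<lambda>y. if j < J then y j else 0) \<in> borel_measurable ?P" for j
      by (cases "j < J") auto
  qed
  then have "(\<lambda>y. h (\<lambda>j. if j < J then y j else 0)) \<in> borel_measurable ?P"
    by (rule measurable_compose) (rule borel_measurable_continuous_onI[OF h])
  also have "(\<lambda>y. h (\<lambda>j. if j < J then y j else 0)) = h"
    by (rule ext, rule dep) auto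
  finally have hm: "h \<in> borel_measurable ?P" .
  have law: "(\<integral>\<omega>. h (\<lambda>j. Z j \<omega>) \<partial>Q) = (\<integral>y. h y \<partial>Pi\<^sub>M {..<J} (\<lambda>j. distr Q borel (Z j)))"
    if "prob_space Q" and ind: "prob_space.indep_vars Q (\<lambda>_. borel) Z {..<J}" for Q :: "'c measure" and Z
  proof -
    interpret prob_space Q by fact
    have rv: "random_variable borel (Z j)" if "j \<in> {..<J}" for j
      using ind that by (auto simp: indep_vars_def)
    have "(\<integral>\<omega>. h (\<lambda>j. Z j \<omega>) \<partial>Q) = (\<integral>\<omega>. h (\<lambda>j\<in>{..<J}. Z j \<omega>) \<partial>Q)"
      by (intro Bochner_Integration.integral_cong dep) auto
    also have "\<dots> = (\<integral>y. h y \<partial>distr Q ?P (\<lambda>\<omega>. \<lambda>j\<in>{..<J}. Z j \<omega>))"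
      by (rule integral_distr[symmetric]) (intro measurable_restrict rv hm | assumption)+
    also have "distr Q ?P (\<lambda>\<omega>. \<lambda>j\<in>{..<J}. Z j \<omega>) = Pi\<^sub>M {..<J} (\<lambda>j. distr Q borel (Z j))"
      by (rule indep_vars_iff_distr_eq_PiM'[THEN iffD1, OF _ rv ind]) (use False in auto)
    finally show ?thesis .
  qed
  have "Pi\<^sub>M {..<J} (\<lambda>j. distr M borel (X j)) = Pi\<^sub>M {..<J} (\<lambda>j. distr M' borel (X' j))"
    by (intro PiM_cong refl eq) auto
  then show ?thesis
    using law[OF assms(1) X] law[OF assms(2) X'] by simp
qed

lemma tendsto_coordinatewiseI:
  fixes f :: "'c \<Rightarrow> 'i \<Rightarrow> 'b::topological_space"
  assumes "\<And>i. ((\<lambda>x. f x i) \<longlongrightarrow> l i) F"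
  shows "(f \<longlongrightarrow> l) F"
  using assms limitin_componentwise[of "\<lambda>_. euclidean" UNIV f l F]
  by (simp add: euclidean_product_topology limitin_canonical_iff extensional_def)

lemma indep_vars_PiM_coordinates:
  assumes "\<And>i. i \<in> I \<Longrightarrow> prob_space (\<Omega> i)" "I \<noteq> {}"
  shows "prob_space.indep_vars (Pi\<^sub>M I \<Omega>) \<Omega> (\<lambda>i \<omega>. \<omega> i) I"
proof -
  interpret prob_space "Pi\<^sub>M I \<Omega>" by (rule prob_space_PiM) (use assms in auto)
  have "distr (Pi\<^sub>M I \<Omega>) (Pi\<^sub>M I \<Omega>) (\<lambda>x. \<lambda>i\<in>I. x i) = distr (Pi\<^sub>M I \<Omega>) (Pi\<^sub>M I \<Omega>) (\<lambda>x. x)"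
    by (rule distr_cong) (auto simp: space_PiM PiE_def extensional_restrict)
  also have "\<dots> = Pi\<^sub>M I (\<lambda>i. distr (Pi\<^sub>M I \<Omega>) (\<Omega> i) (\<lambda>x. x i))"
    unfolding distr_id by (intro PiM_cong refl distr_PiM_component[symmetric] assms) auto
  finally show ?thesis
    by (subst indep_vars_iff_distr_eq_PiM') (use assms in auto)
qed

locale fair_signs = prob_space M for M :: "'a measure" +
  fixes \<epsilon> :: "nat \<Rightarrow> 'a \<Rightarrow> real"
  assumes indep: "indep_vars (\<lambda>_. borel) \<epsilon> UNIV"
    and prob_1: "\<And>i. prob {\<omega>\<in>space M. \<epsilon> i \<omega> = 1} = 1 / 2"
    and prob_m1: "\<And>i. prob {\<omega>\<in>space M. \<epsilon> i \<omega> = -1} = 1 / 2"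
begin

lemma measurable_\<epsilon> [measurable]: "\<epsilon> i \<in> borel_measurable M"
  using indep by (auto simp: indep_vars_def)

lemma \<epsilon>_values: "AE \<omega> in M. \<epsilon> i \<omega> = 1 \<or> \<epsilon> i \<omega> = -1"
proof -
  have "prob {\<omega>\<in>space M. \<epsilon> i \<omega> = 1 \<or> \<epsilon> i \<omega> = -1} =
    prob ({\<omega>\<in>space M. \<epsilon> i \<omega> = 1} \<union> {\<omega>\<in>space M. \<epsilon> i \<omega> = -1})"
    by (rule arg_cong[where f=prob]) auto
  also have "\<dots> = prob {\<omega>\<in>space M. \<epsilon> i \<omega> = 1} + prob {\<omega>\<in>space M. \<epsilon> i \<omega> = -1}"
    by (rule finite_measure_Union) auto
  finally have "prob {\<omega>\<in>space M. \<epsilon> i \<omega> = 1 \<or> \<epsilon> i \<omega> = -1} = 1"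
    by (simp add: prob_1 prob_m1)
  then show ?thesis by (subst (asm) prob_Collect_eq_1) auto
qed

lemma prob_signs:
  assumes "s \<in> signs L"
  shows "prob {\<omega>\<in>space M. \<forall>i<L. \<epsilon> i \<omega> = s i} = 1 / 2 ^ L"
proof (cases "L = 0")
  case True
  then show ?thesis by (simp add: prob_space)
next
  case False
  have "{\<omega>\<in>space M. \<forall>i<L. \<epsilon> i \<omega> = s i} = (\<Inter>i\<in>{..<L}. \<epsilon> i -` {s i} \<inter> space M)"
    using False by auto
  then have "prob {\<omega>\<in>space M. \<forall>i<L. \<epsilon> i \<omega> = s i} = (\<Prod>i\<in>{..<L}. prob (\<epsilon> i -` {s i} \<inter> space M))"
    using indep_varsD[OF indep, of "{..<L}" "\<lambda>i. {s i}"] False by auto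
  also have "\<dots> = (\<Prod>i\<in>{..<L}. 1 / 2)"
  proof (rule prod.cong[OF refl])
    fix i assume "i \<in> {..<L}"
    then have "s i = 1 \<or> s i = -1" using signs_values[OF assms] by simp
    moreover have "\<epsilon> i -` {c} \<inter> space M = {\<omega>\<in>space M. \<epsilon> i \<omega> = c}" for c by auto
    ultimately show "prob (\<epsilon> i -` {s i} \<inter> space M) = 1 / 2"
      using prob_1[of i] prob_m1[of i] by auto
  qed
  finally show ?thesis by (simp add: power_divide)
qed

text \<open>The bridge that carries the combinatorial bounds over to any realisation of the coin
  flips.\<close>

lemma expectation_eq_sign_avg:
  assumes h: "(\<lambda>\<omega>. h (\<lambda>i\<in>{..<L}. \<epsilon> i \<omega>)) \<in> borel_measurable M"
  shows "(\<integral>\<omega>. h (\<lambda>i\<in>{..<L}. \<epsilon> i \<omega>) \<partial>M) = sign_avg L h"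
proof -
  have "(\<integral>\<omega>. h (\<lambda>i\<in>{..<L}. \<epsilon> i \<omega>) \<partial>M) = (\<integral>\<omega>. indicator (space M) \<omega> * h (\<lambda>i\<in>{..<L}. \<epsilon> i \<omega>) \<partial>M)"
    by (intro Bochner_Integration.integral_cong) auto
  also have "\<dots> = (\<Sum>s\<in>signs L. h s * prob {\<omega>\<in>space M. \<omega> \<in> space M \<and> (\<forall>i<L. \<epsilon> i \<omega> = s i)})"
    by (rule expectation_signs) (use \<epsilon>_values h in auto)
  also have "\<dots> = sign_avg L h"
    by (simp add: prob_signs sign_avg_def flip: sum_divide_distrib)
  finally show ?thesis .
qed

text \<open>Lets every statement about initial segments apply to a block that starts at an arbitrary
  time.\<close>

lemma shift: "fair_signs M (\<lambda>i. \<epsilon> (a + i))"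
proof
  have "indep_vars (\<lambda>j. Pi\<^sub>M {a + j} (\<lambda>_. borel)) (\<lambda>j \<omega>. restrict (\<lambda>i. \<epsilon> i \<omega>) {a + j}) UNIV"
    by (rule indep_vars_restrict[OF indep]) (auto simp: disjoint_family_on_def)
  then have "indep_vars (\<lambda>_. borel) (\<lambda>j \<omega>. (\<lambda>y. y (a + j)) (restrict (\<lambda>i. \<epsilon> i \<omega>) {a + j})) UNIV"
    by (rule indep_vars_compose2) auto
  then show "indep_vars (\<lambda>_. borel) (\<lambda>i. \<epsilon> (a + i)) UNIV" by simp
qed (use prob_1 prob_m1 in auto)

lemma prob_maximal:
  assumes "c > 0"
  shows "prob {\<omega>\<in>space M. \<exists>k\<le>l. c \<le> \<bar>\<Sum>i<k. \<epsilon> (a + i) \<omega>\<bar>} \<le> 3 * (real l)\<^sup>2 / c ^ 4"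
proof -
  interpret sh: fair_signs M "\<lambda>i. \<epsilon> (a + i)" by (rule shift)
  let ?h = "\<lambda>s :: nat \<Rightarrow> real. of_bool (\<exists>k\<le>l. c \<le> \<bar>sum s {..<k}\<bar>) :: real"
  define E where "E = {\<omega>\<in>space M. \<exists>k\<le>l. c \<le> \<bar>\<Sum>i<k. \<epsilon> (a + i) \<omega>\<bar>}"
  have E [measurable]: "E \<in> sets M" unfolding E_def by measurable
  have h: "?h (\<lambda>i\<in>{..<l}. \<epsilon> (a + i) \<omega>) = indicator E \<omega>" if \<omega>: "\<omega> \<in> space M" for \<omega>
  proof -
    have "sum (\<lambda>i\<in>{..<l}. \<epsilon> (a + i) \<omega>) {..<k} = (\<Sum>i<k. \<epsilon> (a + i) \<omega>)" if "k \<le> l" for k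
      by (rule sum.cong) (use that in auto)
    then have "(\<exists>k\<le>l. c \<le> \<bar>sum (\<lambda>i\<in>{..<l}. \<epsilon> (a + i) \<omega>) {..<k}\<bar>) \<longleftrightarrow> \<omega> \<in> E"
      using \<omega> by (simp only: E_def mem_Collect_eq simp_thms cong: conj_cong)
    then show ?thesis by (simp only: indicator_def)
  qed
  have "sign_avg l ?h = (\<integral>\<omega>. ?h (\<lambda>i\<in>{..<l}. \<epsilon> (a + i) \<omega>) \<partial>M)"
  proof (rule sh.expectation_eq_sign_avg[symmetric])
    show "(\<lambda>\<omega>. ?h (\<lambda>i\<in>{..<l}. \<epsilon> (a + i) \<omega>)) \<in> borel_measurable M"
      by (rule measurable_cong[THEN iffD2, OF h borel_measurable_indicator[OF E]])
  qed
  also have "\<dots> = (\<integral>\<omega>. indicator E \<omega> \<partial>M)"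
    by (rule Bochner_Integration.integral_cong[OF refl h])
  also have "\<dots> = prob E" using sets.sets_into_space[OF E] by (simp add: Int_absorb2)
  finally show ?thesis using sign_avg_maximal[OF assms, of l] by (simp only: E_def)
qed

text \<open>Both laws are computed as the same average over signs, since a shifted sequence is again
  one of fair signs.\<close>

lemma distr_block_sum:
  "distr M borel (\<lambda>\<omega>. \<Sum>i<l. \<epsilon> (a + i) \<omega>) = distr M borel (\<lambda>\<omega>. \<Sum>i<l. \<epsilon> i \<omega>)"
proof -
  have *: "measure M ((\<lambda>\<omega>. \<Sum>i<l. \<epsilon> (b + i) \<omega>) -` A \<inter> space M) = sign_avg l (\<lambda>s. indicator A (sum s {..<l}))"
    if [measurable]: "A \<in> sets borel" for A b
  proof -
    interpret sh: fair_signs M "\<lambda>i. \<epsilon> (b + i)" by (rule shift)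
    have eq: "sum (\<lambda>i\<in>{..<l}. \<epsilon> (b + i) \<omega>) {..<l} = (\<Sum>i<l. \<epsilon> (b + i) \<omega>)" for \<omega>
      by (rule sum.cong) auto
    have "sign_avg l (\<lambda>s. indicator A (sum s {..<l})) =
      (\<integral>\<omega>. indicator A (sum (\<lambda>i\<in>{..<l}. \<epsilon> (b + i) \<omega>) {..<l}) \<partial>M)"
      by (rule sh.expectation_eq_sign_avg[symmetric]) (unfold eq, measurable)
    also have "\<dots> = (\<integral>\<omega>. indicator ((\<lambda>\<omega>. \<Sum>i<l. \<epsilon> (b + i) \<omega>) -` A \<inter> space M) \<omega> \<partial>M)"
      unfolding eq by (intro Bochner_Integration.integral_cong) (auto simp: indicator_def)
    finally show ?thesis by simp
  qed
  show ?thesis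
  proof (rule measure_eqI)
    fix A assume "A \<in> sets (distr M borel (\<lambda>\<omega>. \<Sum>i<l. \<epsilon> (a + i) \<omega>))"
    then have A: "A \<in> sets borel" by simp
    show "emeasure (distr M borel (\<lambda>\<omega>. \<Sum>i<l. \<epsilon> (a + i) \<omega>)) A =
      emeasure (distr M borel (\<lambda>\<omega>. \<Sum>i<l. \<epsilon> i \<omega>)) A"
      using *[OF A, of a] *[OF A, of 0] A by (simp add: emeasure_distr emeasure_eq_measure)
  qed simp
qed

lemma weak_conv_sum:
  "weak_conv_m (\<lambda>l. distr M borel (\<lambda>\<omega>. (\<Sum>i<l. \<epsilon> i \<omega>) / sqrt (real l))) std_normal_distribution"
proof -
  have sq: "(\<integral>\<omega>. (\<epsilon> i \<omega>)\<^sup>2 \<partial>M) = 1" for i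
  proof -
    have "(\<integral>\<omega>. (\<epsilon> i \<omega>)\<^sup>2 \<partial>M) = (\<integral>\<omega>. 1 \<partial>M)"
      by (rule integral_cong_AE) (use \<epsilon>_values[of i] in \<open>auto elim: eventually_mono\<close>)
    then show ?thesis by (simp add: prob_space)
  qed
  have mean: "expectation (\<epsilon> i) = 0" for i
  proof -
    interpret sh: fair_signs M "\<lambda>k. \<epsilon> (i + k)" by (rule shift)
    show ?thesis
      using sh.expectation_eq_sign_avg[of "\<lambda>s. s 0" 1] by (simp add: sign_avg_Suc)
  qed
  have "weak_conv_m (\<lambda>l. distr M borel (\<lambda>\<omega>. (\<Sum>i<l. \<epsilon> i \<omega>) / sqrt (real l * 1\<^sup>2))) std_normal_distribution"
  proof (rule central_limit_theorem_zero_mean[OF indep mean])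
    show "integrable M (\<lambda>x. (\<epsilon> n x)\<^sup>2)" for n
      by (rule integrable_const_bound[where B=1]) (use \<epsilon>_values[of n] in \<open>auto elim!: eventually_mono\<close>)
    show "variance (\<epsilon> n) = 1\<^sup>2" for n using mean sq by simp
    show "distr M borel (\<epsilon> n) = distr M borel (\<epsilon> 0)" for n
      using distr_block_sum[of n 1] by simp
  qed simp
  then show ?thesis by simp
qed

text \<open>A joint central limit theorem from the one-dimensional one. Skorokhod's representation
  gives normalised sums that converge pointwise on some \<Omega>; a product of \<open>J\<close>
  copies of \<Omega> realises the independent blocks and the independent Gaussians together. Then
  dominated convergence applies to \<open>h\<close>.\<close>

lemma block_sums_converge:
  fixes b :: "nat \<Rightarrow> nat \<Rightarrow> nat" and G :: "nat \<Rightarrow> 'b \<Rightarrow> real" and h :: "(nat \<Rightarrow> real) \<Rightarrow> real"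
  assumes "prob_space N"
    and G: "prob_space.indep_vars N (\<lambda>_. borel) G {..<J}"
    and G_distr: "\<And>j. j < J \<Longrightarrow> distr N borel (G j) = distr std_normal_distribution borel (\<lambda>x. v * x)"
    and b: "\<And>n. mono (b n)"
    and len: "\<And>j. j < J \<Longrightarrow> filterlim (\<lambda>n. b n (Suc j) - b n j) at_top sequentially"
    and c: "\<And>j. j < J \<Longrightarrow> (\<lambda>n. c n * sqrt (real (b n (Suc j) - b n j))) \<longlonglongrightarrow> v"
    and h: "continuous_on UNIV h" and B: "\<And>y. \<bar>h y\<bar> \<le> B"
    and dep: "\<And>y y'. (\<And>j. j < J \<Longrightarrow> y j = y' j) \<Longrightarrow> h y = h y'"
  shows "(\<lambda>n. \<integral>\<omega>. h (\<lambda>j. c n * (\<Sum>i = b n j..<b n (Suc j). \<epsilon> i \<omega>)) \<partial>M) \<longlonglongrightarrow> (\<integral>\<omega>. h (\<lambda>j. G j \<omega>) \<partial>N)"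
proof (cases "J = 0")
  case True
  interpret N: prob_space N by fact
  have "h y = h (\<lambda>_. 0)" for y by (rule dep) (use True in auto)
  then obtain a where "\<And>y. h y = a" by blast
  then show ?thesis by (simp add: prob_space N.prob_space)
next
  case False
  define l where "l n j = b n (Suc j) - b n j" for n j
  define D where "D n j \<omega> = c n * (\<Sum>i = b n j..<b n (Suc j). \<epsilon> i \<omega>)" for n j \<omega>
  have rd: "real_distribution (distr M borel (\<lambda>\<omega>. (\<Sum>i<l. \<epsilon> i \<omega>) / sqrt (real l)))" for l
    by (rule real_distribution_distr) measurable
  have rs: "real_distribution std_normal_distribution"
    by (rule real_dist_normal_dist)
  \<comment> \<open>One sequence, indexed by the length of the sum, serves all blocks: block j uses
    the entry at its own length \<open>l n j\<close>, read in coordinate j of the product.\<close>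
  from Skorohod[OF rd rs weak_conv_sum] obtain \<Omega> :: "real measure" and V_seq :: "nat \<Rightarrow> real \<Rightarrow> real" and V where
    sk: "prob_space \<Omega> \<and> (\<forall>l. V_seq l \<in> borel_measurable \<Omega>) \<and>
      (\<forall>l. distr \<Omega> borel (V_seq l) = distr M borel (\<lambda>\<omega>. (\<Sum>i<l. \<epsilon> i \<omega>) / sqrt (real l))) \<and>
      V \<in> measurable \<Omega> lborel \<and> distr \<Omega> borel V = std_normal_distribution \<and>
      (\<forall>x\<in>space \<Omega>. (\<lambda>l. V_seq l x) \<longlonglongrightarrow> V x)"
    by (elim exE) (rule that)
  then have \<Omega>: "prob_space \<Omega>" and V_seq [measurable]: "\<And>l. V_seq l \<in> borel_measurable \<Omega>"
    and V_seq_distr: "\<And>l. distr \<Omega> borel (V_seq l) = distr M borel (\<lambda>\<omega>. (\<Sum>i<l. \<epsilon> i \<omega>) / sqrt (real l))"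
    and V_distr: "distr \<Omega> borel V = std_normal_distribution"
    and V_lim: "\<And>x. x \<in> space \<Omega> \<Longrightarrow> (\<lambda>l. V_seq l x) \<longlonglongrightarrow> V x"
    by auto
  have V [measurable]: "V \<in> borel_measurable \<Omega>" using sk by simp
  define P where "P = Pi\<^sub>M {..<J} (\<lambda>_. \<Omega>)"
  interpret P: prob_space P unfolding P_def by (rule prob_space_PiM) (rule \<Omega>)
  have indP: "P.indep_vars (\<lambda>_. \<Omega>) (\<lambda>i \<omega>. \<omega> i) {..<J}"
    unfolding P_def by (rule indep_vars_PiM_coordinates) (use \<Omega> False in auto)
  have compP: "P.indep_vars (\<lambda>_. borel) (\<lambda>j \<omega>. f j (\<omega> j)) {..<J}"
    if "\<And>j. f j \<in> borel_measurable \<Omega>" for f :: "nat \<Rightarrow> real \<Rightarrow> real"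
    using indP by (rule P.indep_vars_compose2) (use that in auto)
  have coordP: "distr P borel (\<lambda>\<omega>. f (\<omega> j)) = distr \<Omega> borel f"
    if "j < J" and [measurable]: "f \<in> borel_measurable \<Omega>" for f :: "real \<Rightarrow> real" and j
  proof -
    have "distr P borel (\<lambda>\<omega>. f (\<omega> j)) = distr (distr P \<Omega> (\<lambda>\<omega>. \<omega> j)) borel f"
      unfolding P_def by (subst distr_distr) (use that in \<open>auto simp: o_def\<close>)
    also have "distr P \<Omega> (\<lambda>\<omega>. \<omega> j) = \<Omega>"
      unfolding P_def by (rule distr_PiM_component) (use \<Omega> that in auto)
    finally show ?thesis .
  qed
  have block_M: "(\<integral>\<omega>. h (\<lambda>j. D n j \<omega>) \<partial>M) = (\<integral>\<omega>. h (\<lambda>j. c n * sqrt (real (l n j)) * V_seq (l n j) (\<omega> j)) \<partial>P)" for n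
  proof (rule expectation_indep_vars_eq[OF prob_space_axioms P.prob_space_axioms _ _ _ h dep])
    have "disjoint_family_on (\<lambda>j. {b n j..<b n (Suc j)}) {..<J}"
      unfolding disjoint_family_on_def
    proof (intro ballI impI)
      fix j k :: nat assume "j \<noteq> k"
      then consider "Suc j \<le> k" | "Suc k \<le> j" by linarith
      then show "{b n j..<b n (Suc j)} \<inter> {b n k..<b n (Suc k)} = {}"
        by cases (use monoD[OF b, of "Suc j" k n] monoD[OF b, of "Suc k" j n] in auto)
    qed
    then have "indep_vars (\<lambda>j. Pi\<^sub>M {b n j..<b n (Suc j)} (\<lambda>_. borel))
      (\<lambda>j \<omega>. restrict (\<lambda>i. \<epsilon> i \<omega>) {b n j..<b n (Suc j)}) {..<J}"
      by (intro indep_vars_restrict[OF indep]) auto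
    then have "indep_vars (\<lambda>_. borel)
      (\<lambda>j \<omega>. (\<lambda>y. c n * (\<Sum>i = b n j..<b n (Suc j). y i)) (restrict (\<lambda>i. \<epsilon> i \<omega>) {b n j..<b n (Suc j)})) {..<J}"
      by (rule indep_vars_compose2) auto
    also have "(\<lambda>j \<omega>. (\<lambda>y. c n * (\<Sum>i = b n j..<b n (Suc j). y i)) (restrict (\<lambda>i. \<epsilon> i \<omega>) {b n j..<b n (Suc j)})) = D n"
      by (intro ext) (auto simp: D_def)
    finally show "indep_vars (\<lambda>_. borel) (D n) {..<J}" .
    show "P.indep_vars (\<lambda>_. borel) (\<lambda>j \<omega>. c n * sqrt (real (l n j)) * V_seq (l n j) (\<omega> j)) {..<J}"
      by (rule compP) auto
    fix j assume j: "j < J"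
    have sum_eq: "(\<Sum>i = b n j..<b n (Suc j). \<epsilon> i \<omega>) = (\<Sum>i<l n j. \<epsilon> (b n j + i) \<omega>)" for \<omega>
    proof -
      have "b n j \<le> b n (Suc j)" using monoD[OF b] by simp
      then have "{b n j..<b n (Suc j)} = {0 + b n j..<l n j + b n j}" by (simp add: l_def)
      then show ?thesis
        by (simp only: sum.shift_bounds_nat_ivl) (simp add: atLeast0LessThan add.commute)
    qed
    have "distr M borel (D n j) = distr (distr M borel (\<lambda>\<omega>. \<Sum>i<l n j. \<epsilon> (b n j + i) \<omega>)) borel (\<lambda>x. c n * x)"
      unfolding D_def sum_eq by (subst distr_distr) (auto simp: o_def)
    also have "\<dots> = distr M borel (\<lambda>\<omega>. c n * (\<Sum>i<l n j. \<epsilon> i \<omega>))"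
      unfolding distr_block_sum by (subst distr_distr) (auto simp: o_def)
    also have "(\<lambda>\<omega>. c n * (\<Sum>i<l n j. \<epsilon> i \<omega>)) =
      (\<lambda>\<omega>. c n * sqrt (real (l n j)) * ((\<Sum>i<l n j. \<epsilon> i \<omega>) / sqrt (real (l n j))))"
      \<comment> \<open>For an empty block both sides are 0, the quotient by sqrt 0 being 0.\<close>
      by (cases "l n j = 0") auto
    also have "distr M borel \<dots> = distr (distr M borel (\<lambda>\<omega>. (\<Sum>i<l n j. \<epsilon> i \<omega>) / sqrt (real (l n j)))) borel (\<lambda>x. c n * sqrt (real (l n j)) * x)"
      by (subst distr_distr) (auto simp: o_def)
    also have "\<dots> = distr \<Omega> borel (\<lambda>x. c n * sqrt (real (l n j)) * V_seq (l n j) x)"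
      unfolding V_seq_distr[symmetric] by (subst distr_distr) (auto simp: o_def)
    also have "\<dots> = distr P borel (\<lambda>\<omega>. c n * sqrt (real (l n j)) * V_seq (l n j) (\<omega> j))"
      by (rule coordP[symmetric, OF j]) auto
    finally show "distr M borel (D n j) = distr P borel (\<lambda>\<omega>. c n * sqrt (real (l n j)) * V_seq (l n j) (\<omega> j))" .
  qed
  have block_N: "(\<integral>\<omega>. h (\<lambda>j. G j \<omega>) \<partial>N) = (\<integral>\<omega>. h (\<lambda>j. v * V (\<omega> j)) \<partial>P)"
  proof (rule expectation_indep_vars_eq[OF assms(1) P.prob_space_axioms G _ _ h dep])
    show "P.indep_vars (\<lambda>_. borel) (\<lambda>j \<omega>. v * V (\<omega> j)) {..<J}" by (rule compP) auto
    fix j assume j: "j < J"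
    have "distr N borel (G j) = distr \<Omega> borel (\<lambda>x. v * V x)"
      unfolding G_distr[OF j] V_distr[symmetric] by (subst distr_distr) (auto simp: o_def)
    also have "\<dots> = distr P borel (\<lambda>\<omega>. v * V (\<omega> j))"
      by (rule coordP[symmetric, OF j]) auto
    finally show "distr N borel (G j) = distr P borel (\<lambda>\<omega>. v * V (\<omega> j))" .
  qed
  \<comment> \<open>Coordinates from \<open>J\<close> on are not controlled. Frozen at 0, they do
    not disturb convergence in the product topology, where \<open>h\<close> is continuous.\<close>
  have hJ: "h y = h (\<lambda>j. if j < J then y j else 0)" for y by (rule dep) auto
  have hmeas: "(\<lambda>\<omega>. h (\<lambda>j. f j (\<omega> j))) \<in> borel_measurable P"
    if [measurable]: "\<And>j. f j \<in> borel_measurable \<Omega>" for f :: "nat \<Rightarrow> real \<Rightarrow> real"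
  proof -
    have "(\<lambda>\<omega> j. if j < J then f j (\<omega> j) else 0) \<in> borel_measurable P"
    proof (rule measurable_coordinatewise_then_product)
      show "(\<lambda>\<omega>. if j < J then f j (\<omega> j) else 0) \<in> borel_measurable P" for j
        unfolding P_def by (cases "j < J") auto
    qed
    then have "(\<lambda>\<omega>. h (\<lambda>j. if j < J then f j (\<omega> j) else 0)) \<in> borel_measurable P"
      by (rule measurable_compose) (rule borel_measurable_continuous_onI[OF h])
    then show ?thesis by (subst hJ)
  qed
  have "(\<lambda>n. \<integral>\<omega>. h (\<lambda>j. c n * sqrt (real (l n j)) * V_seq (l n j) (\<omega> j)) \<partial>P) \<longlonglongrightarrow> (\<integral>\<omega>. h (\<lambda>j. v * V (\<omega> j)) \<partial>P)"
  proof (rule integral_dominated_convergence[where w="\<lambda>_. B"])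
    show "AE \<omega> in P. (\<lambda>n. h (\<lambda>j. c n * sqrt (real (l n j)) * V_seq (l n j) (\<omega> j))) \<longlonglongrightarrow> h (\<lambda>j. v * V (\<omega> j))"
    proof (rule AE_I2)
      fix \<omega> assume \<omega>: "\<omega> \<in> space P"
      have "(\<lambda>n j. if j < J then c n * sqrt (real (l n j)) * V_seq (l n j) (\<omega> j) else 0) \<longlonglongrightarrow>
        (\<lambda>j. if j < J then v * V (\<omega> j) else 0)"
      proof (rule tendsto_coordinatewiseI)
        fix j
        show "(\<lambda>n. if j < J then c n * sqrt (real (l n j)) * V_seq (l n j) (\<omega> j) else 0) \<longlonglongrightarrow>
          (if j < J then v * V (\<omega> j) else 0)"
        proof (cases "j < J")
          case True
          have "\<omega> j \<in> space \<Omega>" using \<omega> True by (auto simp: P_def space_PiM PiE_iff)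
          from filterlim_compose[OF V_lim[OF this] len[OF True]]
          show ?thesis using True c[OF True] by (auto simp: l_def intro!: tendsto_mult)
        qed simp
      qed
      then have "(\<lambda>n. h (\<lambda>j. if j < J then c n * sqrt (real (l n j)) * V_seq (l n j) (\<omega> j) else 0)) \<longlonglongrightarrow>
        h (\<lambda>j. if j < J then v * V (\<omega> j) else 0)"
        using h unfolding continuous_on_sequentially by (auto simp: o_def)
      then show "(\<lambda>n. h (\<lambda>j. c n * sqrt (real (l n j)) * V_seq (l n j) (\<omega> j))) \<longlonglongrightarrow> h (\<lambda>j. v * V (\<omega> j))"
        by (subst (1 2) hJ)
    qed
  qed (use B in \<open>auto intro!: hmeas\<close>)
  then show ?thesis
    unfolding block_M[symmetric] block_N[symmetric] D_def .
qed

end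

text \<open>The coin flips live on an auxiliary space unrelated to those of the walks and of the
  Brownian motion; only laws are ever compared.\<close>

lemma fair_signs_exist: "\<exists>(C :: (nat \<Rightarrow> real) measure) \<epsilon>. fair_signs C \<epsilon>"
proof (intro exI)
  define D where "D = distr (measure_pmf (pmf_of_set {-1, 1 :: real})) borel (\<lambda>x. x)"
  define C where "C = Pi\<^sub>M (UNIV :: nat set) (\<lambda>_. D)"
  interpret D: prob_space D
    unfolding D_def by (rule measure_pmf.prob_space_distr) simp
  interpret C: prob_space C
    unfolding C_def by (rule prob_space_PiM) (rule D.prob_space_axioms)
  have sD: "sets D = sets borel" by (simp add: D_def)
  have *: "C.prob {\<omega>\<in>space C. \<omega> i = a} = 1 / 2" if a: "a = 1 \<or> a = -1" for a i
  proof -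
    have "C.prob {\<omega>\<in>space C. \<omega> i = a} = measure (distr C D (\<lambda>\<omega>. \<omega> i)) {a}"
      unfolding C_def by (subst measure_distr) (auto simp: sD intro!: arg_cong[where f="measure _"])
    also have "distr C D (\<lambda>\<omega>. \<omega> i) = D"
      unfolding C_def by (rule distr_PiM_component) (auto intro: D.prob_space_axioms)
    also have "measure D {a} = 1 / 2"
      unfolding D_def using a by (subst measure_distr) (auto simp: measure_pmf_single)
    finally show ?thesis .
  qed
  show "fair_signs C (\<lambda>i \<omega>. \<omega> i)"
  proof
    have "C.indep_vars (\<lambda>_. D) (\<lambda>i \<omega>. \<omega> i) UNIV"
      unfolding C_def by (rule indep_vars_PiM_coordinates) (auto intro: D.prob_space_axioms)
    then have "C.indep_vars (\<lambda>_. borel) (\<lambda>i \<omega>. (\<lambda>x. x) (\<omega> i)) UNIV"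
      by (rule C.indep_vars_compose2) (rule measurable_ident_sets[OF sD])
    then show "C.indep_vars (\<lambda>_. borel) (\<lambda>i \<omega>. \<omega> i) UNIV" by simp
  qed (use * in auto)
qed

section \<open>Convergence of the paths\<close>

lemma continuous_cadlag:
  assumes w: "continuous_on {0..} w"
  shows "(\<lambda>t\<in>{0..}. w t) \<in> cadlag_space"
proof -
  let ?w = "\<lambda>t\<in>{0..}. w t"
  have c: "continuous_on {0..} ?w"
    using w by (rule continuous_on_cong[THEN iffD1, rotated -1]) auto
  have 1: "(?w \<longlongrightarrow> ?w t) (at_right t)" if "t \<ge> 0" for t
  proof -
    have "(?w \<longlongrightarrow> ?w t) (at t within {0..})" by (rule c[unfolded continuous_on_def, rule_format]) (use that in simp)
    then show ?thesis by (rule tendsto_within_subset) (use that in auto)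
  qed
  have 2: "(?w \<longlongrightarrow> ?w t) (at_left t)" if "t > 0" for t
  proof -
    have "(?w \<longlongrightarrow> ?w t) (at t within {0..})" by (rule c[unfolded continuous_on_def, rule_format]) (use that in simp)
    moreover have "at t within {0..} = at t" using that by (intro at_within_interior) auto
    ultimately show ?thesis by (metis filterlim_at_split)
  qed
  have "?w \<in> extensional {0..}" by (simp only: restrict_extensional)
  then show ?thesis
    unfolding cadlag_space_def using 1 2 by blast
qed

text \<open>Uniform continuity on [0, T]; sampling at the left end of each cell keeps the sampled
  time inside that interval.\<close>

lemma step_path_approx:
  assumes w: "continuous_on {0..} w"
  shows "(\<lambda>m. lu_dist (step_path ((real m)\<^sup>2) (\<lambda>k. w (real k / (real m)\<^sup>2))) (\<lambda>t\<in>{0..}. w t)) \<longlonglongrightarrow> 0"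
proof (rule lu_dist_tendsto_zeroI)
  fix T :: nat and e :: real assume e: "e > 0"
  have "uniformly_continuous_on {0..real T} w"
    by (intro compact_uniformly_continuous continuous_on_subset[OF w]) auto
  then obtain d where d: "d > 0" "\<And>x y. x \<in> {0..real T} \<Longrightarrow> y \<in> {0..real T} \<Longrightarrow> dist y x < d \<Longrightarrow> dist (w y) (w x) < e"
    using e unfolding uniformly_continuous_on_def by metis
  obtain m0 :: nat where m0: "1 / d < real m0" using reals_Archimedean2 by blast
  show "\<forall>\<^sub>F m in sequentially. \<forall>t\<in>{0..<real T}.
    \<bar>step_path ((real m)\<^sup>2) (\<lambda>k. w (real k / (real m)\<^sup>2)) t - (\<lambda>t\<in>{0..}. w t) t\<bar> \<le> e"
  proof (rule eventually_sequentiallyI[of "max 1 m0"], intro ballI)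
    fix m t assume m: "max 1 m0 \<le> m" and t: "t \<in> {0..<real T}"
    define r where "r = (real m)\<^sup>2"
    have "real m \<ge> 1" using m by simp
    then have r1: "r \<ge> real m" unfolding r_def by (simp add: power2_eq_square)
    then have "r > 1 / d" "r > 0" using m0 m \<open>real m \<ge> 1\<close> by linarith+
    define k where "k = nat \<lfloor>r * t\<rfloor>"
    have "0 \<le> r * t" using \<open>r > 0\<close> t by simp
    then have k: "real k \<le> r * t" "r * t < real k + 1"
      unfolding k_def by linarith+
    have "real k / r \<le> t" "t < real k / r + 1 / r" using k \<open>r > 0\<close> by (auto simp: field_simps)
    moreover have "1 / r < d" using \<open>r > 1 / d\<close> \<open>r > 0\<close> d by (simp add: field_simps)
    ultimately have "dist (w (real k / r)) (w t) < e"
      using t \<open>r > 0\<close> by (intro d) (auto simp: dist_real_def)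
    then show "\<bar>step_path ((real m)\<^sup>2) (\<lambda>k. w (real k / (real m)\<^sup>2)) t - (\<lambda>t\<in>{0..}. w t) t\<bar> \<le> e"
      using t by (simp add: step_path_def dist_real_def flip: r_def k_def)
  qed
qed

lemma lu_lipschitz_step_path_measurable:
  fixes p :: "(nat \<Rightarrow> real) \<Rightarrow> nat \<Rightarrow> real"
  assumes G: "lu_lipschitz k G" and r: "r \<ge> 0" and p: "\<And>j. continuous_on UNIV (\<lambda>s. p s j)"
    and f: "\<And>i. f i \<in> borel_measurable M"
  shows "(\<lambda>\<omega>. G (step_path r (p (\<lambda>i. f i \<omega>)))) \<in> borel_measurable M"
proof -
  have "(\<lambda>\<omega> i. f i \<omega>) \<in> borel_measurable M"
    by (rule measurable_coordinatewise_then_product) (rule f)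
  then show ?thesis
    by (rule measurable_compose)
       (rule borel_measurable_continuous_onI[OF lu_lipschitz_step_path_continuous[OF G r p]])
qed

lemma continuous_on_partial_sum: "continuous_on UNIV (\<lambda>s :: nat \<Rightarrow> real. c * sum s {..<k})"
  by (intro continuous_intros continuous_on_product_coordinates)

text \<open>Half of a portmanteau argument. The inf-convolutions lie below \<open>F\<close> and
  converge to it, so one of them can be fixed that loses less than \<open>e\<close> in the limiting
  integral; it is Lipschitz, so \<open>conv\<close> applies to it, and \<open>F\<close> dominates it
  for every n.\<close>

lemma lu_continuous_lower_bound:
  fixes Z :: "nat \<Rightarrow> 'a \<Rightarrow> real \<Rightarrow> real" and Z' :: "'b \<Rightarrow> real \<Rightarrow> real" and F :: "(real \<Rightarrow> real) \<Rightarrow> real"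
  assumes M: "\<And>n. prob_space (M n)" and N: "prob_space N"
    and Z: "\<And>n \<omega>. \<omega> \<in> space (M n) \<Longrightarrow> Z n \<omega> \<in> cadlag_space"
    and Z': "\<And>\<omega>. \<omega> \<in> space N \<Longrightarrow> Z' \<omega> \<in> cadlag_space"
    and Zm: "\<And>k G n. lu_lipschitz k G \<Longrightarrow> (\<lambda>\<omega>. G (Z n \<omega>)) \<in> borel_measurable (M n)"
    and Z'm: "\<And>k G. lu_lipschitz k G \<Longrightarrow> (\<lambda>\<omega>. G (Z' \<omega>)) \<in> borel_measurable N"
    and conv: "\<And>k G B. lu_lipschitz k G \<Longrightarrow> k \<ge> 0 \<Longrightarrow> (\<And>x. x \<in> cadlag_space \<Longrightarrow> \<bar>G x\<bar> \<le> B) \<Longrightarrow>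
      (\<lambda>n. \<integral>\<omega>. G (Z n \<omega>) \<partial>M n) \<longlonglongrightarrow> (\<integral>\<omega>. G (Z' \<omega>) \<partial>N)"
    and F: "\<And>x a. (\<And>n. x n \<in> cadlag_space) \<Longrightarrow> a \<in> cadlag_space \<Longrightarrow>
      (\<lambda>n. lu_dist (x n) a) \<longlonglongrightarrow> 0 \<Longrightarrow> (\<lambda>n. F (x n)) \<longlonglongrightarrow> F a"
    and B: "\<And>x. x \<in> cadlag_space \<Longrightarrow> \<bar>F x\<bar> \<le> B" and e: "e > 0"
  shows "\<forall>\<^sub>F n in sequentially. (\<integral>\<omega>. F (Z' \<omega>) \<partial>N) - e < (\<integral>\<omega>. F (Z n \<omega>) \<partial>M n)"
proof -
  interpret N: prob_space N by fact
  interpret M: prob_space "M n" for n by (rule M)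
  define H where "H k = inf_conv cadlag_space F (real k)" for k
  have ne: "cadlag_space \<noteq> {}" using step_path_cadlag[of 0] by auto
  have lip: "lu_lipschitz (real k) (H k)" for k
    unfolding H_def by (rule lu_lipschitz_inf_conv[where B=B]) (use ne B in auto)
  have lim: "(\<lambda>k. H k a) \<longlonglongrightarrow> F a" if "a \<in> cadlag_space" for a
    unfolding H_def by (rule inf_conv_tendsto[where B=B]) (use that B F in auto)
  have HF: "H k a \<le> F a" if "a \<in> cadlag_space" for k a
    using inf_conv_le[of cadlag_space "real k" F B a a] ne B that by (simp add: H_def)
  have HB: "\<bar>H k a\<bar> \<le> B" if "a \<in> cadlag_space" for k a
    using inf_conv_ge[of cadlag_space "real k" F B a] HF[OF that, of k] B[OF that] ne B
    by (auto simp: H_def abs_le_iff)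
  \<comment> \<open>\<open>F\<close> need not be Lipschitz, but along the paths it is a pointwise
    limit of Lipschitz functionals, hence measurable.\<close>
  have Fm: "(\<lambda>\<omega>. F (Z n \<omega>)) \<in> borel_measurable (M n)" for n
    by (rule borel_measurable_LIMSEQ_real[where u="\<lambda>k \<omega>. H k (Z n \<omega>)", OF _ Zm[OF lip]]) (use lim Z in auto)
  have F'm: "(\<lambda>\<omega>. F (Z' \<omega>)) \<in> borel_measurable N"
    by (rule borel_measurable_LIMSEQ_real[where u="\<lambda>k \<omega>. H k (Z' \<omega>)", OF _ Z'm[OF lip]]) (use lim Z' in auto)
  have "(\<lambda>k. \<integral>\<omega>. H k (Z' \<omega>) \<partial>N) \<longlonglongrightarrow> (\<integral>\<omega>. F (Z' \<omega>) \<partial>N)"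
    by (rule integral_dominated_convergence[where w="\<lambda>_. B"])
       (use F'm Z'm[OF lip] lim HB Z' in \<open>auto intro!: AE_I2\<close>)
  then have "\<forall>\<^sub>F k in sequentially. (\<integral>\<omega>. H k (Z' \<omega>) \<partial>N) > (\<integral>\<omega>. F (Z' \<omega>) \<partial>N) - e"
    by (rule order_tendstoD) (use e in simp)
  then obtain k where k: "(\<integral>\<omega>. H k (Z' \<omega>) \<partial>N) > (\<integral>\<omega>. F (Z' \<omega>) \<partial>N) - e"
    by (auto simp: eventually_sequentially)
  have "(\<lambda>n. \<integral>\<omega>. H k (Z n \<omega>) \<partial>M n) \<longlonglongrightarrow> (\<integral>\<omega>. H k (Z' \<omega>) \<partial>N)"
    by (rule conv[where B=B, OF lip]) (use HB in auto)
  from order_tendstoD(1)[OF this k]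
  show ?thesis
  proof (rule eventually_mono)
    fix n assume *: "(\<integral>\<omega>. F (Z' \<omega>) \<partial>N) - e < (\<integral>\<omega>. H k (Z n \<omega>) \<partial>M n)"
    have "(\<integral>\<omega>. H k (Z n \<omega>) \<partial>M n) \<le> (\<integral>\<omega>. F (Z n \<omega>) \<partial>M n)"
    proof (rule integral_mono)
      show "integrable (M n) (\<lambda>\<omega>. H k (Z n \<omega>))"
        by (rule M.integrable_const_bound[where B=B]) (use Zm[OF lip] HB Z in \<open>auto intro!: AE_I2\<close>)
      show "integrable (M n) (\<lambda>\<omega>. F (Z n \<omega>))"
        by (rule M.integrable_const_bound[where B=B]) (use Fm B Z in \<open>auto intro!: AE_I2\<close>)
    qed (use HF Z in auto)
    with * show "(\<integral>\<omega>. F (Z' \<omega>) \<partial>N) - e < (\<integral>\<omega>. F (Z n \<omega>) \<partial>M n)" by simp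
  qed
qed

lemma converges_in_distribution_skorokhodI:
  fixes Z :: "nat \<Rightarrow> 'a \<Rightarrow> real \<Rightarrow> real" and Z' :: "'b \<Rightarrow> real \<Rightarrow> real"
  assumes M: "\<And>n. prob_space (M n)" and N: "prob_space N"
    and Z: "\<And>n \<omega>. \<omega> \<in> space (M n) \<Longrightarrow> Z n \<omega> \<in> cadlag_space"
    and Z': "\<And>\<omega>. \<omega> \<in> space N \<Longrightarrow> Z' \<omega> \<in> cadlag_space"
    and Zm: "\<And>k G n. lu_lipschitz k G \<Longrightarrow> (\<lambda>\<omega>. G (Z n \<omega>)) \<in> borel_measurable (M n)"
    and Z'm: "\<And>k G. lu_lipschitz k G \<Longrightarrow> (\<lambda>\<omega>. G (Z' \<omega>)) \<in> borel_measurable N"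
    and conv: "\<And>k G B. lu_lipschitz k G \<Longrightarrow> k \<ge> 0 \<Longrightarrow> (\<And>x. x \<in> cadlag_space \<Longrightarrow> \<bar>G x\<bar> \<le> B) \<Longrightarrow>
      (\<lambda>n. \<integral>\<omega>. G (Z n \<omega>) \<partial>M n) \<longlonglongrightarrow> (\<integral>\<omega>. G (Z' \<omega>) \<partial>N)"
  shows "converges_in_distribution skorokhod_topology M Z N Z'"
  unfolding converges_in_distribution_def
proof (intro conjI allI impI)
  show "Z n \<in> measurable (M n) (borel_of skorokhod_topology)" for n
    by (rule measurable_borel_of_skorokhodI) (use Z Zm in auto)
  show "Z' \<in> measurable N (borel_of skorokhod_topology)"
    by (rule measurable_borel_of_skorokhodI) (use Z' Z'm in auto)
  fix F :: "(real \<Rightarrow> real) \<Rightarrow> real"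
  assume F: "continuous_map skorokhod_topology euclideanreal F"
    and "bounded (F ` topspace skorokhod_topology)"
  then obtain B where B: "\<And>x. x \<in> cadlag_space \<Longrightarrow> \<bar>F x\<bar> \<le> B"
    by (auto simp: bounded_iff topspace_skorokhod_topology)
  have Flim: "(\<lambda>n. F (x n)) \<longlonglongrightarrow> F a" if "\<And>n. x n \<in> cadlag_space" "a \<in> cadlag_space"
    "(\<lambda>n. lu_dist (x n) a) \<longlonglongrightarrow> 0" for x a
    by (rule continuous_map_skorokhod_lu[OF F that])
  have low: "\<forall>\<^sub>F n in sequentially. (\<integral>\<omega>. F (Z' \<omega>) \<partial>N) - e < (\<integral>\<omega>. F (Z n \<omega>) \<partial>M n)" if "e > 0" for e
    by (rule lu_continuous_lower_bound[where B=B]) (fact M N Z Z' Zm Z'm conv Flim B that)+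
  \<comment> \<open>The class of admissible functionals is closed under negation, which turns the
    lower bound into the upper one.\<close>
  have "\<forall>\<^sub>F n in sequentially. (\<integral>\<omega>. - F (Z' \<omega>) \<partial>N) - e < (\<integral>\<omega>. - F (Z n \<omega>) \<partial>M n)" if "e > 0" for e
  proof (rule lu_continuous_lower_bound[where B=B and F="\<lambda>x. - F x"])
    show "\<bar>- F x\<bar> \<le> B" if "x \<in> cadlag_space" for x using B[OF that] by simp
    show "(\<lambda>n. - F (x n)) \<longlonglongrightarrow> - F a" if "\<And>n. x n \<in> cadlag_space" "a \<in> cadlag_space"
      "(\<lambda>n. lu_dist (x n) a) \<longlonglongrightarrow> 0" for x a
      by (intro tendsto_minus Flim that)
  qed (fact M N Z Z' Zm Z'm conv that)+
  then have high: "\<forall>\<^sub>F n in sequentially. (\<integral>\<omega>. F (Z n \<omega>) \<partial>M n) < (\<integral>\<omega>. F (Z' \<omega>) \<partial>N) + e" if "e > 0" for e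
    using eventually_mono[of _ sequentially "\<lambda>n. (\<integral>\<omega>. F (Z n \<omega>) \<partial>M n) < (\<integral>\<omega>. F (Z' \<omega>) \<partial>N) + e"] that by force
  show "(\<lambda>n. \<integral>\<omega>. F (Z n \<omega>) \<partial>M n) \<longlonglongrightarrow> (\<integral>\<omega>. F (Z' \<omega>) \<partial>N)"
  proof (rule tendstoI)
    fix e :: real assume "e > 0"
    from low[OF this] high[OF this]
    show "\<forall>\<^sub>F n in sequentially. dist (\<integral>\<omega>. F (Z n \<omega>) \<partial>M n) (\<integral>\<omega>. F (Z' \<omega>) \<partial>N) < e"
      by eventually_elim (auto simp: dist_real_def abs_less_iff)
  qed
qed

section \<open>Rescaled, stopped and discretised paths\<close>

definition walk_path :: "nat \<Rightarrow> (nat \<Rightarrow> real) \<Rightarrow> real \<Rightarrow> real" where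
  "walk_path n s = step_path (real n) (\<lambda>k. 2 / sqrt (real n) * sum s {..<k})"

text \<open>Freezing the path after \<open>L\<close> steps leaves a function of finitely many signs,
  to which the density comparison applies.\<close>

definition stopped_path :: "nat \<Rightarrow> nat \<Rightarrow> (nat \<Rightarrow> real) \<Rightarrow> real \<Rightarrow> real" where
  "stopped_path n L s = step_path (real n) (\<lambda>k. 2 / sqrt (real n) * sum s {..<min k L})"

text \<open>The mesh \<open>m\<^sup>-\<^sup>2\<close> on the horizon \<open>[0, m)\<close> makes both discretisation errors vanish as \<open>m \<rightarrow> \<infinity>\<close>.\<close>

definition grid_path :: "nat \<Rightarrow> (nat \<Rightarrow> real) \<Rightarrow> real \<Rightarrow> real" where
  "grid_path m y = step_path ((real m)\<^sup>2) (\<lambda>k. sum y {..<min k (m ^ 3)})"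

lemma path_cadlag [simp]:
  "walk_path n s \<in> cadlag_space" "stopped_path n L s \<in> cadlag_space" "grid_path m y \<in> cadlag_space"
  by (auto simp: walk_path_def stopped_path_def grid_path_def intro!: step_path_cadlag)

lemma lu_lipschitz_path_measurable:
  assumes "lu_lipschitz k G" and "\<And>i. f i \<in> borel_measurable M"
  shows "(\<lambda>\<omega>. G (walk_path n (\<lambda>i. f i \<omega>))) \<in> borel_measurable M"
    "(\<lambda>\<omega>. G (stopped_path n L (\<lambda>i. f i \<omega>))) \<in> borel_measurable M"
    "(\<lambda>\<omega>. G (grid_path m (\<lambda>i. f i \<omega>))) \<in> borel_measurable M"
proof -
  have *: "(\<lambda>\<omega>. G (step_path r (\<lambda>j. c * sum (\<lambda>i. f i \<omega>) {..<g j}))) \<in> borel_measurable M" if "r \<ge> 0" for r c g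
    using lu_lipschitz_step_path_measurable[OF assms(1) that, where p="\<lambda>s j. c * sum s {..<g j}", OF continuous_on_partial_sum assms(2)] .
  show "(\<lambda>\<omega>. G (walk_path n (\<lambda>i. f i \<omega>))) \<in> borel_measurable M"
    "(\<lambda>\<omega>. G (stopped_path n L (\<lambda>i. f i \<omega>))) \<in> borel_measurable M"
    "(\<lambda>\<omega>. G (grid_path m (\<lambda>i. f i \<omega>))) \<in> borel_measurable M"
    unfolding walk_path_def stopped_path_def grid_path_def
    by (rule *[OF of_nat_0_le_iff] *[of _ 1, simplified])+ simp
qed

lemma stopped_path_restrict: "stopped_path n L (\<lambda>i\<in>{..<L}. s i) = stopped_path n L s"
proof -
  have "sum (\<lambda>i\<in>{..<L}. s i) {..<min k L} = sum s {..<min k L}" for k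
    by (rule sum.cong) auto
  then show ?thesis by (simp add: stopped_path_def)
qed

lemma lu_dist_stopped_path: "lu_dist (walk_path n s) (stopped_path n (n * m) s) \<le> 1 / (1 + real m)"
proof -
  have "lu_dist (walk_path n s) (stopped_path n (n * m) s) \<le> 0 + 1 / (1 + real m)"
  proof (rule lu_dist_le_horizon)
    fix t :: real assume t: "0 \<le> t" "t < real m"
    have "real n * t \<le> real (n * m)" using t by (simp add: mult_left_mono)
    then have "nat \<lfloor>real n * t\<rfloor> \<le> n * m" by linarith
    then show "\<bar>walk_path n s t - stopped_path n (n * m) s t\<bar> \<le> 0"
      using t by (simp add: walk_path_def stopped_path_def step_path_def min_absorb1)
  qed auto
  then show ?thesis by simp
qed

text \<open>The step of the walk that corresponds to the real time j / m^2, rounded down.\<close>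

definition grid :: "nat \<Rightarrow> nat \<Rightarrow> nat \<Rightarrow> nat" where
  "grid m n j = n * j div m ^ 2"

lemma mono_grid: "mono (grid m n)"
  by (auto simp: grid_def mono_def intro!: div_le_mono)

lemma grid_bounds:
  assumes "m \<ge> 1"
  shows "real n * real j / (real m)\<^sup>2 - 1 < real (grid m n j)" "real (grid m n j) \<le> real n * real j / (real m)\<^sup>2"
proof -
  have "real (grid m n j) = real_of_int \<lfloor>real (n * j) / real (m ^ 2)\<rfloor>"
    unfolding grid_def floor_divide_of_nat_eq by simp
  then show "real n * real j / (real m)\<^sup>2 - 1 < real (grid m n j)" "real (grid m n j) \<le> real n * real j / (real m)\<^sup>2"
    by simp_all
qed

lemma grid_length_bounds:
  assumes "m \<ge> 1"
  shows "real n / (real m)\<^sup>2 - 1 \<le> real (grid m n (Suc j) - grid m n j)"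
    "real (grid m n (Suc j) - grid m n j) \<le> real n / (real m)\<^sup>2 + 1"
proof -
  have "grid m n j \<le> grid m n (Suc j)" using monoD[OF mono_grid] by simp
  moreover have "real n * real (Suc j) / (real m)\<^sup>2 = real n * real j / (real m)\<^sup>2 + real n / (real m)\<^sup>2"
    by (simp add: distrib_left add_divide_distrib)
  ultimately show "real n / (real m)\<^sup>2 - 1 \<le> real (grid m n (Suc j) - grid m n j)"
    "real (grid m n (Suc j) - grid m n j) \<le> real n / (real m)\<^sup>2 + 1"
    using grid_bounds[OF assms, of n j] grid_bounds[OF assms, of n "Suc j"] by linarith+
qed

text \<open>The block sums telescope, so the grid path at time t is the walk path at the left end of
  the block of t. The difference is the oscillation inside that block, and the threshold d sqrt n /
  2 undoes the scaling by 2 / sqrt n.\<close>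

lemma lu_dist_grid_path:
  assumes m: "m \<ge> 1" and n: "n \<ge> 1" and d: "d > 0"
    and osc: "\<And>j k. j < m ^ 3 \<Longrightarrow> k \<le> grid m n (Suc j) - grid m n j \<Longrightarrow>
      \<bar>\<Sum>i<k. s (grid m n j + i)\<bar> < d * sqrt (real n) / 2"
  shows "lu_dist (walk_path n s) (grid_path m (\<lambda>j. 2 / sqrt (real n) * (\<Sum>i = grid m n j..<grid m n (Suc j). s i)))
    \<le> d + 1 / (1 + real m)"
proof (rule lu_dist_le_horizon)
  fix t :: real assume t: "0 \<le> t" "t < real m"
  define j where "j = nat \<lfloor>(real m)\<^sup>2 * t\<rfloor>"
  define q where "q = nat \<lfloor>real n * t\<rfloor>"
  have m2: "(real m)\<^sup>2 > 0" using m by simp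
  have "0 \<le> (real m)\<^sup>2 * t" "0 \<le> real n * t" using t by auto
  then have j: "real j \<le> (real m)\<^sup>2 * t" "(real m)\<^sup>2 * t < real j + 1"
    and q: "real q \<le> real n * t" "real n * t < real q + 1"
    unfolding j_def q_def by linarith+
  have "(real m)\<^sup>2 * t < (real m)\<^sup>2 * real m" using t m by simp
  then have "real j < real (m ^ 3)" using j by (simp add: power2_eq_square power3_eq_cube)
  then have jm: "j < m ^ 3" by linarith
  have "real n * (real j / (real m)\<^sup>2) \<le> real n * t"
    using j m2 by (intro mult_left_mono) (auto simp: field_simps)
  \<comment> \<open>Both sides are integers and n j / m^2 <= n t < q + 1.\<close>
  then have 1: "grid m n j \<le> q"
    using grid_bounds(2)[OF m, of n j] q by simp
  have "real n * t \<le> real n * (real (Suc j) / (real m)\<^sup>2)"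
    using j m2 by (intro mult_left_mono) (auto simp: field_simps)
  \<comment> \<open>Here q <= n t <= n (j + 1) / m^2 < \<open>grid m n (Suc j)\<close> + 1. Equality
    can occur because of the rounding, which is why \<open>osc\<close> includes the full block
    length.\<close>
  then have 2: "q \<le> grid m n (Suc j)"
    using grid_bounds(1)[OF m, of n "Suc j"] q by simp
  have tele: "(\<Sum>j<l. \<Sum>i = grid m n j..<grid m n (Suc j). s i) = sum s {..<grid m n l}" for l
  proof (induction l)
    case 0
    then show ?case by (simp add: grid_def)
  next
    case (Suc l)
    have "grid m n l \<le> grid m n (Suc l)" using monoD[OF mono_grid] by simp
    then show ?case using Suc.IH
      by (simp add: lessThan_atLeast0 sum.atLeastLessThan_concat)
  qed
  have "sum s {..<q} = sum s {..<grid m n j} + sum s {grid m n j..<q}"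
    using 1 by (simp add: lessThan_atLeast0 sum.atLeastLessThan_concat)
  also have "sum s {grid m n j..<q} = (\<Sum>i<q - grid m n j. s (grid m n j + i))"
    using 1 sum.shift_bounds_nat_ivl[of s 0 "grid m n j" "q - grid m n j"]
    by (simp add: lessThan_atLeast0 add.commute)
  finally have q_sum: "sum s {..<q} = sum s {..<grid m n j} + (\<Sum>i<q - grid m n j. s (grid m n j + i))" .
  have wp: "walk_path n s t = 2 / sqrt (real n) * sum s {..<q}"
    using t by (simp add: walk_path_def step_path_def flip: q_def)
  have gp: "grid_path m (\<lambda>j. 2 / sqrt (real n) * (\<Sum>i = grid m n j..<grid m n (Suc j). s i)) t =
    2 / sqrt (real n) * sum s {..<grid m n j}"
    using t jm unfolding tele[symmetric] sum_distrib_left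
    by (simp add: grid_path_def step_path_def min_absorb1 flip: j_def)
  have diff: "walk_path n s t - grid_path m (\<lambda>j. 2 / sqrt (real n) * (\<Sum>i = grid m n j..<grid m n (Suc j). s i)) t
    = 2 / sqrt (real n) * (\<Sum>i<q - grid m n j. s (grid m n j + i))"
    unfolding wp gp q_sum distrib_left by simp
  have small: "\<bar>\<Sum>i<q - grid m n j. s (grid m n j + i)\<bar> < d * sqrt (real n) / 2"
    using osc[OF jm] 2 by simp
  show "\<bar>walk_path n s t - grid_path m (\<lambda>j. 2 / sqrt (real n) * (\<Sum>i = grid m n j..<grid m n (Suc j). s i)) t\<bar> \<le> d"
    unfolding diff abs_mult using small n by (simp add: field_simps)
qed (use d in auto)

text \<open>Off an event \<open>U\<close> where some block oscillates too much, the two paths are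
  close and the Lipschitz bound applies: one 1 / (1 + m) comes from stopping, the other from the
  horizon of the grid. On \<open>U\<close> the cost is at most 2 B.\<close>

lemma (in fair_signs) grid_comparison:
  assumes G: "lu_lipschitz k G" and k: "k \<ge> 0" and B: "\<And>x. x \<in> cadlag_space \<Longrightarrow> \<bar>G x\<bar> \<le> B"
    and m: "m \<ge> 1" and n: "n \<ge> m\<^sup>2" and d: "d > 0"
  shows "\<bar>(\<integral>\<omega>. G (stopped_path n (n * m) (\<lambda>i. \<epsilon> i \<omega>)) \<partial>M) -
     (\<integral>\<omega>. G (grid_path m (\<lambda>j. 2 / sqrt (real n) * (\<Sum>i = grid m n j..<grid m n (Suc j). \<epsilon> i \<omega>))) \<partial>M)\<bar>
    \<le> k * (d + 2 / (1 + real m)) + 384 * B / (real m * d ^ 4)"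
proof -
  have n1: "n \<ge> 1" using n m by (metis le_trans one_le_power)
  define c where "c = d * sqrt (real n) / 2"
  have c: "c > 0" using d n1 by (simp add: c_def)
  define gp where "gp \<omega> = grid_path m (\<lambda>j. 2 / sqrt (real n) * (\<Sum>i = grid m n j..<grid m n (Suc j). \<epsilon> i \<omega>))" for \<omega>
  define sp where "sp \<omega> = stopped_path n (n * m) (\<lambda>i. \<epsilon> i \<omega>)" for \<omega>
  define l where "l j = grid m n (Suc j) - grid m n j" for j
  define E where "E j = {\<omega>\<in>space M. \<exists>k\<le>l j. c \<le> \<bar>\<Sum>i<k. \<epsilon> (grid m n j + i) \<omega>\<bar>}" for j
  have E [measurable]: "E j \<in> sets M" for j unfolding E_def by measurable
  have probE: "prob (E j) \<le> 192 / (real m ^ 4 * d ^ 4)" for j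
  proof -
    have "prob (E j) \<le> 3 * (real (l j))\<^sup>2 / c ^ 4"
      unfolding E_def by (rule prob_maximal[OF c])
    \<comment> \<open>Since n >= m^2, the rounding error 1 of a block length is absorbed by doubling
      n / m^2. The factor n^2 then cancels against c^4, so the bound is uniform in n; 192 is 3 * 4 *
      16.\<close>
    also have "\<dots> \<le> 3 * (2 * real n / (real m)\<^sup>2)\<^sup>2 / c ^ 4"
    proof (intro divide_right_mono mult_left_mono power_mono)
      have "1 \<le> real n / (real m)\<^sup>2" using n m by (simp add: field_simps flip: of_nat_power)
      then show "real (l j) \<le> 2 * real n / (real m)\<^sup>2"
        using grid_length_bounds(2)[OF m, of n j] by (simp add: l_def)
    qed (use c in auto)
    also have "c ^ 4 = d ^ 4 * (real n)\<^sup>2 / 16"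
    proof -
      have "sqrt (real n) ^ 4 = ((sqrt (real n))\<^sup>2)\<^sup>2" by (simp only: power4_eq_xxxx power2_eq_square mult.assoc)
      then have "sqrt (real n) ^ 4 = (real n)\<^sup>2" by (simp only: real_sqrt_pow2[OF of_nat_0_le_iff])
      then show ?thesis by (simp add: c_def power_mult_distrib power_divide)
    qed
    also have "3 * (2 * real n / (real m)\<^sup>2)\<^sup>2 / (d ^ 4 * (real n)\<^sup>2 / 16) = 192 / (real m ^ 4 * d ^ 4)"
      using n1 m d by (simp add: field_simps power_mult_distrib power_divide flip: power_mult)
    finally show ?thesis .
  qed
  define U where "U = (\<Union>j<m ^ 3. E j)"
  have U [measurable]: "U \<in> sets M" unfolding U_def by measurable
  have "prob U \<le> (\<Sum>j<m ^ 3. prob (E j))"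
    unfolding U_def by (rule finite_measure_subadditive_finite) auto
  also have "\<dots> \<le> (\<Sum>j<m ^ 3. 192 / (real m ^ 4 * d ^ 4))" by (rule sum_mono) (rule probE)
  also have "\<dots> = 192 / (real m * d ^ 4)"
    using m d by (simp add: field_simps power_numeral_reduce)
  finally have probU: "prob U \<le> 192 / (real m * d ^ 4)" .
  have B0: "B \<ge> 0" using B[OF path_cadlag(1)] by (meson abs_ge_zero order_trans)
  have cad [simp]: "gp \<omega> \<in> cadlag_space" "sp \<omega> \<in> cadlag_space" for \<omega> by (auto simp: gp_def sp_def)
  have ms: "(\<lambda>\<omega>. G (sp \<omega>)) \<in> borel_measurable M"
    unfolding sp_def by (rule lu_lipschitz_path_measurable[OF G]) simp
  have mg: "(\<lambda>\<omega>. G (gp \<omega>)) \<in> borel_measurable M"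
    unfolding gp_def by (rule lu_lipschitz_path_measurable[OF G]) measurable
  have i_s: "integrable M (\<lambda>\<omega>. G (sp \<omega>))"
    by (rule integrable_const_bound[where B=B]) (use ms B in auto)
  have ig: "integrable M (\<lambda>\<omega>. G (gp \<omega>))"
    by (rule integrable_const_bound[where B=B]) (use mg B in auto)
  have pt: "\<bar>G (sp \<omega>) - G (gp \<omega>)\<bar> \<le> k * (d + 2 / (1 + real m)) + 2 * B * indicator U \<omega>"
    if \<omega>: "\<omega> \<in> space M" for \<omega>
  proof (cases "\<omega> \<in> U")
    case True
    have "0 \<le> k * (d + 2 / (1 + real m))" using k d by simp
    then show ?thesis using True B[OF cad(1), of \<omega>] B[OF cad(2), of \<omega>] by simp
  next
    case False
    have "lu_dist (walk_path n (\<lambda>i. \<epsilon> i \<omega>)) (gp \<omega>) \<le> d + 1 / (1 + real m)"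
      unfolding gp_def
    proof (rule lu_dist_grid_path[OF m n1 d])
      fix j k assume "j < m ^ 3" "k \<le> grid m n (Suc j) - grid m n j"
      then show "\<bar>\<Sum>i<k. \<epsilon> (grid m n j + i) \<omega>\<bar> < d * sqrt (real n) / 2"
        using False \<omega> unfolding U_def E_def l_def c_def by (fastforce simp: not_le)
    qed
    moreover have "lu_dist (walk_path n (\<lambda>i. \<epsilon> i \<omega>)) (sp \<omega>) \<le> 1 / (1 + real m)"
      unfolding sp_def by (rule lu_dist_stopped_path)
    ultimately have "lu_dist (sp \<omega>) (gp \<omega>) \<le> d + 2 / (1 + real m)"
      using lu_dist_triangle[of "sp \<omega>" "gp \<omega>" "walk_path n (\<lambda>i. \<epsilon> i \<omega>)"]
        lu_dist_commute[of "sp \<omega>" "walk_path n (\<lambda>i. \<epsilon> i \<omega>)"] by simp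
    then have "k * lu_dist (sp \<omega>) (gp \<omega>) \<le> k * (d + 2 / (1 + real m))"
      using k by (rule mult_left_mono)
    then show ?thesis using lu_lipschitzD[OF G cad(2) cad(1), of \<omega> \<omega>] False by simp
  qed
  have "\<bar>(\<integral>\<omega>. G (sp \<omega>) \<partial>M) - (\<integral>\<omega>. G (gp \<omega>) \<partial>M)\<bar> = \<bar>\<integral>\<omega>. G (sp \<omega>) - G (gp \<omega>) \<partial>M\<bar>"
    using i_s ig by simp
  also have "\<dots> \<le> (\<integral>\<omega>. \<bar>G (sp \<omega>) - G (gp \<omega>)\<bar> \<partial>M)" by (rule integral_abs_bound)
  also have "\<dots> \<le> (\<integral>\<omega>. k * (d + 2 / (1 + real m)) + 2 * B * indicator U \<omega> \<partial>M)"
    by (rule integral_mono) (use i_s ig pt in \<open>auto simp: emeasure_eq_measure\<close>)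
  also have "\<dots> = k * (d + 2 / (1 + real m)) + 2 * B * prob U"
    by (subst Bochner_Integration.integral_add) (auto simp: emeasure_eq_measure prob_space)
  also have "\<dots> \<le> k * (d + 2 / (1 + real m)) + 2 * B * (192 / (real m * d ^ 4))"
    using probU B0 by (intro add_left_mono mult_left_mono) auto
  finally show ?thesis by (simp add: sp_def gp_def)
qed

text \<open>Over a time m^-2 the standard deviation is 1 / m. This puts the increments in the form
  that \<open>block_sums_converge\<close> expects of its Gaussian limits.\<close>

lemma distr_brownian_increment:
  assumes BM: "standard_brownian_motion N W" and "m \<ge> 1"
  shows "distr N borel (\<lambda>\<omega>. 2 * (W (real (Suc j) / (real m)\<^sup>2) \<omega> - W (real j / (real m)\<^sup>2) \<omega>)) =
    distr std_normal_distribution borel (\<lambda>x. 2 / real m * x)"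
proof -
  interpret prob_space N using BM by (simp add: standard_brownian_motion_def)
  define D where "D \<omega> = W (real (Suc j) / (real m)\<^sup>2) \<omega> - W (real j / (real m)\<^sup>2) \<omega>" for \<omega>
  have m0: "real m > 0" using assms by simp
  then have lt: "real j / (real m)\<^sup>2 < real (Suc j) / (real m)\<^sup>2" by (simp add: field_simps)
  have "real (Suc j) / (real m)\<^sup>2 - real j / (real m)\<^sup>2 = (1 / real m)\<^sup>2"
    by (simp add: power_divide flip: diff_divide_distrib)
  then have sq: "sqrt (real (Suc j) / (real m)\<^sup>2 - real j / (real m)\<^sup>2) = 1 / real m"
    using m0 by simp
  have "\<forall>s t. 0 \<le> s \<longrightarrow> s < t \<longrightarrow>
        distributed N lborel (\<lambda>\<omega>. W t \<omega> - W s \<omega>) (\<lambda>x. ennreal (normal_density 0 (sqrt (t - s)) x))"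
    using BM unfolding standard_brownian_motion_def by blast
  from this[rule_format, OF _ lt] have "distributed N lborel D (normal_density 0 (1 / real m))"
    unfolding sq D_def[abs_def] by simp
  then have "distributed N lborel (\<lambda>x. (D x - 0) / (1 / real m)) std_normal_density"
    using m0 by (subst (asm) normal_standard_normal_convert) auto
  then have dist: "distr N lborel (\<lambda>x. real m * D x) = density lborel std_normal_density"
    and meas: "(\<lambda>x. real m * D x) \<in> measurable N lborel"
    by (auto simp: distributed_def mult.commute)
  have [measurable]: "(\<lambda>x. real m * D x) \<in> borel_measurable N" using meas by simp
  have "distr N borel (\<lambda>x. real m * D x) = distr N lborel (\<lambda>x. real m * D x)"
    by (rule distr_cong) auto
  then have std: "distr N borel (\<lambda>x. real m * D x) = std_normal_distribution" using dist by simp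
  have "distr N borel (\<lambda>\<omega>. 2 * D \<omega>) = distr N borel (\<lambda>\<omega>. 2 / real m * (real m * D \<omega>))"
    using m0 by simp
  also have "\<dots> = distr (distr N borel (\<lambda>x. real m * D x)) borel (\<lambda>x. 2 / real m * x)"
    by (subst distr_distr) (auto simp: o_def)
  finally show ?thesis unfolding std unfolding D_def .
qed

lemma (in fair_signs) grid_path_converges:
  assumes BM: "standard_brownian_motion N W" and m: "m \<ge> 1"
    and G: "lu_lipschitz k G" and B: "\<And>x. x \<in> cadlag_space \<Longrightarrow> \<bar>G x\<bar> \<le> B"
  shows "(\<lambda>n. \<integral>\<omega>. G (grid_path m (\<lambda>j. 2 / sqrt (real n) * (\<Sum>i = grid m n j..<grid m n (Suc j). \<epsilon> i \<omega>))) \<partial>M)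
    \<longlonglongrightarrow> (\<integral>\<omega>. G (grid_path m (\<lambda>j. 2 * (W (real (Suc j) / (real m)\<^sup>2) \<omega> - W (real j / (real m)\<^sup>2) \<omega>))) \<partial>N)"
\<comment> \<open>m^3 cells of length m^-2 cover [0, m). The scale 2 / sqrt n times the root of a
  block length of about n / m^2 tends to 2 / m.\<close>
proof (rule block_sums_converge[where J="m ^ 3" and v="2 / real m" and B=B])
  show N: "prob_space N" using BM by (simp add: standard_brownian_motion_def)
  interpret N: prob_space N by (rule N)
  have m0: "(real m)\<^sup>2 > 0" using m by simp
  have "N.indep_vars (\<lambda>_. borel) (\<lambda>j \<omega>. W (real (Suc j) / (real m)\<^sup>2) \<omega> - W (real j / (real m)\<^sup>2) \<omega>) {..<m ^ 3}"
  proof -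
    have "\<forall>(\<tau> :: nat \<Rightarrow> real) m. 0 \<le> \<tau> 0 \<longrightarrow> strict_mono_on {..m} \<tau> \<longrightarrow>
        N.indep_vars (\<lambda>_. borel) (\<lambda>i \<omega>. W (\<tau> (Suc i)) \<omega> - W (\<tau> i) \<omega>) {..<m}"
      using BM by (simp add: standard_brownian_motion_def)
    from this[rule_format, of "\<lambda>j. real j / (real m)\<^sup>2" "m ^ 3"] show ?thesis
      using m0 by (simp add: strict_mono_on_def divide_strict_right_mono)
  qed
  then show "N.indep_vars (\<lambda>_. borel) (\<lambda>j \<omega>. 2 * (W (real (Suc j) / (real m)\<^sup>2) \<omega> - W (real j / (real m)\<^sup>2) \<omega>)) {..<m ^ 3}"
    by (rule N.indep_vars_compose2[where Y="\<lambda>_ x. 2 * x"]) simp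
  show "distr N borel (\<lambda>\<omega>. 2 * (W (real (Suc j) / (real m)\<^sup>2) \<omega> - W (real j / (real m)\<^sup>2) \<omega>)) =
    distr std_normal_distribution borel (\<lambda>x. 2 / real m * x)" for j
    by (rule distr_brownian_increment[OF BM m])
  show "mono (grid m n)" for n by (rule mono_grid)
  show "filterlim (\<lambda>n. grid m n (Suc j) - grid m n j) at_top sequentially" for j
    unfolding filterlim_sequentially_iff_filterlim_real
  proof -
    show "filterlim (\<lambda>n. real (grid m n (Suc j) - grid m n j)) at_top sequentially"
    proof (rule filterlim_at_top_mono)
      show "filterlim (\<lambda>n. real n / (real m)\<^sup>2 - 1) at_top sequentially"
        using m0 by real_asymp
      show "\<forall>\<^sub>F n in sequentially. real n / (real m)\<^sup>2 - 1 \<le> real (grid m n (Suc j) - grid m n j)"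
        using grid_length_bounds(1)[OF m] by simp
    qed
  qed
  show "(\<lambda>n. 2 / sqrt (real n) * sqrt (real (grid m n (Suc j) - grid m n j))) \<longlonglongrightarrow> 2 / real m" for j
  proof -
    have "(\<lambda>n. real (grid m n (Suc j) - grid m n j) / real n) \<longlonglongrightarrow> 1 / (real m)\<^sup>2"
    proof (rule tendsto_sandwich)
      show "\<forall>\<^sub>F n in sequentially. (real n / (real m)\<^sup>2 - 1) / real n \<le> real (grid m n (Suc j) - grid m n j) / real n"
        using grid_length_bounds(1)[OF m] by (intro always_eventually allI divide_right_mono) auto
      show "\<forall>\<^sub>F n in sequentially. real (grid m n (Suc j) - grid m n j) / real n \<le> (real n / (real m)\<^sup>2 + 1) / real n"
        using grid_length_bounds(2)[OF m] by (intro always_eventually allI divide_right_mono) auto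
      show "(\<lambda>n. (real n / (real m)\<^sup>2 - 1) / real n) \<longlonglongrightarrow> 1 / (real m)\<^sup>2"
        "(\<lambda>n. (real n / (real m)\<^sup>2 + 1) / real n) \<longlonglongrightarrow> 1 / (real m)\<^sup>2"
        using m0 by (real_asymp simp: inverse_eq_divide)+
    qed
    then have "(\<lambda>n. 2 * sqrt (real (grid m n (Suc j) - grid m n j) / real n)) \<longlonglongrightarrow> 2 * sqrt (1 / (real m)\<^sup>2)"
      by (rule tendsto_mult_left[OF tendsto_real_sqrt])
    then show ?thesis using m by (simp add: real_sqrt_divide)
  qed
  show "continuous_on UNIV (\<lambda>y. G (grid_path m y))"
    unfolding grid_path_def by (rule lu_lipschitz_step_path_continuous[OF G]) (auto intro!: continuous_on_partial_sum[of 1, simplified])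
  show "\<bar>G (grid_path m y)\<bar> \<le> B" for y by (rule B) simp
  show "G (grid_path m y) = G (grid_path m y')" if "\<And>j. j < m ^ 3 \<Longrightarrow> y j = y' j" for y y'
  proof -
    have "sum y {..<min k (m ^ 3)} = sum y' {..<min k (m ^ 3)}" for k
      by (rule sum.cong) (use that in auto)
    then show ?thesis by (simp add: grid_path_def)
  qed
qed

text \<open>By continuity of the paths the functional is a pointwise limit of functionals of step
  paths, each of which samples W at countably many times.\<close>

lemma brownian_path_measurable:
  assumes BM: "standard_brownian_motion N W" and G: "lu_lipschitz k G"
  shows "(\<lambda>\<omega>. G (\<lambda>t\<in>{0..}. 2 * W t \<omega>)) \<in> borel_measurable N"
proof (rule borel_measurable_LIMSEQ_real)
  have cont: "continuous_on {0..} (\<lambda>t. 2 * W t \<omega>)" if "\<omega> \<in> space N" for \<omega>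
    using BM that by (auto simp: standard_brownian_motion_def intro!: continuous_intros)
  show "(\<lambda>m. G (step_path ((real m)\<^sup>2) (\<lambda>k. 2 * W (real k / (real m)\<^sup>2) \<omega>))) \<longlonglongrightarrow> G (\<lambda>t\<in>{0..}. 2 * W t \<omega>)"
    if "\<omega> \<in> space N" for \<omega>
    by (rule lu_lipschitz_tendsto[OF G step_path_approx[OF cont[OF that]]])
       (auto intro!: step_path_cadlag continuous_cadlag[OF cont[OF that]])
  show "(\<lambda>\<omega>. G (step_path ((real m)\<^sup>2) (\<lambda>k. 2 * W (real k / (real m)\<^sup>2) \<omega>))) \<in> borel_measurable N" for m
    by (rule lu_lipschitz_step_path_measurable[OF G, where p="\<lambda>s. s"])
       (use BM in \<open>auto simp: standard_brownian_motion_def intro!: borel_measurable_times continuous_on_product_coordinates\<close>)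
qed

text \<open>Before time m the grid path coincides almost surely with the sampled Brownian path, so
  the error splits into the tail after m and the sampling error.\<close>

lemma brownian_grid_path_tendsto:
  assumes BM: "standard_brownian_motion N W"
    and G: "lu_lipschitz k G" and B: "\<And>x. x \<in> cadlag_space \<Longrightarrow> \<bar>G x\<bar> \<le> B"
  shows "(\<lambda>m. \<integral>\<omega>. G (grid_path m (\<lambda>j. 2 * (W (real (Suc j) / (real m)\<^sup>2) \<omega> - W (real j / (real m)\<^sup>2) \<omega>))) \<partial>N)
    \<longlonglongrightarrow> (\<integral>\<omega>. G (\<lambda>t\<in>{0..}. 2 * W t \<omega>) \<partial>N)"
proof (rule integral_dominated_convergence[where w="\<lambda>_. B"])
  interpret prob_space N using BM by (simp add: standard_brownian_motion_def)
  have Wm: "W t \<in> borel_measurable N" if "t \<ge> 0" for t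
    using BM that by (simp add: standard_brownian_motion_def)
  show "(\<lambda>\<omega>. G (\<lambda>t\<in>{0..}. 2 * W t \<omega>)) \<in> borel_measurable N"
    by (rule brownian_path_measurable[OF BM G])
  show "(\<lambda>\<omega>. G (grid_path m (\<lambda>j. 2 * (W (real (Suc j) / (real m)\<^sup>2) \<omega> - W (real j / (real m)\<^sup>2) \<omega>)))) \<in> borel_measurable N" for m
    by (rule lu_lipschitz_path_measurable[OF G]) (auto intro!: borel_measurable_times borel_measurable_diff Wm)
  show "integrable N (\<lambda>_. B)" by simp
  show "AE \<omega> in N. norm (G (grid_path m (\<lambda>j. 2 * (W (real (Suc j) / (real m)\<^sup>2) \<omega> - W (real j / (real m)\<^sup>2) \<omega>)))) \<le> B" for m
    using B by simp
  have "AE \<omega> in N. W 0 \<omega> = 0" using BM by (simp add: standard_brownian_motion_def)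
  then show "AE \<omega> in N. (\<lambda>m. G (grid_path m (\<lambda>j. 2 * (W (real (Suc j) / (real m)\<^sup>2) \<omega> - W (real j / (real m)\<^sup>2) \<omega>)))) \<longlonglongrightarrow>
    G (\<lambda>t\<in>{0..}. 2 * W t \<omega>)"
    using AE_space
  proof eventually_elim
    case (elim \<omega>)
    have cont: "continuous_on {0..} (\<lambda>t. 2 * W t \<omega>)"
      using BM elim by (auto simp: standard_brownian_motion_def intro!: continuous_intros)
    define gp where "gp m = grid_path m (\<lambda>j. 2 * (W (real (Suc j) / (real m)\<^sup>2) \<omega> - W (real j / (real m)\<^sup>2) \<omega>))" for m
    define ap where "ap m = step_path ((real m)\<^sup>2) (\<lambda>k. 2 * W (real k / (real m)\<^sup>2) \<omega>)" for m
    have near: "lu_dist (gp m) (ap m) \<le> 1 / (1 + real m)" for m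
    proof -
      have "lu_dist (gp m) (ap m) \<le> 0 + 1 / (1 + real m)"
      proof (rule lu_dist_le_horizon)
        fix t :: real assume t: "0 \<le> t" "t < real m"
        \<comment> \<open>The only place where W 0 = 0 enters: without it the increments would
          rebuild W - W 0.\<close>
        have tele: "(\<Sum>j<l. 2 * (W (real (Suc j) / (real m)\<^sup>2) \<omega> - W (real j / (real m)\<^sup>2) \<omega>)) = 2 * W (real l / (real m)\<^sup>2) \<omega>" for l
          using sum_lessThan_telescope[of "\<lambda>j. W (real j / (real m)\<^sup>2) \<omega>" l] elim
          by (simp only: sum_distrib_left[symmetric]) simp
        have "(real m)\<^sup>2 * t \<le> (real m)\<^sup>2 * real m" using t by (intro mult_left_mono) auto
        also have "\<dots> = real (m ^ 3)" by (simp add: power2_eq_square power3_eq_cube)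
        finally have "nat \<lfloor>(real m)\<^sup>2 * t\<rfloor> \<le> m ^ 3" by linarith
        then show "\<bar>gp m t - ap m t\<bar> \<le> 0"
          using t tele by (simp add: gp_def ap_def grid_path_def step_path_def min_absorb1)
      qed auto
      then show ?thesis by simp
    qed
    have "(\<lambda>m. lu_dist (gp m) (\<lambda>t\<in>{0..}. 2 * W t \<omega>)) \<longlonglongrightarrow> 0"
    proof (rule tendsto_sandwich[OF _ _ tendsto_const])
      show "(\<lambda>m. 1 / (1 + real m) + lu_dist (ap m) (\<lambda>t\<in>{0..}. 2 * W t \<omega>)) \<longlonglongrightarrow> 0"
      proof (rule tendsto_add_zero)
        show "(\<lambda>m. 1 / (1 + real m)) \<longlonglongrightarrow> 0" by real_asymp
        show "(\<lambda>m. lu_dist (ap m) (\<lambda>t\<in>{0..}. 2 * W t \<omega>)) \<longlonglongrightarrow> 0"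
          unfolding ap_def by (rule step_path_approx[OF cont])
      qed
      show "\<forall>\<^sub>F m in sequentially. lu_dist (gp m) (\<lambda>t\<in>{0..}. 2 * W t \<omega>) \<le>
        1 / (1 + real m) + lu_dist (ap m) (\<lambda>t\<in>{0..}. 2 * W t \<omega>)"
      proof (intro always_eventually allI)
        fix m
        show "lu_dist (gp m) (\<lambda>t\<in>{0..}. 2 * W t \<omega>) \<le> 1 / (1 + real m) + lu_dist (ap m) (\<lambda>t\<in>{0..}. 2 * W t \<omega>)"
          using lu_dist_triangle[of "gp m" "\<lambda>t\<in>{0..}. 2 * W t \<omega>" "ap m"] near[of m] by linarith
      qed
    qed (auto intro!: always_eventually lu_dist_nonneg)
    then show ?case
      unfolding gp_def by (rule lu_lipschitz_tendsto[OF G]) (auto intro!: continuous_cadlag[OF cont])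
  qed
qed

text \<open>On |X 0| <= d K / sqrt n the quantity L (x^2 + 4 L) / K^2 is at most m d^2 + (2 m n /
  K)^2 for L = n m. With m fixed, both hypotheses can then be exploited at one common small level
  \<open>d\<close>.\<close>

lemma walk_compare_tendsto:
  fixes K :: "nat \<Rightarrow> nat" and M :: "nat \<Rightarrow> 'a measure"
  assumes K_pos: "\<And>n. K n \<ge> 1"
    and n_over_K: "(\<lambda>n. real n / real (K n)) \<longlonglongrightarrow> 0"
    and walk: "\<And>n. cube_walk (M n) (K n) (Y n) (\<xi> n)"
    and init: "\<And>e. e > 0 \<Longrightarrow>
      (\<lambda>n. measure (M n) {\<omega>\<in>space (M n). \<bar>sqrt (real n) / real (K n) * walk_sum (K n) (Y n) 0 \<omega>\<bar> > e}) \<longlonglongrightarrow> 0"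
    and G: "lu_lipschitz k G" and B: "\<And>x. x \<in> cadlag_space \<Longrightarrow> \<bar>G x\<bar> \<le> B" and m: "m \<ge> 1"
  shows "(\<lambda>n. (\<integral>\<omega>. G (stopped_path n (n * m) (\<lambda>i. half_step (K n) (Y n) i \<omega>)) \<partial>M n) -
    sign_avg (n * m) (\<lambda>s. G (stopped_path n (n * m) s))) \<longlonglongrightarrow> 0"
proof (rule tendstoI)
  fix e' :: real assume "e' > 0"
  have B0: "B \<ge> 0" using B[OF path_cadlag(1)] by (meson abs_ge_zero order_trans)
  \<comment> \<open>The denominator B + 1 ensures B e < e' also when B is 0.\<close>
  define e where "e = e' / (B + 1)"
  have e: "e > 0" using \<open>e' > 0\<close> B0 by (simp add: e_def)
  have m0: "real m \<ge> 1" using m by simp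
  \<comment> \<open>At most 1/4 so that the initial value and the displacement 2 n m each stay below
    K / 4. At most e / (28 m) because \<eta> will be at most 14 m d, which uses up half of
    \<open>e\<close>; the bad initial event takes the other half.\<close>
  define d where "d = min (1 / 4) (e / (28 * real m))"
  have d: "d > 0" "d \<le> 1 / 4" "14 * real m * d \<le> e / 2"
    using e m0 by (auto simp: d_def min_def field_simps)
  have "d / (2 * real m) > 0" using d m0 by simp
  with n_over_K have "\<forall>\<^sub>F n in sequentially. real n / real (K n) < d / (2 * real m)"
    by (rule order_tendstoD)
  moreover have "\<forall>\<^sub>F n in sequentially.
    measure (M n) {\<omega>\<in>space (M n). \<bar>sqrt (real n) / real (K n) * walk_sum (K n) (Y n) 0 \<omega>\<bar> > d} < e / 4"
    by (rule order_tendstoD[OF init[OF d(1)]]) (use e in simp)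
  moreover have "\<forall>\<^sub>F n in sequentially. n \<ge> (1 :: nat)" by (rule eventually_ge_at_top)
  ultimately show "\<forall>\<^sub>F n in sequentially. dist ((\<integral>\<omega>. G (stopped_path n (n * m) (\<lambda>i. half_step (K n) (Y n) i \<omega>)) \<partial>M n) -
    sign_avg (n * m) (\<lambda>s. G (stopped_path n (n * m) s))) 0 < e'"
  proof eventually_elim
    case (elim n)
    interpret cube_walk "M n" "K n" "Y n" "\<xi> n" by (rule walk)
    define q where "q = real n / real (K n)"
    have Kn: "real (K n) > 0" using assms(1)[of n] by simp
    have n1: "real n \<ge> 1" "sqrt (real n) \<ge> 1" using elim by simp_all
    have q: "0 \<le> q" "2 * real m * q \<le> d" using elim(1) m0 Kn by (auto simp: q_def field_simps)
    define r where "r = d * real (K n) / sqrt (real n)"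
    define h where "h s = G (stopped_path n (n * m) s)" for s
    \<comment> \<open>The bound of \<open>sign_avg_walk_density_L1\<close> with 2 m d^2 as its error
      and \<open>d\<close> again as its splitting level, which makes the quotient linear in
      d.\<close>
    define \<eta> where "\<eta> = 2 * (d + (2 * real m * d\<^sup>2) / d + 2 * (2 * real m * d\<^sup>2))"
    have bad: "{\<omega>\<in>space (M n). \<bar>X 0 \<omega>\<bar> > r} =
      {\<omega>\<in>space (M n). \<bar>sqrt (real n) / real (K n) * X 0 \<omega>\<bar> > d}"
      using Kn n1 by (auto simp: r_def abs_mult field_simps)
    have "\<bar>(\<integral>\<omega>. h (\<lambda>i\<in>{..<n * m}. \<sigma> i \<omega>) \<partial>M n) - sign_avg (n * m) h\<bar> \<le>
      B * (\<eta> + 2 * prob {\<omega>\<in>space (M n). \<bar>X 0 \<omega>\<bar> > r})"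
    proof (rule expectation_compare_signs)
      show "\<bar>h s\<bar> \<le> B" for s unfolding h_def by (rule B) simp
      show "(\<lambda>\<omega>. h (\<lambda>i\<in>{..<n * m}. \<sigma> i \<omega>)) \<in> borel_measurable (M n)"
        unfolding h_def stopped_path_restrict by (rule lu_lipschitz_path_measurable[OF G]) simp
      show "\<eta> \<ge> 0" using d m0 by (simp add: \<eta>_def)
      fix x assume x: "\<bar>x\<bar> \<le> r"
      show "sign_avg (n * m) (\<lambda>s. \<bar>walk_density (real (K n)) x (n * m) s - 1\<bar>) \<le> \<eta>"
        unfolding \<eta>_def
      proof (rule sign_avg_walk_density_L1[OF Kn _ d(1)])
        have "r \<le> d * real (K n)"
          unfolding r_def using divide_left_mono[of 1 "sqrt (real n)" "d * real (K n)"] n1 d Kn by simp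
        moreover have "2 * real (n * m) = (2 * real m * q) * real (K n)" using Kn by (simp add: q_def)
        moreover have "(2 * real m * q) * real (K n) \<le> d * real (K n)" using q Kn by (intro mult_right_mono) auto
        moreover have "d * real (K n) \<le> 1 / 4 * real (K n)" using d Kn by (intro mult_right_mono) auto
        ultimately show "\<bar>x\<bar> + 2 * real (n * m) \<le> real (K n) / 2" using x by linarith
        have "x\<^sup>2 \<le> r\<^sup>2" using x by (metis abs_ge_zero power2_abs power_mono)
        then have "real (n * m) * (x\<^sup>2 + 4 * real (n * m)) / (real (K n))\<^sup>2 \<le>
          real (n * m) * (r\<^sup>2 + 4 * real (n * m)) / (real (K n))\<^sup>2"
          by (intro divide_right_mono mult_left_mono) auto
        also have "\<dots> = real m * d\<^sup>2 + (2 * real m * q)\<^sup>2"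
          using Kn n1 by (simp add: r_def q_def power_mult_distrib power_divide field_simps power2_eq_square)
        also have "\<dots> \<le> real m * d\<^sup>2 + d\<^sup>2" using q m0 by (intro add_left_mono power_mono) auto
        also have "\<dots> \<le> real m * d\<^sup>2 + real m * d\<^sup>2"
          using m0 by (intro add_left_mono) (simp add: mult_le_cancel_right1)
        finally show "real (n * m) * (x\<^sup>2 + 4 * real (n * m)) / (real (K n))\<^sup>2 \<le> 2 * real m * d\<^sup>2" by simp
      qed
    qed
    also have "\<dots> \<le> B * e"
    proof (rule mult_left_mono[OF _ B0])
      have "d\<^sup>2 \<le> d" using d by (simp add: power2_eq_square mult_le_cancel_left1)
      then have "8 * (real m * d\<^sup>2) \<le> 8 * (real m * d)" using m0 by simp
      moreover have "2 * d \<le> 2 * (real m * d)" using m0 d by simp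
      moreover have "\<eta> = 2 * d + 4 * (real m * d) + 8 * (real m * d\<^sup>2)"
        using d by (simp add: \<eta>_def power2_eq_square)
      ultimately have "\<eta> \<le> 14 * real m * d" unfolding mult.assoc by linarith
      then show "\<eta> + 2 * prob {\<omega>\<in>space (M n). \<bar>X 0 \<omega>\<bar> > r} \<le> e"
        unfolding bad using elim(2) d(3) by linarith
    qed
    also have "B * e < e'" using \<open>e' > 0\<close> B0 by (simp add: e_def field_simps)
    finally show ?case unfolding h_def[abs_def] stopped_path_restrict by (simp add: dist_real_def)
  qed
qed

text \<open>A chain of comparisons: stopping (\<open>s1\<close>), fair signs (\<open>s2\<close>),
  discretisation (\<open>s3\<close>), the central limit theorem (\<open>s4\<close>), refinement of
  the Brownian grid (\<open>s5\<close>). \<open>s1\<close> and \<open>s3\<close> are uniform in n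
  (the latter for n >= m^2), which allows m to be fixed before n grows.\<close>

lemma walk_paths_converge_lipschitz:
  fixes K :: "nat \<Rightarrow> nat" and M :: "nat \<Rightarrow> 'a measure"
  assumes K_pos: "\<And>n. K n \<ge> 1"
    and n_over_K: "(\<lambda>n. real n / real (K n)) \<longlonglongrightarrow> 0"
    and walk: "\<And>n. cube_walk (M n) (K n) (Y n) (\<xi> n)"
    and init: "\<And>e. e > 0 \<Longrightarrow>
      (\<lambda>n. measure (M n) {\<omega>\<in>space (M n). \<bar>sqrt (real n) / real (K n) * walk_sum (K n) (Y n) 0 \<omega>\<bar> > e}) \<longlonglongrightarrow> 0"
    and BM: "standard_brownian_motion N W"
    and G: "lu_lipschitz k G" and k: "k \<ge> 0" and B: "\<And>x. x \<in> cadlag_space \<Longrightarrow> \<bar>G x\<bar> \<le> B"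
  shows "(\<lambda>n. \<integral>\<omega>. G (walk_path n (\<lambda>i. half_step (K n) (Y n) i \<omega>)) \<partial>M n) \<longlonglongrightarrow>
    (\<integral>\<omega>. G (\<lambda>t\<in>{0..}. 2 * W t \<omega>) \<partial>N)"
proof (rule tendstoI)
  fix e :: real assume e: "e > 0"
  have B0: "B \<ge> 0" using B[OF path_cadlag(1)] by (meson abs_ge_zero order_trans)
  obtain C :: "(nat \<Rightarrow> real) measure" and \<epsilon> where "fair_signs C \<epsilon>" using fair_signs_exist by blast
  then interpret C: fair_signs C \<epsilon> .
  define a where "a n = (\<integral>\<omega>. G (walk_path n (\<lambda>i. half_step (K n) (Y n) i \<omega>)) \<partial>M n)" for n
  define a1 where "a1 m n = (\<integral>\<omega>. G (stopped_path n (n * m) (\<lambda>i. half_step (K n) (Y n) i \<omega>)) \<partial>M n)" for m n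
  define a2 where "a2 m n = sign_avg (n * m) (\<lambda>s. G (stopped_path n (n * m) s))" for m n
  define a3 where "a3 m n = (\<integral>\<omega>. G (grid_path m (\<lambda>j. 2 / sqrt (real n) * (\<Sum>i = grid m n j..<grid m n (Suc j). \<epsilon> i \<omega>))) \<partial>C)" for m n
  define a4 where "a4 m = (\<integral>\<omega>. G (grid_path m (\<lambda>j. 2 * (W (real (Suc j) / (real m)\<^sup>2) \<omega> - W (real j / (real m)\<^sup>2) \<omega>))) \<partial>N)" for m
  define a5 where "a5 = (\<integral>\<omega>. G (\<lambda>t\<in>{0..}. 2 * W t \<omega>) \<partial>N)"
  have s1: "\<bar>a n - a1 m n\<bar> \<le> k / (1 + real m)" for m n
  proof -
    interpret cube_walk "M n" "K n" "Y n" "\<xi> n" by (rule walk)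
    have i1: "integrable (M n) (\<lambda>\<omega>. G (walk_path n (\<lambda>i. \<sigma> i \<omega>)))"
      by (rule integrable_const_bound[where B=B]) (use B lu_lipschitz_path_measurable(1)[OF G \<sigma>_measurable] in auto)
    have i2: "integrable (M n) (\<lambda>\<omega>. G (stopped_path n (n * m) (\<lambda>i. \<sigma> i \<omega>)))"
      by (rule integrable_const_bound[where B=B]) (use B lu_lipschitz_path_measurable(2)[OF G \<sigma>_measurable] in auto)
    have "\<bar>a n - a1 m n\<bar> = \<bar>\<integral>\<omega>. G (walk_path n (\<lambda>i. \<sigma> i \<omega>)) - G (stopped_path n (n * m) (\<lambda>i. \<sigma> i \<omega>)) \<partial>M n\<bar>"
      using i1 i2 by (simp add: a_def a1_def)
    also have "\<dots> \<le> (\<integral>\<omega>. \<bar>G (walk_path n (\<lambda>i. \<sigma> i \<omega>)) - G (stopped_path n (n * m) (\<lambda>i. \<sigma> i \<omega>))\<bar> \<partial>M n)"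
      by (rule integral_abs_bound)
    also have "\<dots> \<le> (\<integral>\<omega>. k / (1 + real m) \<partial>M n)"
    proof (rule integral_mono)
      fix \<omega>
      have "\<bar>G (walk_path n (\<lambda>i. \<sigma> i \<omega>)) - G (stopped_path n (n * m) (\<lambda>i. \<sigma> i \<omega>))\<bar> \<le>
        k * lu_dist (walk_path n (\<lambda>i. \<sigma> i \<omega>)) (stopped_path n (n * m) (\<lambda>i. \<sigma> i \<omega>))"
        by (rule lu_lipschitzD[OF G]) auto
      also have "\<dots> \<le> k * (1 / (1 + real m))"
        by (intro mult_left_mono lu_dist_stopped_path k)
      finally show "\<bar>G (walk_path n (\<lambda>i. \<sigma> i \<omega>)) - G (stopped_path n (n * m) (\<lambda>i. \<sigma> i \<omega>))\<bar> \<le> k / (1 + real m)"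
        by simp
    qed (use i1 i2 in auto)
    finally show ?thesis by (simp add: prob_space)
  qed
  have s2: "(\<lambda>n. a1 m n - a2 m n) \<longlonglongrightarrow> 0" if "m \<ge> 1" for m
    unfolding a1_def a2_def by (rule walk_compare_tendsto[OF K_pos n_over_K walk init G B that])
  have s23: "a2 m n = (\<integral>\<omega>. G (stopped_path n (n * m) (\<lambda>i. \<epsilon> i \<omega>)) \<partial>C)" for m n
    unfolding a2_def
    by (subst C.expectation_eq_sign_avg[symmetric])
       (auto simp: stopped_path_restrict intro!: lu_lipschitz_path_measurable[OF G])
  \<comment> \<open>Chosen before m, because the term with m d^4 in its denominator vanishes only
    for fixed d. The summand 1 covers k = 0.\<close>
  define d where "d = e / (8 * (k + 1))"
  have d: "d > 0" "k * d \<le> e / 8" using e k by (auto simp: d_def field_simps)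
  have s3: "\<bar>a2 m n - a3 m n\<bar> \<le> k * (d + 2 / (1 + real m)) + 384 * B / (real m * d ^ 4)"
    if "m \<ge> 1" "n \<ge> m\<^sup>2" for m n
    unfolding s23 a3_def by (rule C.grid_comparison[OF G k B that d(1)])
  have s4: "a3 m \<longlonglongrightarrow> a4 m" if "m \<ge> 1" for m
    unfolding a3_def[abs_def] a4_def by (rule C.grid_path_converges[OF BM that G B])
  have s5: "a4 \<longlonglongrightarrow> a5"
    unfolding a4_def[abs_def] a5_def by (rule brownian_grid_path_tendsto[OF BM G B])
  \<comment> \<open>The 3 collects one tail from \<open>s1\<close> and two from
    \<open>s3\<close>.\<close>
  have "(\<lambda>m. k * (3 / (1 + real m)) + 384 * B / (real m * d ^ 4)) \<longlonglongrightarrow> 0"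
    using d by real_asymp
  then have "\<forall>\<^sub>F m in sequentially. k * (3 / (1 + real m)) + 384 * B / (real m * d ^ 4) < e / 8"
    by (rule order_tendstoD) (use e in simp)
  moreover have "\<forall>\<^sub>F m in sequentially. dist (a4 m) a5 < e / 8"
    by (rule tendstoD[OF s5]) (use e in simp)
  moreover have "\<forall>\<^sub>F m in sequentially. m \<ge> (1 :: nat)" by (rule eventually_ge_at_top)
  ultimately have "\<forall>\<^sub>F m in sequentially. k * (3 / (1 + real m)) + 384 * B / (real m * d ^ 4) < e / 8 \<and>
      dist (a4 m) a5 < e / 8 \<and> m \<ge> 1"
    by eventually_elim simp
  then obtain m where m: "k * (3 / (1 + real m)) + 384 * B / (real m * d ^ 4) < e / 8"
      "dist (a4 m) a5 < e / 8" "m \<ge> 1"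
    by (auto simp: eventually_sequentially)
  have "\<forall>\<^sub>F n in sequentially. dist (a1 m n - a2 m n) 0 < e / 8"
    by (rule tendstoD[OF s2[OF m(3)]]) (use e in simp)
  moreover have "\<forall>\<^sub>F n in sequentially. dist (a3 m n) (a4 m) < e / 8"
    by (rule tendstoD[OF s4[OF m(3)]]) (use e in simp)
  moreover have "\<forall>\<^sub>F n in sequentially. n \<ge> m\<^sup>2" by (rule eventually_ge_at_top)
  ultimately have "\<forall>\<^sub>F n in sequentially. dist (a n) a5 < e"
  proof eventually_elim
    case (elim n)
    have "k * (d + 2 / (1 + real m)) + k / (1 + real m) = k * d + k * (3 / (1 + real m))"
      using distrib_left[of k d "2 * (1 / (1 + real m))"] by simp
    then show ?case
      using elim m s1[of n m] s3[OF m(3) elim(3)] d(2) e unfolding dist_real_def by linarith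
  qed
  then show "\<forall>\<^sub>F n in sequentially. dist (\<integral>\<omega>. G (walk_path n (\<lambda>i. half_step (K n) (Y n) i \<omega>)) \<partial>M n)
    (\<integral>\<omega>. G (\<lambda>t\<in>{0..}. 2 * W t \<omega>) \<partial>N) < e"
    unfolding a_def a5_def .
qed

theorem theorem3:
  fixes K :: "nat \<Rightarrow> nat"
    and M :: "nat \<Rightarrow> 'a measure"
    and \<mu> :: "nat \<Rightarrow> (nat \<Rightarrow> int) measure"
    and Y :: "nat \<Rightarrow> nat \<Rightarrow> 'a \<Rightarrow> nat \<Rightarrow> int"
    and N :: "'b measure"
    and W :: "real \<Rightarrow> 'b \<Rightarrow> real"
  assumes K_pos: "\<And>n. K n \<ge> 1"
    and K_at_top: "filterlim K at_top sequentially"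
    and n_over_K: "(\<lambda>n. real n / real (K n)) \<longlonglongrightarrow> 0"
    and walk: "\<And>k. k \<ge> 1 \<Longrightarrow> hypercube_walk (M k) k (\<mu> k) (Y k)"
    and init: "converges_in_prob_zero (\<lambda>n. M (K n))
                 (\<lambda>n \<omega>. sqrt (real n) / real (K n) * X_proc (Y (K n)) n (K n) 0 \<omega>)"
    and BM: "standard_brownian_motion N W"
  shows "converges_in_distribution skorokhod_topology
           (\<lambda>n. M (K n))
           (\<lambda>n \<omega>. \<lambda>t\<in>{0..}.
              1 / sqrt (real n) * (X_proc (Y (K n)) n (K n) t \<omega> - X_proc (Y (K n)) n (K n) 0 \<omega>))
           N (\<lambda>\<omega>. \<lambda>t\<in>{0..}. 2 * W t \<omega>)"
proof -
  have "\<exists>\<xi>. cube_walk (M (K n)) (K n) (Y (K n)) \<xi>" for n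
    using hypercube_walk_imp_cube_walk[OF walk[OF K_pos] K_pos, of n] by blast
  then obtain \<xi> where cw: "\<And>n. cube_walk (M (K n)) (K n) (Y (K n)) (\<xi> n)" by metis
  \<comment> \<open>Cancels the halving of the increments against the factor 2 in
    \<open>walk_path\<close>.\<close>
  have half: "2 / c * (y / 2) = 1 / c * y" for c y :: real by simp
  have Z_eq: "(\<lambda>t\<in>{0..}. 1 / sqrt (real n) * (X_proc (Y (K n)) n (K n) t \<omega> - X_proc (Y (K n)) n (K n) 0 \<omega>)) =
    walk_path n (\<lambda>i. half_step (K n) (Y (K n)) i \<omega>)" for n \<omega>
    unfolding walk_path_def step_path_def sum_half_step half X_proc_def walk_sum_def by simp
  have init': "(\<lambda>n. measure (M (K n)) {\<omega>\<in>space (M (K n)).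
      \<bar>sqrt (real n) / real (K n) * walk_sum (K n) (Y (K n)) 0 \<omega>\<bar> > e}) \<longlonglongrightarrow> 0" if "e > 0" for e
    using init that by (simp add: converges_in_prob_zero_def X_proc_def walk_sum_def)
  show ?thesis
    unfolding Z_eq
  proof (rule converges_in_distribution_skorokhodI)
    show "prob_space (M (K n))" for n using cw[of n] by (simp add: cube_walk_def)
    show "prob_space N" using BM by (simp add: standard_brownian_motion_def)
    show "(\<lambda>t\<in>{0..}. 2 * W t \<omega>) \<in> cadlag_space" if "\<omega> \<in> space N" for \<omega>
      using BM that by (intro continuous_cadlag) (auto simp: standard_brownian_motion_def intro!: continuous_intros)
    fix k G assume G: "lu_lipschitz k G"
    show "(\<lambda>\<omega>. G (walk_path n (\<lambda>i. half_step (K n) (Y (K n)) i \<omega>))) \<in> borel_measurable (M (K n))" for n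
      by (rule lu_lipschitz_path_measurable[OF G]) (rule cube_walk.\<sigma>_measurable[OF cw])
    show "(\<lambda>\<omega>. G (\<lambda>t\<in>{0..}. 2 * W t \<omega>)) \<in> borel_measurable N"
      by (rule brownian_path_measurable[OF BM G])
    show "(\<lambda>n. \<integral>\<omega>. G (walk_path n (\<lambda>i. half_step (K n) (Y (K n)) i \<omega>)) \<partial>M (K n)) \<longlonglongrightarrow>
      (\<integral>\<omega>. G (\<lambda>t\<in>{0..}. 2 * W t \<omega>) \<partial>N)" if "k \<ge> 0" "\<And>x. x \<in> cadlag_space \<Longrightarrow> \<bar>G x\<bar> \<le> B" for B
      by (rule walk_paths_converge_lipschitz[OF K_pos n_over_K cw init' BM G that])
  qed simp
qed

end
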